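(* Let $G$ be a permutation group of degree $n\ne 3$. If $\alpha_{2,1}(G)=\lfloor n/2\rfloor$, then $e(G)\le\lfloor n/2\rfloor+\nu$, where $\nu=\sum_{j\ge0}\bigl(1-\prod_{l\ge1}(1-2^{-(j+l)})\bigr)\approx 1.606695$.
   Context: $\alpha_{2,1}(G)$ is the number of complemented chief factors of order $2$ in a chief series of $G$. $e(G)$ is the expected number of uniformly random elements of $G$, drawn independently with replacement, needed until they generate $G$; equivalently $e(G)=\sum_{n\ge0}(1-P_G(n))$ with $P_G(n)$ the probability that $n$ random elements generate $G$. *)

theory Defs
  imports "HOL-Analysis.Analysis" "HOL-Algebra.Algebra"
begin

definition is_chief_series :: "('a, 'b) monoid_scheme \<Rightarrow> 'a set list \<Rightarrow> bool" where
  "is_chief_series G Ns \<longleftrightarrow>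
     Ns \<noteq> [] \<and> hd Ns = {\<one>\<^bsub>G\<^esub>} \<and> last Ns = carrier G \<and>
     (\<forall>i < length Ns. Ns ! i \<lhd> G) \<and>
     (\<forall>i. Suc i < length Ns \<longrightarrow>
        Ns ! i \<subset> Ns ! Suc i \<and>
        \<not> (\<exists>M. M \<lhd> G \<and> Ns ! i \<subset> M \<and> M \<subset> Ns ! Suc i))"

definition compl_factor_order2 :: "('a, 'b) monoid_scheme \<Rightarrow> 'a set list \<Rightarrow> nat \<Rightarrow> bool" where
  "compl_factor_order2 G Ns i \<longleftrightarrow>
     card (Ns ! Suc i) = 2 * card (Ns ! i) \<and>
     (\<exists>K. subgroup K G \<and> K <#>\<^bsub>G\<^esub> (Ns ! Suc i) = carrier G \<and> K \<inter> Ns ! Suc i = Ns ! i)"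

definition count_compl_order2 :: "('a, 'b) monoid_scheme \<Rightarrow> 'a set list \<Rightarrow> nat" where
  "count_compl_order2 G Ns = card {i. Suc i < length Ns \<and> compl_factor_order2 G Ns i}"

definition alpha21 :: "('a, 'b) monoid_scheme \<Rightarrow> nat" where
  "alpha21 G = count_compl_order2 G (SOME Ns. is_chief_series G Ns)"

definition gen_prob :: "('a, 'b) monoid_scheme \<Rightarrow> nat \<Rightarrow> real" where
  "gen_prob G k =
     real (card {f \<in> {..<k} \<rightarrow>\<^sub>E carrier G. generate G (f ` {..<k}) = carrier G})
     / real (card (carrier G)) ^ k"

definition expected_gen :: "('a, 'b) monoid_scheme \<Rightarrow> real" where
  "expected_gen G = suminf (\<lambda>k. 1 - gen_prob G k)"

definition nu_const :: real where
  "nu_const = suminf (\<lambda>j. 1 - prodinf (\<lambda>l. 1 - 1 / (2::real) ^ (j + Suc l)))"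

end

theory Submission
  imports Defs
begin

text \<open>
  Let \<open>S\<close> be the subgroup generated by the squares of \<open>G\<close>, so that \<open>G / S\<close> is the largest elementary
  abelian 2-quotient. Each complemented chief factor of order 2 is visible in \<open>G / S\<close>, hence
  \<open>2 ^ \<alpha> \<le> |G : S|\<close>. On the other hand a 2-group \<open>T\<close> of permutations of \<open>n\<close> points satisfies
  \<open>|T : sq T| \<le> 2 ^ \<lfloor>n / 2\<rfloor>\<close>; applied to a Sylow 2-subgroup \<open>T\<close> of \<open>G\<close> this forces equality everywhere,
  in particular \<open>T \<inter> S = sq T\<close>. By Tate's theorem \<open>G\<close> then has a normal complement \<open>K\<close> to \<open>T\<close>,
  of odd order. Because \<open>T\<close> attains the bound, it cannot act faithfully after two points are removed, and this
  leaves only \<open>|K| = 1\<close> and \<open>|K| = 3\<close>, where in the second case \<open>K\<close> is generated by a 3-cycle. A tuple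
  generating \<open>G\<close> modulo \<open>S\<close> therefore generates \<open>G\<close>, unless it lies in one of the three point stabilizers of
  index 3. The probability of generation is thus at least \<open>\<Prod>i<d. (1 - 2 ^ i / 2 ^ k)\<close> times
  \<open>1 - 3 / 3 ^ k\<close> (or 1), with \<open>d = \<lfloor>n / 2\<rfloor>\<close>, and the sum over \<open>k\<close> is compared with the one defining
  \<open>\<nu>\<close>; for \<open>n = 3\<close> this comparison fails.
\<close>


section \<open>Finite groups, actions and subgroups of squares\<close>

text \<open>The orbits and block systems of a faithful action are in general not faithful. The bound
  for a 2-group is therefore proved in the relative form
  \<open>|T : sq T <#> C| \<le> 2 ^ (|D| div 2)\<close> with \<open>C\<close> the kernel of the
  action, and such bounds are multiplied along a chain of kernels. Equality is rigid because
  removing points lowers the exponent. It forces every orbit that an odd normalized subgroup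
  \<open>K\<close> moves to contain a point fixed by \<open>T\<close>, and it leaves
  \<open>T\<close> at most one fixed point. So \<open>K\<close> is regular on the points that it
  moves, where \<open>T\<close> acts as it does on \<open>K\<close> by conjugation. The same bound,
  applied to the pairs \<open>{k, inv k}\<close>, leaves \<open>|K| \<le> 5\<close>; order 5 fails
  because its automorphism group is cyclic of order 4, not elementary abelian. The exception
  \<open>n = 3\<close> comes from the symmetric group itself: there
  \<open>P(k) = (1 - 1/2^k) (1 - 3/3^k)\<close>, so \<open>e = 2 + 4.5 - 3.6 = 2.9\<close>, while
  \<open>1 + \<nu> < 2.61\<close>.\<close>

lemma card_fibers:
  assumes "finite A" and "\<And>b. b \<in> f ` A \<Longrightarrow> card {a \<in> A. f a = b} = c"
  shows "card A = c * card (f ` A)"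
proof -
  have "card A = (\<Sum>b\<in>f ` A. card {a \<in> A. f a = b})"
    using assms(1) sum.image_gen[of A "\<lambda>_. 1::nat" f] by simp
  then show ?thesis using assms(2) by simp
qed

lemma card_fibers_le:
  assumes "finite A" and "\<And>b. b \<in> f ` A \<Longrightarrow> card {a \<in> A. f a = b} \<le> c"
  shows "card A \<le> c * card (f ` A)"
proof -
  have "card A = (\<Sum>b\<in>f ` A. card {a \<in> A. f a = b})"
    using assms(1) sum.image_gen[of A "\<lambda>_. 1::nat" f] by simp
  also have "\<dots> \<le> (\<Sum>b\<in>f ` A. c)" by (intro sum_mono assms(2))
  finally show ?thesis by (simp add: mult.commute)
qed

locale fin_group = group G for G (structure) +
  assumes fin: "finite (carrier G)"
begin

lemma inv_mult_cancel [simp]: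
  "x \<in> carrier G \<Longrightarrow> y \<in> carrier G \<Longrightarrow> inv x \<otimes> (x \<otimes> y) = y"
  "x \<in> carrier G \<Longrightarrow> y \<in> carrier G \<Longrightarrow> x \<otimes> (inv x \<otimes> y) = y"
  by (simp_all add: m_assoc [symmetric])

lemmas group_word = m_assoc inv_mult_group

lemma conj_eq_one:
  assumes "t \<in> carrier G" "x \<in> carrier G" "t \<otimes> x \<otimes> inv t = \<one>"
  shows "x = \<one>"
proof -
  have "x = inv t \<otimes> (t \<otimes> x \<otimes> inv t) \<otimes> t" using assms(1,2) by (simp add: group_word)
  then show ?thesis unfolding assms(3) using assms(1) by simp
qed

text \<open>For a 2-group this is the Frattini subgroup. Squares suffice as generators, since
  commutators are products of squares.\<close>

definition sq :: "'a set \<Rightarrow> 'a set" where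
  "sq T = generate G ((\<lambda>t. t \<otimes> t) ` T)"

abbreviation (input) conjg :: "'a \<Rightarrow> 'a \<Rightarrow> 'a" where
  "conjg g x \<equiv> g \<otimes> x \<otimes> inv g"

definition normalizes :: "'a set \<Rightarrow> 'a set \<Rightarrow> bool" where
  "normalizes T N \<longleftrightarrow> (\<forall>t\<in>T. \<forall>x\<in>N. conjg t x \<in> N)"

text \<open>Nothing is required of \<open>\<phi>\<close> outside \<open>T\<close> and
  \<open>D\<close>, so one function serves for all subgroups of \<open>T\<close> and all invariant
  subsets of \<open>D\<close>.\<close>

definition acts :: "'a set \<Rightarrow> ('a \<Rightarrow> 'c \<Rightarrow> 'c) \<Rightarrow> 'c set \<Rightarrow> bool" where
  "acts T \<phi> D \<longleftrightarrow> (\<forall>t\<in>T. \<forall>x\<in>D. \<phi> t x \<in> D) \<and>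
     (\<forall>t\<in>T. \<forall>s\<in>T. \<forall>x\<in>D. \<phi> (t \<otimes> s) x = \<phi> t (\<phi> s x)) \<and> (\<forall>x\<in>D. \<phi> \<one> x = x)"

text \<open>The pointwise stabilizer: the kernel when \<open>D\<close> is the whole domain, a point
  stabilizer when it is a singleton.\<close>

definition fixer :: "'a set \<Rightarrow> ('a \<Rightarrow> 'c \<Rightarrow> 'c) \<Rightarrow> 'c set \<Rightarrow> 'a set" where
  "fixer T \<phi> D = {t \<in> T. \<forall>x\<in>D. \<phi> t x = x}"

lemma sub_fin: "subgroup A G \<Longrightarrow> finite A"
  using fin finite_subset subgroup.subset by blast

lemma sub_pos: "subgroup A G \<Longrightarrow> card A > 0"
  using subgroup.finite_imp_card_positive fin by blast

lemma subD:
  assumes "subgroup A G"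
  shows "x \<in> A \<Longrightarrow> x \<in> carrier G" "\<one> \<in> A" "x \<in> A \<Longrightarrow> y \<in> A \<Longrightarrow> x \<otimes> y \<in> A" "x \<in> A \<Longrightarrow> inv x \<in> A"
  using assms by (auto simp: subgroup_def subgroup.m_inv_closed)

lemma sub_carrier: "subgroup (carrier G) G"
  by (rule subgroup_self)

lemma sub_card_dvd:
  assumes "subgroup A G" "subgroup B G" "A \<subseteq> B"
  shows "card A dvd card B"
proof -
  interpret H: group "G\<lparr>carrier := B\<rparr>" using assms(2) by (rule subgroup.subgroup_is_group) (rule is_group)
  have "subgroup A (G\<lparr>carrier := B\<rparr>)" using assms by (simp add: subgroup_incl)
  from H.lagrange[OF this] have "card (rcosets\<^bsub>G\<lparr>carrier := B\<rparr>\<^esub> A) * card A = card B" by (simp add: order_def)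
  then show ?thesis by (metis dvd_triv_right)
qed

section \<open>Products of subgroups\<close>

lemma set_mult_iff: "x \<in> A <#> B \<longleftrightarrow> (\<exists>a\<in>A. \<exists>b\<in>B. x = a \<otimes> b)"
  by (auto simp: set_mult_def)

text \<open>The fibre of multiplication over \<open>x \<otimes> y\<close> consists of the pairs
  \<open>(x \<otimes> d, inv d \<otimes> y)\<close> with \<open>d\<close> in the
  intersection.\<close>

lemma set_mult_card:
  assumes A: "subgroup A G" and B: "subgroup B G"
  shows "card (A <#> B) * card (A \<inter> B) = card A * card B"
proof -
  note a = subD[OF A] and b = subD[OF B]
  let ?f = "\<lambda>(a,b). a \<otimes> b"
  have im: "?f ` (A \<times> B) = A <#> B" by (auto simp: set_mult_def)
  have "card (A \<times> B) = card (A \<inter> B) * card (?f ` (A \<times> B))"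
  proof (rule card_fibers)
    show "finite (A \<times> B)" using A B sub_fin by blast
    fix c assume "c \<in> ?f ` (A \<times> B)"
    then obtain x y where xy: "x \<in> A" "y \<in> B" "c = x \<otimes> y" by auto
    have "bij_betw (\<lambda>d. (x \<otimes> d, inv d \<otimes> y)) (A \<inter> B) {p \<in> A \<times> B. ?f p = c}"
      unfolding bij_betw_def
    proof
      show "inj_on (\<lambda>d. (x \<otimes> d, inv d \<otimes> y)) (A \<inter> B)"
        using xy a(1) by (auto simp: inj_on_def)
      show "(\<lambda>d. (x \<otimes> d, inv d \<otimes> y)) ` (A \<inter> B) = {p \<in> A \<times> B. ?f p = c}"
      proof (safe, goal_cases)
        case (1 _ d) then show ?case using xy a by auto
      next
        case (2 _ d) then show ?case using xy b by auto
      next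
        case (3 _ d) then show ?case using xy a(1) b(1) by (simp add: group_word)
      next
        case (4 u v)
        then have c: "u \<in> carrier G" "v \<in> carrier G" "x \<in> carrier G" "y \<in> carrier G" using xy a b by auto
        have e: "u \<otimes> v = x \<otimes> y" using 4 xy by simp
        have u: "u = x \<otimes> y \<otimes> inv v" using e c by (simp add: inv_solve_right)
        have uv: "inv x \<otimes> u = y \<otimes> inv v" unfolding u using c by (simp add: m_assoc)
        have "y \<otimes> inv v \<in> B" "inv x \<otimes> u \<in> A" using 4 xy a b by simp_all
        then have "inv x \<otimes> u \<in> A \<inter> B" using uv by simp
        moreover have "(u, v) = (x \<otimes> (inv x \<otimes> u), inv (inv x \<otimes> u) \<otimes> y)"
          unfolding uv using c by (simp add: u group_word)
        ultimately show ?case by blast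
      qed
    qed
    then show "card {p \<in> A \<times> B. ?f p = c} = card (A \<inter> B)"
      by (simp add: bij_betw_same_card)
  qed
  then show ?thesis by (simp add: im card_cartesian_product mult.commute)
qed

lemma normalizes_mono: "normalizes T N \<Longrightarrow> S \<subseteq> T \<Longrightarrow> normalizes S N"
  by (auto simp: normalizes_def)

lemma set_mult_subgroup:
  assumes N: "subgroup N G" and A: "subgroup A G" and n: "normalizes A N"
  shows "subgroup (N <#> A) G"
proof (rule subgroupI)
  note a = subD[OF A] and b = subD[OF N]
  show "N <#> A \<subseteq> carrier G" using a b by (auto simp: set_mult_def)
  show "N <#> A \<noteq> {}" using a(2) b(2) by (auto simp: set_mult_def)
  fix x assume "x \<in> N <#> A"
  then obtain u v where x: "x = u \<otimes> v" "u \<in> N" "v \<in> A" by (auto simp: set_mult_def)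
  have "inv v \<otimes> inv u \<otimes> inv (inv v) \<in> N" using n x a(4) b(4) unfolding normalizes_def by blast
  moreover have "inv x = (inv v \<otimes> inv u \<otimes> inv (inv v)) \<otimes> inv v" using x a b by (simp add: group_word)
  ultimately show "inv x \<in> N <#> A" using x(3) a(4) unfolding set_mult_iff by blast
  fix y assume "y \<in> N <#> A"
  then obtain u' v' where y: "y = u' \<otimes> v'" "u' \<in> N" "v' \<in> A" by (auto simp: set_mult_def)
  have "conjg v u' \<in> N" using n x y by (simp add: normalizes_def)
  then have "u \<otimes> (conjg v u') \<in> N" using b x by blast
  moreover have "v \<otimes> v' \<in> A" using x y a by simp
  moreover have "x \<otimes> y = (u \<otimes> (conjg v u')) \<otimes> (v \<otimes> v')" using x y a b by (simp add: group_word)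
  ultimately show "x \<otimes> y \<in> N <#> A" unfolding set_mult_iff by blast
qed

lemma set_mult_upper:
  assumes "subgroup N G" "subgroup A G" shows "N \<subseteq> N <#> A" "A \<subseteq> N <#> A"
proof -
  note a = subD[OF assms(1)] and b = subD[OF assms(2)]
  show "N \<subseteq> N <#> A"
  proof fix x assume "x \<in> N" then show "x \<in> N <#> A" using a b(2) unfolding set_mult_iff by (metis r_one) qed
  show "A \<subseteq> N <#> A"
  proof fix x assume "x \<in> A" then show "x \<in> N <#> A" using b a(2) unfolding set_mult_iff by (metis l_one) qed
qed

lemma set_mult_least: "subgroup B G \<Longrightarrow> N \<subseteq> B \<Longrightarrow> A \<subseteq> B \<Longrightarrow> N <#> A \<subseteq> B"
  unfolding set_mult_def by (auto intro: subD(3))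

lemma sub_Int: "subgroup A G \<Longrightarrow> subgroup B G \<Longrightarrow> subgroup (A \<inter> B) G"
  by (rule subgroups_Inter_pair)

section \<open>The subgroup generated by the squares\<close>

lemma sq_sub: "subgroup T G \<Longrightarrow> subgroup (sq T) G"
  unfolding sq_def by (rule generate_is_subgroup) (auto dest: subD(1))

lemma sq_least:
  assumes "subgroup B G" and "\<And>t. t \<in> T \<Longrightarrow> t \<otimes> t \<in> B"
  shows "sq T \<subseteq> B"
  unfolding sq_def by (rule generate_subgroup_incl) (use assms in auto)

lemma sq_mem: "t \<in> T \<Longrightarrow> t \<otimes> t \<in> sq T"
  unfolding sq_def by (auto intro: generate.incl)

lemma sq_subset: "subgroup T G \<Longrightarrow> sq T \<subseteq> T"
  by (rule sq_least) (auto dest: subD(3))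

lemma sq_mono: "subgroup T G \<Longrightarrow> subgroup S G \<Longrightarrow> S \<subseteq> T \<Longrightarrow> sq S \<subseteq> sq T"
  by (rule sq_least) (auto simp: sq_sub sq_mem)

lemma conj_subgroup_vimage:
  assumes A: "subgroup A G" and g: "g \<in> carrier G"
  shows "subgroup {x \<in> carrier G. conjg g x \<in> A} G"
proof (rule subgroupI)
  note a = subD[OF A]
  show "{x \<in> carrier G. conjg g x \<in> A} \<noteq> {}" using g a by (auto intro!: exI[of _ \<one>])
  fix x assume x: "x \<in> {x \<in> carrier G. conjg g x \<in> A}"
  then have "inv (conjg g x) \<in> A" using a by blast
  then show "inv x \<in> {x \<in> carrier G. conjg g x \<in> A}" using x g by (simp add: group_word)
  fix y assume y: "y \<in> {x \<in> carrier G. conjg g x \<in> A}"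
  then have "(conjg g x) \<otimes> (conjg g y) \<in> A" using x a by blast
  then show "x \<otimes> y \<in> {x \<in> carrier G. conjg g x \<in> A}" using x y g by (simp add: group_word)
qed auto

lemma sq_normalized:
  assumes T: "subgroup T G" and S: "subgroup S G" and n: "normalizes S T"
  shows "normalizes S (sq T)"
  unfolding normalizes_def
proof (intro ballI)
  fix s x assume s: "s \<in> S" and x: "x \<in> sq T"
  have sc: "s \<in> carrier G" using S s subD by blast
  have "sq T \<subseteq> {x \<in> carrier G. conjg s x \<in> sq T}"
  proof (rule sq_least)
    show "subgroup {x \<in> carrier G. conjg s x \<in> sq T} G"
      by (rule conj_subgroup_vimage) (use T sc sq_sub in auto)
    fix t assume t: "t \<in> T"
    then have tc: "t \<in> carrier G" using T subD by blast
    have "conjg s t \<in> T" using n s t by (simp add: normalizes_def)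
    then have "(conjg s t) \<otimes> (conjg s t) \<in> sq T" by (rule sq_mem)
    then show "t \<otimes> t \<in> {x \<in> carrier G. conjg s x \<in> sq T}"
      using sc tc by (simp add: group_word)
  qed
  then show "conjg s x \<in> sq T" using x by auto
qed

lemma normalizes_self: "subgroup T G \<Longrightarrow> normalizes T T"
  by (simp add: normalizes_def subD)

lemma sq_normalized_self: "subgroup T G \<Longrightarrow> normalizes T (sq T)"
  by (intro sq_normalized normalizes_self)

lemma normalizes_Int: "normalizes T A \<Longrightarrow> normalizes T B \<Longrightarrow> normalizes T (A \<inter> B)"
  by (simp add: normalizes_def)

text \<open>The identity \<open>a b a^-1 b^-1 = a^2 (a^-1 b)^2 b^-2\<close> writes a commutator as a
  product of three squares, so the quotient by \<open>sq T\<close> is abelian.\<close>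

lemma sq_comm:
  assumes T: "subgroup T G" and ab: "a \<in> T" "b \<in> T"
  shows "conjg a b \<otimes> inv b \<in> sq T"
proof -
  note t = subD[OF T] and s = subD[OF sq_sub[OF T]]
  have c: "a \<in> carrier G" "b \<in> carrier G" using ab t by auto
  have "(a \<otimes> a) \<otimes> ((inv a \<otimes> b) \<otimes> (inv a \<otimes> b)) \<otimes> (inv b \<otimes> inv b) \<in> sq T"
    using ab by (intro s sq_mem t)
  then show ?thesis using c by (simp add: group_word)
qed

text \<open>\<open>A\<close> is the preimage of a subgroup of the abelian group
  \<open>T / sq T\<close>, hence normal in \<open>T\<close>.\<close>

lemma sq_normalizes_over:
  assumes T: "subgroup T G" and A: "subgroup A G" and "sq T \<subseteq> A" "A \<subseteq> T"
  shows "normalizes T A"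
  unfolding normalizes_def
proof (intro ballI)
  fix t a assume ta: "t \<in> T" "a \<in> A"
  then have c: "t \<in> carrier G" "a \<in> carrier G" using T A subD by blast+
  have "conjg t a \<otimes> inv a \<in> A" using sq_comm[OF T] ta assms by blast
  then have "conjg t a \<otimes> inv a \<otimes> a \<in> A" using ta A subD by blast
  then show "conjg t a \<in> A" using c by (simp add: group_word)
qed

section \<open>Actions, stabilizers and orbits\<close>

lemma actsD:
  assumes "acts T \<phi> D"
  shows "t \<in> T \<Longrightarrow> x \<in> D \<Longrightarrow> \<phi> t x \<in> D"
    "t \<in> T \<Longrightarrow> s \<in> T \<Longrightarrow> x \<in> D \<Longrightarrow> \<phi> (t \<otimes> s) x = \<phi> t (\<phi> s x)" "x \<in> D \<Longrightarrow> \<phi> \<one> x = x"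
  using assms by (auto simp: acts_def)

lemma acts_inv:
  assumes T: "subgroup T G" and a: "acts T \<phi> D" and t: "t \<in> T" and x: "x \<in> D"
  shows "\<phi> (inv t) (\<phi> t x) = x" "\<phi> t (\<phi> (inv t) x) = x"
proof -
  have "t \<in> carrier G" "inv t \<in> T" using T t subD by blast+
  then show "\<phi> (inv t) (\<phi> t x) = x" "\<phi> t (\<phi> (inv t) x) = x"
    using actsD(2)[OF a, of "inv t" t x] actsD(2)[OF a, of t "inv t" x] actsD(3)[OF a x] t x by auto
qed

lemma acts_inj:
  assumes T: "subgroup T G" and a: "acts T \<phi> D" and t: "t \<in> T" and "x \<in> D" "y \<in> D" "\<phi> t x = \<phi> t y"
  shows "x = y"
  using acts_inv(1)[OF T a t] assms by metis

lemma acts_subset: "acts T \<phi> D \<Longrightarrow> S \<subseteq> T \<Longrightarrow> Y \<subseteq> D \<Longrightarrow> (\<And>t x. t \<in> S \<Longrightarrow> x \<in> Y \<Longrightarrow> \<phi> t x \<in> Y) \<Longrightarrow> acts S \<phi> Y"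
  unfolding acts_def by blast

lemma acts_mono: "acts T \<phi> D \<Longrightarrow> S \<subseteq> T \<Longrightarrow> acts S \<phi> D"
  unfolding acts_def by blast

lemma fixer_sub:
  assumes T: "subgroup T G" and a: "acts T \<phi> D" and "Y \<subseteq> D"
  shows "subgroup (fixer T \<phi> Y) G"
proof (rule subgroupI)
  note t = subD[OF T]
  show "fixer T \<phi> Y \<subseteq> carrier G" using t by (auto simp: fixer_def)
  show "fixer T \<phi> Y \<noteq> {}" using t assms actsD(3)[OF a] by (auto simp: fixer_def intro!: exI[of _ \<one>])
  fix x assume x: "x \<in> fixer T \<phi> Y"
  then have xT: "x \<in> T" by (simp add: fixer_def)
  have "\<phi> (inv x) z = z" if "z \<in> Y" for z
    using x that acts_inv(1)[OF T a xT, of z] assms(3) by (auto simp: fixer_def)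
  then show "inv x \<in> fixer T \<phi> Y" using t(4)[OF xT] by (simp add: fixer_def)
  fix y assume y: "y \<in> fixer T \<phi> Y"
  then have yT: "y \<in> T" by (simp add: fixer_def)
  have "\<phi> (x \<otimes> y) z = z" if "z \<in> Y" for z
    using x y that actsD(2)[OF a xT yT, of z] assms(3) by (auto simp: fixer_def)
  then show "x \<otimes> y \<in> fixer T \<phi> Y" using t(3)[OF xT yT] by (simp add: fixer_def)
qed

lemma fixer_normalized:
  assumes T: "subgroup T G" and a: "acts T \<phi> D" and "Y \<subseteq> D" "\<And>t x. t \<in> T \<Longrightarrow> x \<in> Y \<Longrightarrow> \<phi> t x \<in> Y"
  shows "normalizes T (fixer T \<phi> Y)"
  unfolding normalizes_def
proof (intro ballI)
  note tt = subD[OF T]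
  fix t s assume t: "t \<in> T" and s: "s \<in> fixer T \<phi> Y"
  then have s': "s \<in> T" "\<And>y. y \<in> Y \<Longrightarrow> \<phi> s y = y" by (auto simp: fixer_def)
  have aY: "acts T \<phi> Y" using acts_subset[OF a] assms by blast
  show "conjg t s \<in> fixer T \<phi> Y"
    unfolding fixer_def
  proof (safe)
    show "conjg t s \<in> T" using t s'(1) tt by simp
    fix y assume y: "y \<in> Y"
    have "\<phi> (conjg t s) y = \<phi> t (\<phi> s (\<phi> (inv t) y))"
      using actsD[OF aY] t s' tt y by simp
    also have "\<dots> = y" using s'(2)[OF actsD(1)[OF aY tt(4)[OF t] y]] acts_inv(2)[OF T aY t y] by simp
    finally show "\<phi> (conjg t s) y = y" .
  qed
qed

lemma orbit_stab:
  assumes T: "subgroup T G" and a: "acts T \<phi> D" and x: "x \<in> D"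
  shows "card T = card (fixer T \<phi> {x}) * card ((\<lambda>t. \<phi> t x) ` T)"
proof (rule card_fibers)
  note tt = subD[OF T]
  show "finite T" using T sub_fin by blast
  fix y assume "y \<in> (\<lambda>t. \<phi> t x) ` T"
  then obtain s where s: "s \<in> T" "y = \<phi> s x" by auto
  have "bij_betw (\<lambda>t. s \<otimes> t) (fixer T \<phi> {x}) {t \<in> T. \<phi> t x = y}"
    unfolding bij_betw_def
  proof
    show "inj_on (\<lambda>t. s \<otimes> t) (fixer T \<phi> {x})" using s tt by (auto simp: inj_on_def fixer_def)
    show "(\<lambda>t. s \<otimes> t) ` fixer T \<phi> {x} = {t \<in> T. \<phi> t x = y}"
    proof (safe, goal_cases)
      case 1 then show ?case using s tt by (auto simp: fixer_def)
    next
      case 2 then show ?case using s tt x actsD(2)[OF a] by (auto simp: fixer_def)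
    next
      case (3 t)
      have "\<phi> (inv s \<otimes> t) x = \<phi> (inv s) (\<phi> s x)" using 3 s tt x actsD(2)[OF a] by simp
      also have "\<dots> = x" using acts_inv[OF T a s(1) x] by simp
      finally have "inv s \<otimes> t \<in> fixer T \<phi> {x}" using s 3 tt by (simp add: fixer_def)
      moreover have "t = s \<otimes> (inv s \<otimes> t)" using s 3 tt by simp
      ultimately show ?case by blast
    qed
  qed
  then show "card {t \<in> T. \<phi> t x = y} = card (fixer T \<phi> {x})" by (simp add: bij_betw_same_card)
qed

lemma orbit_invariant:
  assumes T: "subgroup T G" and a: "acts T \<phi> D" and x: "x \<in> D" and t: "t \<in> T" and y: "y \<in> D"
  shows "\<phi> t y \<in> (\<lambda>t. \<phi> t x) ` T \<longleftrightarrow> y \<in> (\<lambda>t. \<phi> t x) ` T"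
proof
  assume "y \<in> (\<lambda>t. \<phi> t x) ` T"
  then obtain r where "r \<in> T" "y = \<phi> r x" by auto
  then show "\<phi> t y \<in> (\<lambda>t. \<phi> t x) ` T" using actsD(2)[OF a t _ x] subD(3)[OF T] t by (metis image_eqI)
next
  assume "\<phi> t y \<in> (\<lambda>t. \<phi> t x) ` T"
  then obtain r where r: "r \<in> T" "\<phi> t y = \<phi> r x" by auto
  then have "y = \<phi> (inv t) (\<phi> r x)" using acts_inv(1)[OF T a t y] by simp
  also have "\<dots> = \<phi> (inv t \<otimes> r) x" using actsD(2)[OF a _ _ x] subD(4)[OF T] t r by simp
  finally show "y \<in> (\<lambda>t. \<phi> t x) ` T" using subD[OF T] t r by blast
qed

text \<open>An orbit of a 2-group has 2-power length, so one with more than one point has even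
  length and contains no fixed point. Such orbits are removed one by one. This parity is the source
  of all later fixed points.\<close>

lemma fixed_points_parity:
  assumes T: "subgroup T G" "card T = 2 ^ m" 
  shows "finite D \<Longrightarrow> acts T \<phi> D \<Longrightarrow> even (card D) \<longleftrightarrow> even (card {x \<in> D. \<forall>t\<in>T. \<phi> t x = x})"
proof (induction "card D" arbitrary: D rule: less_induct)
  case less
  note a = less.prems(2)
  show ?case
  proof (cases "\<forall>x\<in>D. \<forall>t\<in>T. \<phi> t x = x")
    case True
    then have "{x \<in> D. \<forall>t\<in>T. \<phi> t x = x} = D" by auto
    then show ?thesis by simp
  next
    case False
    then obtain x s where x: "x \<in> D" "s \<in> T" "\<phi> s x \<noteq> x" by auto
    let ?O = "(\<lambda>t. \<phi> t x) ` T"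
    have OX: "?O \<subseteq> D" using x actsD(1)[OF a] by auto
    have fO: "finite ?O" using OX less.prems(1) finite_subset by blast
    have xO: "x \<in> ?O" using subD(2)[OF T(1)] actsD(3)[OF a x(1)] by force
    note inv = orbit_invariant[OF T(1) a x(1)]
    have "card ?O dvd 2 ^ m" using orbit_stab[OF T(1) a x(1)] T(2) by (metis dvd_triv_right)
    then obtain j where j: "card ?O = 2 ^ j" using divides_primepow_nat two_is_prime_nat by blast
    have "{x, \<phi> s x} \<subseteq> ?O" using xO x by auto
    then have "card ?O \<ge> 2" using x(3) card_mono[OF fO, of "{x, \<phi> s x}"] by simp
    then have eO: "even (card ?O)" using j by (cases j) auto
    have "even (card (D - ?O)) \<longleftrightarrow> even (card {y \<in> D - ?O. \<forall>t\<in>T. \<phi> t y = y})"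
    proof (rule less.hyps)
      show "card (D - ?O) < card D" using less.prems(1) x(1) xO by (intro psubset_card_mono) auto
      show "finite (D - ?O)" using less.prems by simp
      show "acts T \<phi> (D - ?O)" by (rule acts_subset[OF a]) (use inv actsD(1)[OF a] in auto)
    qed
    moreover have "{y \<in> D - ?O. \<forall>t\<in>T. \<phi> t y = y} = {y \<in> D. \<forall>t\<in>T. \<phi> t y = y}"
    proof -
      have "\<not> (\<forall>t\<in>T. \<phi> t y = y)" if "y \<in> ?O" for y
      proof
        assume fx: "\<forall>t\<in>T. \<phi> t y = y"
        obtain r where r: "r \<in> T" "y = \<phi> r x" using \<open>y \<in> ?O\<close> by auto
        have "x = \<phi> (inv r) y" using r acts_inv[OF T(1) a r(1) x(1)] by simp
        then have "x = y" using fx r subD[OF T(1)] by simp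
        then show False using fx x by auto
      qed
      then show ?thesis by blast
    qed
    moreover have "card D = card (D - ?O) + card ?O"
      using OX less.prems(1) fO by (metis card_Diff_subset card_mono le_add_diff_inverse2)
    ultimately show ?thesis using eO by simp
  qed
qed

section \<open>Cosets, central elements and maximal subgroups of 2-groups\<close>

lemma pow_two_dvd:
  assumes "subgroup A G" "subgroup B G" "A \<subseteq> B" "card B = 2 ^ m"
  shows "\<exists>j\<le>m. card A = 2 ^ j"
  using sub_card_dvd[OF assms(1-3)] assms(4) divides_primepow_nat[OF two_is_prime_nat, of "card A" m] by auto

lemma card_eq_sub: "subgroup B G \<Longrightarrow> A \<subseteq> B \<Longrightarrow> card A = card B \<Longrightarrow> A = B"
  using sub_fin card_subset_eq by blast

lemma rcos_iff: "y \<in> N #> x \<longleftrightarrow> (\<exists>n\<in>N. y = n \<otimes> x)"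
  by (auto simp: r_coset_def)

lemma rcos_eq_iff:
  assumes N: "subgroup N G" and c: "x \<in> carrier G" "y \<in> carrier G"
  shows "N #> x = N #> y \<longleftrightarrow> x \<otimes> inv y \<in> N"
proof
  assume "N #> x = N #> y"
  then have "x \<in> N #> y" using rcos_self[OF c(1) N] by simp
  then obtain n where "n \<in> N" "x = n \<otimes> y" by (auto simp: rcos_iff)
  then show "x \<otimes> inv y \<in> N" using c subD(1)[OF N] by (simp add: m_assoc)
next
  assume n: "x \<otimes> inv y \<in> N"
  have "x = (x \<otimes> inv y) \<otimes> y" using c by (simp add: m_assoc)
  then have "x \<in> N #> y" using n by (auto simp: rcos_iff)
  then show "N #> x = N #> y" using repr_independence[OF _ _ N] c by auto
qed

lemma card_rcos:
  assumes N: "subgroup N G" and x: "x \<in> carrier G"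
  shows "card (N #> x) = card N"
proof -
  have "N #> x = (\<lambda>h. h \<otimes> x) ` N" by (auto simp: r_coset_def)
  moreover have "inj_on (\<lambda>h. h \<otimes> x) N" using x subD(1)[OF N] by (auto simp: inj_on_def)
  ultimately show ?thesis by (simp add: card_image)
qed

lemma card_cosets:
  assumes N: "subgroup N G" and A: "subgroup A G" and "N \<subseteq> A"
  shows "card A = card N * card ((\<lambda>x. N #> x) ` A)"
proof (rule card_fibers)
  show "finite A" using A sub_fin by blast
  fix c assume "c \<in> (\<lambda>x. N #> x) ` A"
  then obtain x where x: "x \<in> A" "c = N #> x" by auto
  have xc: "x \<in> carrier G" using x A subD by blast
  have "a \<in> {a \<in> A. N #> a = c} \<longleftrightarrow> a \<in> N #> x" for a
  proof
    assume "a \<in> {a \<in> A. N #> a = c}"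
    then show "a \<in> N #> x" using rcos_self[OF _ N, of a] x(2) subD(1)[OF A] by simp
  next
    assume "a \<in> N #> x"
    then obtain n where n: "n \<in> N" "a = n \<otimes> x" by (auto simp: rcos_iff)
    then have aA: "a \<in> A" using x assms(3) subD(3)[OF A] by auto
    then have ac: "a \<in> carrier G" using A subD by blast
    have "N #> a = c" unfolding x(2) rcos_eq_iff[OF N ac xc] using n subD(1)[OF N] xc by (simp add: m_assoc)
    then show "a \<in> {a \<in> A. N #> a = c}" using aA by simp
  qed
  then have "{a \<in> A. N #> a = c} = N #> x" by blast
  then show "card {a \<in> A. N #> a = c} = card N"
    using card_rcos[OF N xc] by simp
qed

lemma even_card_cosets:
  assumes N: "subgroup N G" and A: "subgroup A G" "card A = 2 ^ m" and "N \<subseteq> A" "N \<noteq> A"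
  shows "even (card ((\<lambda>x. N #> x) ` A))"
proof -
  have c: "card A = card N * card ((\<lambda>x. N #> x) ` A)" by (rule card_cosets[OF N A(1) assms(4)])
  then have "card ((\<lambda>x. N #> x) ` A) dvd 2 ^ m" using A(2) by simp
  then obtain i where i: "card ((\<lambda>x. N #> x) ` A) = 2 ^ i" using divides_primepow_nat two_is_prime_nat by blast
  have "i \<noteq> 0" using c i card_eq_sub[OF A(1) assms(4)] assms(5) by auto
  then show ?thesis using i by simp
qed

text \<open>The last of \<open>x, x^2, x^4, ...\<close> that lies outside \<open>N\<close> has its
  square in \<open>N\<close>. The set \<open>Z\<close> carries along any property that survives
  squaring.\<close>

lemma square_descent:
  assumes Z: "\<And>x. x \<in> Z \<Longrightarrow> x \<otimes> x \<in> Z" and Zc: "Z \<subseteq> carrier G"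
  shows "x \<in> Z \<Longrightarrow> x \<notin> N \<Longrightarrow> x [^] (2 ^ j :: nat) \<in> N \<Longrightarrow> \<exists>y\<in>Z. y \<notin> N \<and> y \<otimes> y \<in> N"
proof (induction j arbitrary: x)
  case 0
  then show ?case using Zc by auto
next
  case (Suc j)
  have xc: "x \<in> carrier G" using Suc.prems Zc by auto
  show ?case
  proof (cases "x \<otimes> x \<in> N")
    case True then show ?thesis using Suc.prems by blast
  next
    case False
    have "(x \<otimes> x) [^] (2 ^ j :: nat) = x [^] (2 ^ Suc j :: nat)"
      using xc nat_pow_pow[of x 2 "2 ^ j"] by (simp add: numeral_2_eq_2 mult.commute)
    then show ?thesis using Suc.IH[OF Z[OF Suc.prems(1)] False] Suc.prems by simp
  qed
qed

lemma pow_card_sub: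
  assumes T: "subgroup T G" and x: "x \<in> T"
  shows "x [^] card T = \<one>"
proof -
  interpret H: group "G\<lparr>carrier := T\<rparr>" using T by (rule subgroup.subgroup_is_group) (rule is_group)
  have "x [^]\<^bsub>G\<lparr>carrier := T\<rparr>\<^esub> order (G\<lparr>carrier := T\<rparr>) = \<one>\<^bsub>G\<lparr>carrier := T\<rparr>\<^esub>"
    by (rule H.pow_order_eq_1) (use x in simp)
  then show ?thesis by (simp add: order_def nat_pow_consistent[symmetric])
qed

text \<open>Conjugation by \<open>T\<close> permutes the cosets of \<open>N\<close> in
  \<open>M\<close>, whose number is even. The coset \<open>N\<close> is fixed, so by parity another
  one is, which gives an element outside \<open>N\<close> that is central modulo \<open>N\<close>.
  Squaring then brings its order modulo \<open>N\<close> down to 2.\<close>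

lemma central_element:
  assumes T: "subgroup T G" "card T = 2 ^ m"
    and N: "subgroup N G" and M: "subgroup M G" and sub: "N \<subseteq> M" "N \<noteq> M" "M \<subseteq> T"
    and nrm: "normalizes T N" "normalizes T M"
  shows "\<exists>x\<in>M. x \<notin> N \<and> x \<otimes> x \<in> N \<and> (\<forall>t\<in>T. conjg t x \<otimes> inv x \<in> N)"
proof -
  note t = subD[OF T(1)] and n = subD[OF N] and mm = subD[OF M]
  let ?\<phi> = "\<lambda>t C. (\<lambda>y. conjg t y) ` C"
  let ?S = "(\<lambda>x. N #> x) ` M"
  have conj: "?\<phi> g (N #> x) = N #> (conjg g x)" if g: "g \<in> T" and x: "x \<in> carrier G" for g x
  proof (safe)
    have gc: "g \<in> carrier G" using g t by simp
    fix y assume "y \<in> N #> x"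
    then obtain h where h: "h \<in> N" "y = h \<otimes> x" by (auto simp: rcos_iff)
    have "conjg g h \<in> N" using nrm(1) g h by (simp add: normalizes_def)
    moreover have "conjg g y = (conjg g h) \<otimes> (conjg g x)" using gc x h n(1) by (simp add: group_word)
    ultimately show "conjg g y \<in> N #> (conjg g x)" unfolding rcos_iff by blast
  next
    have gc: "g \<in> carrier G" using g t by simp
    fix y assume "y \<in> N #> (conjg g x)"
    then obtain h where h: "h \<in> N" "y = h \<otimes> (conjg g x)" by (auto simp: rcos_iff)
    have "inv g \<otimes> h \<otimes> inv (inv g) \<in> N" using nrm(1) t(4)[OF g] h unfolding normalizes_def by blast
    then have "(inv g \<otimes> h \<otimes> g) \<otimes> x \<in> N #> x" using gc unfolding rcos_iff by auto
    moreover have "y = g \<otimes> ((inv g \<otimes> h \<otimes> g) \<otimes> x) \<otimes> inv g" using gc x h n(1) by (simp add: group_word)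
    ultimately show "y \<in> ?\<phi> g (N #> x)" by blast
  qed
  have act: "acts T ?\<phi> ?S"
    unfolding acts_def
  proof (intro conjI ballI)
    fix g C assume g: "g \<in> T" and "C \<in> ?S"
    then obtain x where x: "x \<in> M" "C = N #> x" by auto
    have "conjg g x \<in> M" using nrm(2) g x by (simp add: normalizes_def)
    then show "?\<phi> g C \<in> ?S" using conj[OF g mm(1)[OF x(1)]] x(2) by auto
  next
    fix g h C assume g: "g \<in> T" and h: "h \<in> T" and "C \<in> ?S"
    then obtain x where x: "x \<in> M" "C = N #> x" by auto
    have xc: "x \<in> carrier G" "conjg h x \<in> carrier G" "h \<in> carrier G" "g \<in> carrier G" using x mm h g t by auto
    show "?\<phi> (g \<otimes> h) C = ?\<phi> g (?\<phi> h C)"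
      unfolding x(2) conj[OF t(3)[OF g h] xc(1)] conj[OF h xc(1)] conj[OF g xc(2)]
      using xc by (simp add: group_word)
  next
    fix C assume "C \<in> ?S"
    then obtain x where x: "x \<in> M" "C = N #> x" by auto
    then show "?\<phi> \<one> C = C" using conj[OF t(2) mm(1)[OF x(1)]] mm(1) by simp
  qed
  have fS: "finite ?S" using M sub_fin by blast
  obtain j where j: "card M = 2 ^ j" using pow_two_dvd[OF M T(1) sub(3) T(2)] by auto
  have "even (card ?S)" by (rule even_card_cosets[OF N M j sub(1,2)])
  then have ev: "even (card {C \<in> ?S. \<forall>t\<in>T. ?\<phi> t C = C})"
    using fixed_points_parity[OF T fS act] by simp
  let ?F = "{C \<in> ?S. \<forall>t\<in>T. ?\<phi> t C = C}"
  have N1: "N #> \<one> \<in> ?F" using conj[OF _ one_closed] mm(2) t(1) by auto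
  have "?F \<noteq> {N #> \<one>}" using ev by auto
  then obtain C where C: "C \<in> ?F" "C \<noteq> N #> \<one>" using N1 by blast
  then obtain x where x: "x \<in> M" "C = N #> x" by auto
  have xc: "x \<in> carrier G" using x mm by auto
  have xN: "x \<notin> N" using C(2) x(2) rcos_eq_iff[OF N xc one_closed] xc by simp
  define Z where "Z = {x \<in> M. \<forall>t\<in>T. conjg t x \<otimes> inv x \<in> N}"
  have xZ: "x \<in> Z"
    unfolding Z_def
  proof (safe intro!: x(1))
    fix g assume g: "g \<in> T"
    have "N #> (conjg g x) = N #> x" using C(1) x(2) g conj[OF g xc] by auto
    then show "conjg g x \<otimes> inv x \<in> N"
      using rcos_eq_iff[OF N, of "conjg g x" x] xc t(1)[OF g] by simp
  qed
  have "\<exists>y\<in>Z. y \<notin> N \<and> y \<otimes> y \<in> N"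
  proof (rule square_descent[OF _ _ xZ xN])
    show "Z \<subseteq> carrier G" using mm by (auto simp: Z_def)
    show "x [^] (2 ^ m :: nat) \<in> N" using pow_card_sub[OF T(1), of x] T(2) x sub(3) n(2) by auto
    fix y assume y: "y \<in> Z"
    then have yM: "y \<in> M" by (simp add: Z_def)
    have yc: "y \<in> carrier G" using yM mm by auto
    show "y \<otimes> y \<in> Z"
      unfolding Z_def
    proof (safe)
      show "y \<otimes> y \<in> M" using yM mm by simp
      fix g assume g: "g \<in> T"
      have gc: "g \<in> carrier G" using g t by simp
      \<comment> \<open>Centrality modulo \<open>N\<close> survives squaring: with
        \<open>c = g y g^-1 y^-1\<close> the commutator of \<open>g\<close> and \<open>y^2\<close>
        is \<open>c (y c y^-1)\<close>, and \<open>y\<close> normalizes \<open>N\<close>.\<close>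
      let ?c = "conjg g y \<otimes> inv y"
      have c: "?c \<in> N" using y g by (simp add: Z_def)
      have "y \<otimes> ?c \<otimes> inv y \<in> N" using nrm(1) c yM sub(3) unfolding normalizes_def by blast
      then have "?c \<otimes> (y \<otimes> ?c \<otimes> inv y) \<in> N" using c n(3) by blast
      then show "g \<otimes> (y \<otimes> y) \<otimes> inv g \<otimes> inv (y \<otimes> y) \<in> N" using gc yc by (simp add: group_word)
    qed
  qed
  then show ?thesis by (auto simp: Z_def)
qed

lemma insert_coset_subgroup:
  assumes N: "subgroup N G" and x: "x \<in> carrier G" "x \<notin> N" "x \<otimes> x \<in> N"
    and nrm: "\<And>n. n \<in> N \<Longrightarrow> conjg x n \<in> N"
  shows "subgroup (N \<union> (N #> x)) G" "card (N \<union> (N #> x)) = 2 * card N"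
proof -
  note n = subD[OF N]
  \<comment> \<open>Only conjugation by \<open>x\<close> is assumed to preserve \<open>N\<close>;
    the other direction follows from \<open>x^-1 h x = x^-2 (x h x^-1) x^2\<close>, because
    \<open>x^2\<close> lies in \<open>N\<close>.\<close>
  have ninv: "inv x \<otimes> h \<otimes> x \<in> N" if h: "h \<in> N" for h
  proof -
    have "inv (x \<otimes> x) \<otimes> (conjg x h) \<otimes> (x \<otimes> x) \<in> N" using n nrm[OF h] x(3) by simp
    then show ?thesis using x(1) n(1)[OF h] by (simp add: group_word)
  qed
  show "subgroup (N \<union> (N #> x)) G"
  proof (rule subgroupI)
    show "N \<union> (N #> x) \<subseteq> carrier G" using n x by (auto simp: rcos_iff)
    show "N \<union> (N #> x) \<noteq> {}" using n(2) by auto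
    fix y assume "y \<in> N \<union> (N #> x)"
    then have y: "y \<in> N \<or> (\<exists>h\<in>N. y = h \<otimes> x)" by (auto simp: rcos_iff)
    then show "inv y \<in> N \<union> (N #> x)"
    proof
      assume "y \<in> N" then show ?thesis using n by simp
    next
      assume "\<exists>h\<in>N. y = h \<otimes> x"
      then obtain h where h: "h \<in> N" "y = h \<otimes> x" by auto
      have hc: "h \<in> carrier G" using h n by simp
      have "(inv x \<otimes> inv h \<otimes> x) \<otimes> inv (x \<otimes> x) \<in> N" using ninv[of "inv h"] h n x by simp
      then have "inv y = ((inv x \<otimes> inv h \<otimes> x) \<otimes> inv (x \<otimes> x)) \<otimes> x \<and> (inv x \<otimes> inv h \<otimes> x) \<otimes> inv (x \<otimes> x) \<in> N" 
        using h(2) hc x(1) by (simp add: group_word)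
      then show ?thesis unfolding Un_iff rcos_iff by blast
    qed
    fix z assume "z \<in> N \<union> (N #> x)"
    then have z: "z \<in> N \<or> (\<exists>h\<in>N. z = h \<otimes> x)" by (auto simp: rcos_iff)
    from y z consider (a) "y \<in> N" "z \<in> N" | (b) h where "y \<in> N" "h \<in> N" "z = h \<otimes> x"
      | (c) h where "h \<in> N" "y = h \<otimes> x" "z \<in> N" | (d) h k where "h \<in> N" "y = h \<otimes> x" "k \<in> N" "z = k \<otimes> x"
      by blast
    then show "y \<otimes> z \<in> N \<union> (N #> x)"
    proof cases
      case a then show ?thesis using n by simp
    next
      case b
      then have "y \<otimes> z = (y \<otimes> h) \<otimes> x" "y \<otimes> h \<in> N" using n x by (simp_all add: m_assoc)
      then show ?thesis unfolding Un_iff rcos_iff by blast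
    next
      case c
      then have "y \<otimes> z = (h \<otimes> (conjg x z)) \<otimes> x" "h \<otimes> (conjg x z) \<in> N" using n(1,3) nrm x by (simp_all add: group_word)
      then show ?thesis unfolding Un_iff rcos_iff by blast
    next
      case d
      then have "y \<otimes> z = h \<otimes> (conjg x k) \<otimes> (x \<otimes> x)" using n(1) x by (simp add: group_word)
      moreover have "h \<otimes> (conjg x k) \<otimes> (x \<otimes> x) \<in> N" by (intro n(3) nrm d x)
      ultimately show ?thesis by simp
    qed
  qed
  have "N \<inter> (N #> x) = {}"
  proof (rule ccontr)
    assume "N \<inter> (N #> x) \<noteq> {}"
    then obtain h where h: "h \<in> N" "h \<otimes> x \<in> N" by (auto simp: rcos_iff)
    then have "inv h \<otimes> (h \<otimes> x) \<in> N" using n by blast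
    then show False using x h n(1) by simp
  qed
  moreover have "card (N #> x) = card N"
    by (rule card_rcos[OF N x(1)])
  moreover have "finite N" using N sub_fin by blast
  moreover have "finite (N #> x)" using finite_subset[OF r_coset_subset_G fin] subgroup.subset[OF N] x(1) by blast
  ultimately show "card (N \<union> (N #> x)) = 2 * card N" by (simp add: card_Un_disjoint)
qed

text \<open>\<open>Y\<close> acts on its own cosets in \<open>T\<close> by right multiplication
  (with inverses, to obtain a left action). Their number is even and the coset \<open>Y\<close> is
  fixed, so some other coset \<open>Y #> x\<close> is fixed as well, which says that
  \<open>x\<close> normalizes \<open>Y\<close>.\<close>

lemma normalizer_grows:
  assumes T: "subgroup T G" "card T = 2 ^ m" and Y: "subgroup Y G" "Y \<subseteq> T" "Y \<noteq> T"
  shows "\<exists>x\<in>T. x \<notin> Y \<and> (\<forall>y\<in>Y. conjg x y \<in> Y)"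
proof -
  note t = subD[OF T(1)] and n = subD[OF Y(1)]
  let ?\<phi> = "\<lambda>y C. C #> inv y"
  let ?S = "(\<lambda>x. Y #> x) ` T"
  have cos: "(Y #> x) #> inv y = Y #> (x \<otimes> inv y)" if "x \<in> T" "y \<in> Y" for x y
    using that t n subgroup.subset[OF Y(1)] by (simp add: coset_mult_assoc)
  have act: "acts Y ?\<phi> ?S"
    unfolding acts_def
  proof (intro conjI ballI)
    fix y C assume "y \<in> Y" "C \<in> ?S"
    then show "C #> inv y \<in> ?S" using cos t Y(2) by (auto intro!: imageI)
  next
    fix y z C assume yz: "y \<in> Y" "z \<in> Y" and "C \<in> ?S"
    then obtain x where x: "x \<in> T" "C = Y #> x" by auto
    have xz: "x \<otimes> inv z \<in> T" using x(1) yz Y(2) t(3,4) by blast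
    have c: "x \<in> carrier G" "y \<in> carrier G" "z \<in> carrier G" using x(1) yz t(1) n(1) by auto
    show "C #> inv (y \<otimes> z) = C #> inv z #> inv y"
      unfolding x(2) cos[OF x(1) n(3)[OF yz]] cos[OF x(1) yz(2)] cos[OF xz yz(1)] using c by (simp add: group_word)
  next
    fix C assume "C \<in> ?S"
    then obtain x where x: "x \<in> T" "C = Y #> x" by auto
    show "C #> inv \<one> = C" unfolding x(2) cos[OF x(1) n(2)] using t(1)[OF x(1)] by simp
  qed
  obtain i where cY: "card Y = 2 ^ i" using pow_two_dvd[OF Y(1) T(1) Y(2) T(2)] by auto
  have fS: "finite ?S" using T sub_fin by blast
  have "even (card ?S)" by (rule even_card_cosets[OF Y(1) T Y(2,3)])
  then have ev: "even (card {C \<in> ?S. \<forall>y\<in>Y. ?\<phi> y C = C})"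
    using fixed_points_parity[OF Y(1) cY fS act] by simp
  let ?F = "{C \<in> ?S. \<forall>y\<in>Y. ?\<phi> y C = C}"
  have N1: "Y #> \<one> \<in> ?F"
  proof -
    have "Y #> \<one> #> inv y = Y #> \<one>" if "y \<in> Y" for y
      unfolding cos[OF t(2) that] using rcos_eq_iff[OF Y(1), of "\<one> \<otimes> inv y" \<one>] that n by simp
    then show ?thesis using t(2) by blast
  qed
  have "?F \<noteq> {Y #> \<one>}" using ev by auto
  then obtain C where C: "C \<in> ?F" "C \<noteq> Y #> \<one>" using N1 by blast
  then obtain x where x: "x \<in> T" "C = Y #> x" by auto
  have xc: "x \<in> carrier G" using x t by auto
  have xN: "x \<notin> Y" using C(2) x(2) rcos_eq_iff[OF Y(1) xc one_closed] xc by simp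
  have "conjg x y \<in> Y" if y: "y \<in> Y" for y
  proof -
    have yc: "y \<in> carrier G" "inv y \<in> Y" using y n by auto
    have "Y #> (x \<otimes> inv (inv y)) = Y #> x" using C(1) x cos[OF x(1) yc(2)] yc(2) by auto
    then show ?thesis using rcos_eq_iff[OF Y(1), of "x \<otimes> y" x] xc yc by simp
  qed
  then show ?thesis using x xN by blast
qed

text \<open>A maximal proper subgroup \<open>M\<close> above \<open>Y\<close> is normalized by an
  element outside it, and by descent by some \<open>y\<close> outside \<open>M\<close> with
  \<open>y^2\<close> in \<open>M\<close>. Then \<open>M \<union> (M #> y)\<close> is a subgroup,
  hence all of \<open>T\<close>. So \<open>M\<close> has index 2 and contains every square.\<close>

lemma two_group_frattini:
  assumes T: "subgroup T G" "card T = 2 ^ m" and Y: "subgroup Y G" "Y \<subseteq> T" "Y \<noteq> T"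
  shows "\<exists>M. subgroup M G \<and> Y \<subseteq> M \<and> M \<subset> T \<and> sq T \<subseteq> M"
proof -
  note t = subD[OF T(1)]
  let ?P = "\<lambda>M. subgroup M G \<and> Y \<subseteq> M \<and> M \<subset> T"
  have PY: "?P Y" using Y by auto
  have Pb: "\<forall>M. ?P M \<longrightarrow> card M < card T" using psubset_card_mono[OF sub_fin[OF T(1)]] by blast
  from ex_has_greatest_nat[of ?P Y card "card T", OF PY Pb]
  obtain M where M: "?P M" and max: "\<And>M'. ?P M' \<Longrightarrow> card M' \<le> card M" by meson
  have sM: "subgroup M G" "M \<subseteq> T" "M \<noteq> T" using M by auto
  note n = subD[OF sM(1)]
  obtain x where x: "x \<in> T" "x \<notin> M" "\<And>y. y \<in> M \<Longrightarrow> conjg x y \<in> M"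
    using normalizer_grows[OF T sM] by blast
  define Z where "Z = {x \<in> T. \<forall>y\<in>M. conjg x y \<in> M}"
  have "\<exists>y\<in>Z. y \<notin> M \<and> y \<otimes> y \<in> M"
  proof (rule square_descent)
    show "Z \<subseteq> carrier G" using t by (auto simp: Z_def)
    show "x \<in> Z" "x \<notin> M" using x by (auto simp: Z_def)
    show "x [^] (2 ^ m :: nat) \<in> M" using pow_card_sub[OF T(1) x(1)] T(2) n(2) by simp
    fix y assume y: "y \<in> Z"
    show "y \<otimes> y \<in> Z" unfolding Z_def
    proof (safe)
      show "y \<otimes> y \<in> T" using y t by (simp add: Z_def)
      fix z assume z: "z \<in> M"
      have "y \<otimes> (conjg y z) \<otimes> inv y \<in> M" using y z by (simp add: Z_def)
      then show "y \<otimes> y \<otimes> z \<otimes> inv (y \<otimes> y) \<in> M" using y z t n(1) by (simp add: Z_def group_word)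
    qed
  qed
  then obtain y where y: "y \<in> T" "y \<notin> M" "y \<otimes> y \<in> M" "\<And>z. z \<in> M \<Longrightarrow> conjg y z \<in> M"
    by (auto simp: Z_def)
  have yc: "y \<in> carrier G" using y t by auto
  note big = insert_coset_subgroup[OF sM(1) yc y(2-4)]
  have bT: "M \<union> (M #> y) \<subseteq> T" using sM(2) y(1) by (auto simp: rcos_iff intro!: t(3))
  have "M \<union> (M #> y) = T"
  proof (rule ccontr)
    assume "M \<union> (M #> y) \<noteq> T"
    then have "?P (M \<union> (M #> y))" using big(1) M bT by auto
    from max[OF this] show False using big(2) sub_pos[OF sM(1)] by simp
  qed
  then have TM: "z \<in> T \<Longrightarrow> z \<in> M \<or> (\<exists>h\<in>M. z = h \<otimes> y)" for z by (auto simp: rcos_iff)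
  have "sq T \<subseteq> M"
  proof (rule sq_least[OF sM(1)])
    fix z assume "z \<in> T"
    from TM[OF this] show "z \<otimes> z \<in> M"
    proof
      assume "z \<in> M" then show ?thesis using n by simp
    next
      assume "\<exists>h\<in>M. z = h \<otimes> y"
      then obtain h where h: "h \<in> M" "z = h \<otimes> y" by auto
      have "h \<otimes> (conjg y h) \<otimes> (y \<otimes> y) \<in> M" using h y n(3) by blast
      then show ?thesis using h yc n(1) by (simp add: group_word)
    qed
  qed
  then show ?thesis using M by blast
qed

end


section \<open>The elementary abelian quotient of a 2-group of permutations\<close>

lemma card_involution_reps:
  fixes f :: "nat \<Rightarrow> nat"
  assumes "finite D" and f: "\<And>x. x \<in> D \<Longrightarrow> f x \<in> D \<and> f (f x) = x \<and> f x \<noteq> x"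
  shows "card D = 2 * card ((\<lambda>x. min x (f x)) ` D)"
proof (rule card_fibers)
  fix b assume "b \<in> (\<lambda>x. min x (f x)) ` D"
  then obtain x where x: "x \<in> D" "b = min x (f x)" by auto
  have "{a \<in> D. min a (f a) = b} = {x, f x}"
  proof (intro equalityI subsetI)
    fix a assume "a \<in> {a \<in> D. min a (f a) = b}"
    then have a: "a \<in> D" "min a (f a) = min x (f x)" using x by auto
    then have "a = x \<or> a = f x \<or> f a = x \<or> f a = f x" by (metis min_def)
    moreover have "f (f a) = a" "f (f x) = x" using f[OF a(1)] f[OF x(1)] by simp_all
    ultimately have "a = x \<or> a = f x" by metis
    then show "a \<in> {x, f x}" by simp
  next
    fix a assume "a \<in> {x, f x}"
    then have "a = x \<or> a = f x" by simp
    moreover have "f (f x) = x" "f x \<in> D" using f[OF x(1)] by simp_all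
    ultimately have "a \<in> D \<and> min a (f a) = b" using x by (elim disjE) (simp_all add: min.commute)
    then show "a \<in> {a \<in> D. min a (f a) = b}" by simp
  qed
  then show "card {a \<in> D. min a (f a) = b} = 2" using f[OF x(1)] by simp
qed fact

context fin_group begin

text \<open>With \<open>A = sq T <#> C\<close>, the index of \<open>A\<close> in \<open>T\<close> is
  at most \<open>p\<close> times \<open>|A <#> K| / |A|\<close>, and this quotient equals
  \<open>|K : A \<inter> K|\<close>, which is at most \<open>q\<close> because \<open>L\<close> lies
  in \<open>A \<inter> K\<close>. This is the step by which bounds for successive kernels are
  multiplied.\<close>

lemma sq_index_trans:
  assumes T: "subgroup T G" and K: "subgroup K G" "K \<subseteq> T" and C: "subgroup C G" "C \<subseteq> K"
    and L: "L \<subseteq> (sq T <#> C) \<inter> K"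
    and p: "card T \<le> p * card (sq T <#> K)" and q: "card K \<le> q * card L"
  shows "card T \<le> p * q * card (sq T <#> C)"
proof -
  have sT: "subgroup (sq T) G" by (rule sq_sub[OF T])
  have nT: "normalizes T (sq T)" by (rule sq_normalized_self[OF T])
  have A: "subgroup (sq T <#> C) G"
    by (rule set_mult_subgroup[OF sT C(1)]) (use nT K C in \<open>auto intro: normalizes_mono\<close>)
  have cA: "card ((sq T <#> C) <#> K) * card ((sq T <#> C) \<inter> K) = card (sq T <#> C) * card K"
    by (rule set_mult_card[OF A K(1)])
  have "sq T <#> K \<subseteq> (sq T <#> C) <#> K" using set_mult_upper(1)[OF sT C(1)] unfolding subset_iff set_mult_iff[of _ "sq T" K] set_mult_iff[of _ "sq T <#> C" K] by blast
  moreover have "finite ((sq T <#> C) <#> K)" using A K(1) fin 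
    by (meson finite_subset set_mult_closed subgroup.subset)
  ultimately have 1: "card (sq T <#> K) \<le> card ((sq T <#> C) <#> K)" by (rule card_mono[rotated])
  have 2: "card L \<le> card ((sq T <#> C) \<inter> K)" by (rule card_mono) (use L K sub_fin in auto)
  have "card T * card K \<le> (p * card (sq T <#> K)) * (q * card L)" by (intro mult_mono p q) auto
  also have "\<dots> = p * q * (card (sq T <#> K) * card L)" by simp
  also have "\<dots> \<le> p * q * (card ((sq T <#> C) <#> K) * card ((sq T <#> C) \<inter> K))" by (intro mult_mono 1 2) auto
  also have "\<dots> = (p * q * card (sq T <#> C)) * card K" unfolding cA by simp
  finally show ?thesis using sub_pos[OF K(1)] by simp
qed

text \<open>Modulo the kernel \<open>z\<close> commutes with \<open>T\<close>, so its fixed points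
  form a \<open>T\<close>-invariant set. By transitivity a single fixed point would put
  \<open>z\<close> into the kernel. Hence \<open>z\<close> acts as a fixed-point-free involution,
  and the pairs \<open>{x, \<phi> z x}\<close> are blocks.\<close>

lemma transitive_central:
  assumes T: "subgroup T G" and a: "acts T \<phi> D" and tr: "x0 \<in> D" "D = (\<lambda>t. \<phi> t x0) ` T"
    and z: "z \<in> T" "z \<notin> fixer T \<phi> D" "z \<otimes> z \<in> fixer T \<phi> D"
    "\<forall>t\<in>T. conjg t z \<otimes> inv z \<in> fixer T \<phi> D"
  shows "x \<in> D \<Longrightarrow> \<phi> z x \<in> D" "x \<in> D \<Longrightarrow> \<phi> z (\<phi> z x) = x" "x \<in> D \<Longrightarrow> \<phi> z x \<noteq> x"
    "t \<in> T \<Longrightarrow> x \<in> D \<Longrightarrow> \<phi> t (\<phi> z x) = \<phi> z (\<phi> t x)"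
proof -
  note tt = subD[OF T] and ac = actsD[OF a]
  show zz: "\<phi> z (\<phi> z x) = x" if "x \<in> D" for x
    using z(3) that ac(2)[OF z(1) z(1) that] by (simp add: fixer_def)
  show zD: "\<phi> z x \<in> D" if "x \<in> D" for x using ac(1)[OF z(1) that] .
  show comm: "\<phi> t (\<phi> z x) = \<phi> z (\<phi> t x)" if t: "t \<in> T" and x: "x \<in> D" for t x
  proof -
    let ?c = "conjg t z \<otimes> inv z"
    have c: "?c \<in> T" "\<And>y. y \<in> D \<Longrightarrow> \<phi> ?c y = y" using bspec[OF z(4) t] by (auto simp: fixer_def)
    have cc: "t \<in> carrier G" "z \<in> carrier G" using t z tt by auto
    have "t \<otimes> z = ?c \<otimes> (z \<otimes> t)" using cc by (simp add: group_word)
    then have "\<phi> (t \<otimes> z) x = \<phi> ?c (\<phi> (z \<otimes> t) x)" using ac(2)[OF c(1) tt(3)[OF z(1) t] x] by simp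
    also have "\<dots> = \<phi> (z \<otimes> t) x" by (rule c(2)) (use ac(1) tt(3) z t x in blast)
    finally show ?thesis using ac(2) t z x by simp
  qed
  show "\<phi> z x \<noteq> x" if x: "x \<in> D" for x
  proof
    assume fx: "\<phi> z x = x"
    have "\<phi> z y = y" if y: "y \<in> D" for y
    proof -
      obtain r where r: "r \<in> T" "x = \<phi> r x0" using x tr(2) by blast
      obtain s where s: "s \<in> T" "y = \<phi> s x0" using y tr(2) by blast
      have "x0 = \<phi> (inv r) x" using r acts_inv(1)[OF T a r(1) tr(1)] by simp
      then have "y = \<phi> (s \<otimes> inv r) x" using s ac(2)[OF s(1) tt(4)[OF r(1)] x] by simp
      then show ?thesis using comm[OF tt(3)[OF s(1) tt(4)[OF r(1)]] x] fx by simp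
    qed
    then show False using z(1,2) by (auto simp: fixer_def)
  qed
qed

lemma fiber_translate_le:
  assumes C: "subgroup C G" and A: "A \<subseteq> carrier G" and w: "w \<in> carrier G"
    and "\<And>v. v \<in> A \<Longrightarrow> inv w \<otimes> v \<in> C"
  shows "card A \<le> card C"
proof (rule card_inj_on_le)
  show "inj_on (\<lambda>v. inv w \<otimes> v) A" using subsetD[OF A] w by (auto simp: inj_on_def)
  show "(\<lambda>v. inv w \<otimes> v) ` A \<subseteq> C" using assms by auto
  show "finite C" using C sub_fin by blast
qed

text \<open>
  In the transitive case an element \<open>z\<close> that is central of order 2 modulo the kernel \<open>C\<close> gives blocks of
  size 2, and the kernel \<open>K\<close> on the blocks is an elementary abelian group modulo \<open>C\<close>. If \<open>u\<close> is central
  of order 2 modulo \<open>K\<close>, then \<open>K\<close> modulo its commutators with \<open>u\<close>, all of which lie in \<open>sq T\<close>, has the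
  same order as the centralizer of \<open>u\<close> in \<open>K / C\<close>, and this centralizer embeds into the
  \<open>u\<close>-invariant sets of blocks. A block is represented by its smaller point, so that the induction stays within
  the type \<^typ>\<open>nat\<close>.
\<close>

lemma two_group_bound_nat:
  fixes \<phi> :: "'a \<Rightarrow> nat \<Rightarrow> nat"
  shows "subgroup T G \<Longrightarrow> card T = 2 ^ m \<Longrightarrow> finite D \<Longrightarrow> acts T \<phi> D \<Longrightarrow>
    card T \<le> 2 ^ (card D div 2) * card (sq T <#> fixer T \<phi> D)"
proof (induction "card D" arbitrary: T m D \<phi> rule: less_induct)
  case less
  note T = less.prems(1,2) and fD = less.prems(3) and a = less.prems(4)
  note tt = subD[OF T(1)] and ac = actsD[OF a]
  define C where "C = fixer T \<phi> D"
  have Csub: "subgroup C G" "C \<subseteq> T" using fixer_sub[OF T(1) a subset_refl] by (auto simp: C_def fixer_def)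
  have nC: "normalizes T C" unfolding C_def by (rule fixer_normalized[OF T(1) a subset_refl ac(1)])
  have sT: "subgroup (sq T) G" by (rule sq_sub[OF T(1)])
  have nT: "normalizes T (sq T)" by (rule sq_normalized_self[OF T(1)])
  define A where "A = sq T <#> C"
  have A: "subgroup A G" "sq T \<subseteq> A" "C \<subseteq> A"
    unfolding A_def using set_mult_subgroup[OF sT Csub(1)] nT Csub normalizes_mono set_mult_upper[OF sT Csub(1)] by blast+
  have "card T \<le> 2 ^ (card D div 2) * card A"
  proof (cases "\<exists>x\<in>D. (\<lambda>t. \<phi> t x) ` T \<noteq> D")
    case True
    then obtain x where x: "x \<in> D" "(\<lambda>t. \<phi> t x) ` T \<noteq> D" by auto
    define O' where "O' = (\<lambda>t. \<phi> t x) ` T"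
    have OD: "O' \<subseteq> D" "O' \<noteq> D" using x ac(1) by (auto simp: O'_def)
    have xO: "x \<in> O'" using ac(3)[OF x(1)] tt(2) unfolding O'_def by force
    have inv: "\<phi> t y \<in> O' \<longleftrightarrow> y \<in> O'" if "t \<in> T" "y \<in> D" for t y
      unfolding O'_def by (rule orbit_invariant[OF T(1) a x(1) that])
    define Y where "Y = D - O'"
    have fO: "finite O'" "finite Y" using OD fD finite_subset by (auto simp: Y_def)
    have cD: "card D = card O' + card Y" using OD fD fO by (simp add: Y_def card_Diff_subset card_mono)
    have cO: "card O' < card D" using OD fD by (simp add: psubset_card_mono psubsetI)
    have cY: "card Y < card D" using xO OD fD unfolding Y_def by (intro psubset_card_mono) auto
    have aO: "acts T \<phi> O'" by (rule acts_subset[OF a]) (use OD inv in auto)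
    have aY: "acts T \<phi> Y" by (rule acts_subset[OF a]) (use inv ac(1) in \<open>auto simp: Y_def\<close>)
    \<comment> \<open>Intransitive case: the kernel \<open>K\<close> on one orbit acts on the
      remaining points with the same kernel \<open>C\<close>. The two bounds multiply, since the
      floors of the halves add up to at most the floor of half the sum.\<close>
    define K where "K = fixer T \<phi> O'"
    have K: "subgroup K G" "K \<subseteq> T" using fixer_sub[OF T(1) a OD(1)] by (auto simp: K_def fixer_def)
    obtain j where j: "card K = 2 ^ j" using pow_two_dvd[OF K(1) T(1) K(2) T(2)] by auto
    have aK: "acts K \<phi> Y" by (rule acts_mono[OF aY K(2)])
    have KC: "fixer K \<phi> Y = C" using OD by (auto simp: K_def C_def Y_def fixer_def)
    have CK: "C \<subseteq> K" using OD by (auto simp: K_def C_def fixer_def)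
    have b1: "card T \<le> 2 ^ (card O' div 2) * card (sq T <#> K)"
      unfolding K_def by (rule less.hyps[OF cO T fO(1) aO])
    have b2: "card K \<le> 2 ^ (card Y div 2) * card (sq K <#> C)"
      using less.hyps[OF cY K(1) j fO(2) aK] unfolding KC .
    have "sq K <#> C \<subseteq> A \<inter> K"
    proof -
      have "sq K \<subseteq> A" using sq_mono[OF T(1) K(1) K(2)] A(2) by auto
      then have "sq K <#> C \<subseteq> A" using set_mult_least[OF A(1) _ A(3)] by auto
      moreover have "sq K <#> C \<subseteq> K" by (rule set_mult_least[OF K(1) sq_subset[OF K(1)] CK])
      ultimately show ?thesis by blast
    qed
    from sq_index_trans[OF T(1) K Csub(1) CK this[unfolded A_def] b1 b2]
    have "card T \<le> 2 ^ (card O' div 2) * 2 ^ (card Y div 2) * card A" by (simp add: A_def)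
    also have "\<dots> \<le> 2 ^ (card D div 2) * card A"
      unfolding power_add[symmetric] by (intro mult_right_mono power_increasing) (auto simp: cD)
    finally show ?thesis .
  next
    case False
    show ?thesis
    proof (cases "C = T")
      case True
      then have "card T \<le> card A" using A card_mono[OF sub_fin[OF A(1)]] by auto
      also have "\<dots> \<le> 2 ^ (card D div 2) * card A" by simp
      finally show ?thesis .
    next
      case CT: False
      then obtain x0 where x0: "x0 \<in> D" using Csub by (auto simp: C_def fixer_def)
      have tr: "D = (\<lambda>t. \<phi> t x0) ` T" using False x0 by auto
      obtain z where z: "z \<in> T" "z \<notin> C" "z \<otimes> z \<in> C" "\<forall>t\<in>T. conjg t z \<otimes> inv z \<in> C"
        using central_element[OF T Csub(1) T(1) Csub(2) CT subset_refl nC normalizes_self[OF T(1)]] by blast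
      note zp = transitive_central[OF T(1) a x0 tr z[unfolded C_def]]
      define \<rho> where "\<rho> = (\<lambda>x. min x (\<phi> z x))"
      define \<psi> where "\<psi> = (\<lambda>t x. \<rho> (\<phi> t x))"
      define D' where "D' = \<rho> ` D"
      have \<rho>z: "\<rho> (\<phi> z x) = \<rho> x" if "x \<in> D" for x using zp(2)[OF that] by (simp add: \<rho>_def min.commute)
      have \<rho>D: "\<rho> x \<in> {x, \<phi> z x}" for x by (auto simp: \<rho>_def min_def)
      have \<rho>D': "\<rho> x \<in> D" if "x \<in> D" for x using \<rho>D[of x] zp(1)[OF that] that by auto
      have \<rho>eq: "\<rho> x = \<rho> y \<longleftrightarrow> x = y \<or> x = \<phi> z y" if "x \<in> D" "y \<in> D" for x y
        using \<rho>D[of x] \<rho>D[of y] \<rho>z that zp(2) by (metis insert_iff singletonD)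
      have \<rho>t: "\<rho> (\<phi> t (\<rho> y)) = \<rho> (\<phi> t y)" if "t \<in> T" "y \<in> D" for t y
        using \<rho>D[of y] \<rho>z[OF ac(1)[OF that]] zp(4)[OF that] by auto
      have D'D: "D' \<subseteq> D" using \<rho>D' by (auto simp: D'_def)
      have fD': "finite D'" using fD by (simp add: D'_def)
      have cD': "card D = 2 * card D'" unfolding D'_def \<rho>_def
        by (rule card_involution_reps[OF fD]) (use zp in auto)
      have pos: "card D' > 0" using x0 fD' by (auto simp: D'_def card_gt_0_iff)
      have a': "acts T \<psi> D'"
        unfolding acts_def
      proof (intro conjI ballI)
        fix t x assume t: "t \<in> T" and "x \<in> D'"
        then have "\<phi> t x \<in> D" using D'D ac(1) by blast
        then show "\<psi> t x \<in> D'" by (simp add: \<psi>_def D'_def)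
      next
        fix t s x assume t: "t \<in> T" and s: "s \<in> T" and "x \<in> D'"
        then have "x \<in> D" using D'D by blast
        then show "\<psi> (t \<otimes> s) x = \<psi> t (\<psi> s x)" using \<rho>t[OF t ac(1)[OF s]] ac(2)[OF t s] by (simp add: \<psi>_def)
      next
        fix x assume "x \<in> D'"
        then obtain y where y: "y \<in> D" "x = \<rho> y" by (auto simp: D'_def)
        then show "\<psi> \<one> x = x" using \<rho>t[OF tt(2) y(1)] ac(3)[OF y(1)] by (simp add: \<psi>_def)
      qed
      define K where "K = fixer T \<psi> D'"
      have K: "subgroup K G" "K \<subseteq> T" using fixer_sub[OF T(1) a' subset_refl] by (auto simp: K_def fixer_def)
      note kk = subD[OF K(1)]
      have nK: "normalizes T K" unfolding K_def by (rule fixer_normalized[OF T(1) a' subset_refl actsD(1)[OF a']])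
      \<comment> \<open>On each block an element of \<open>K\<close> either is the identity or
        agrees with the swap \<open>z\<close>.\<close>
      have Kmem: "\<phi> k x = x \<or> \<phi> k x = \<phi> z x" if "k \<in> K" "x \<in> D" for k x
      proof -
        have kT: "k \<in> T" using that K by auto
        have "\<psi> k (\<rho> x) = \<rho> x" using that by (auto simp: K_def fixer_def D'_def)
        then have "\<rho> (\<phi> k x) = \<rho> x" using \<rho>t[OF kT that(2)] by (simp add: \<psi>_def)
        then show ?thesis using \<rho>eq[OF ac(1)[OF kT that(2)] that(2)] by simp
      qed
      have CK: "C \<subseteq> K"
      proof
        fix c assume c: "c \<in> C"
        have "\<psi> c x = x" if x: "x \<in> D'" for x
        proof -
          have "\<phi> c x = x" "\<phi> \<one> x = x" using c x D'D ac(3) by (auto simp: C_def fixer_def)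
          then show ?thesis using actsD(3)[OF a' x] by (simp add: \<psi>_def)
        qed
        then show "c \<in> K" using c Csub by (auto simp: K_def fixer_def)
      qed
      have lt: "card D' < card D" using cD' pos by simp
      have b1: "card T \<le> 2 ^ (card D' div 2) * card (sq T <#> K)"
        unfolding K_def by (rule less.hyps[OF lt T fD' a'])
      show ?thesis
      \<comment> \<open>If \<open>T\<close> fixes every block, transitivity leaves a single block.
        Then \<open>|D| = 2\<close> and \<open>C\<close> has index 2, so the bound is
        immediate.\<close>
      proof (cases "K = T")
        case True
        have "D \<subseteq> {x0, \<phi> z x0}" using tr Kmem[OF _ x0] True by auto
        then have "card D \<le> 2" using card_mono[of "{x0, \<phi> z x0}" D] zp(3)[OF x0] by auto
        then have D2: "card D = 2" using cD' pos by linarith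
        have "card {x0, \<phi> z x0} = 2" using zp(3)[OF x0] by (metis card_2_iff)
        then have De: "D = {x0, \<phi> z x0}" using D2 \<open>D \<subseteq> {x0, \<phi> z x0}\<close> by (intro card_subset_eq) auto
        have "fixer T \<phi> {x0} = C" unfolding C_def De using zp(4)[OF _ x0] by (auto simp: fixer_def)
        then have "card T = card C * 2" using orbit_stab[OF T(1) a x0] tr D2 by simp
        moreover have "card C \<le> card A" using A card_mono[OF sub_fin[OF A(1)]] by auto
        ultimately show ?thesis using D2 by simp
      next
        case KT: False
        obtain u where u: "u \<in> T" "u \<notin> K" "u \<otimes> u \<in> K" "\<forall>t\<in>T. conjg t u \<otimes> inv u \<in> K"
          using central_element[OF T K(1) T(1) K(2) KT subset_refl nK normalizes_self[OF T(1)]] by blast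
        have uc: "u \<in> carrier G" using u tt by auto
        have x0': "\<rho> x0 \<in> D'" using x0 by (simp add: D'_def)
        have tr': "D' = (\<lambda>t. \<psi> t (\<rho> x0)) ` T"
        proof -
          have "(\<lambda>t. \<psi> t (\<rho> x0)) ` T = (\<lambda>t. \<rho> (\<phi> t x0)) ` T"
            using \<rho>t[OF _ x0] by (intro image_cong) (auto simp: \<psi>_def)
          also have "\<dots> = \<rho> ` ((\<lambda>t. \<phi> t x0) ` T)" by (simp add: image_image)
          finally show ?thesis using tr by (simp add: D'_def)
        qed
        note up = transitive_central[OF T(1) a' x0' tr' u[unfolded K_def]]
        define D'' where "D'' = (\<lambda>x. min x (\<psi> u x)) ` D'"
        have cD'': "card D' = 2 * card D''" unfolding D''_def
          by (rule card_involution_reps[OF fD']) (use up in auto)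
        have D''D: "D'' \<subseteq> D'" using up(1) by (auto simp: D''_def min_def)
        define K' where "K' = {w \<in> K. conjg w u \<otimes> inv u \<in> C}"
        have K'mem: "\<phi> w x = x \<longleftrightarrow> \<phi> w (\<phi> u x) = \<phi> u x" if w: "w \<in> K'" and x: "x \<in> D" for w x
        proof -
          have wT: "w \<in> T" "w \<in> carrier G" using w K tt by (auto simp: K'_def)
          let ?c = "conjg w u \<otimes> inv u"
          have c: "?c \<in> T" "\<And>y. y \<in> D \<Longrightarrow> \<phi> ?c y = y" using w by (auto simp: K'_def C_def fixer_def)
          have "w \<otimes> u = ?c \<otimes> (u \<otimes> w)" using wT uc by (simp add: group_word)
          then have "\<phi> (w \<otimes> u) x = \<phi> ?c (\<phi> (u \<otimes> w) x)" using ac(2)[OF c(1) tt(3)[OF u(1) wT(1)] x] by simp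
          also have "\<dots> = \<phi> (u \<otimes> w) x" by (rule c(2)) (use ac(1) tt(3) u wT x in blast)
          finally have e: "\<phi> w (\<phi> u x) = \<phi> u (\<phi> w x)" using ac(2) u wT x by simp
          show ?thesis unfolding e using acts_inj[OF T(1) a u(1) ac(1)[OF wT(1) x] x] by auto
        qed
        have Kz: "\<phi> w x = x \<longleftrightarrow> \<phi> w (\<rho> x) = \<rho> x" if w: "w \<in> K" and x: "x \<in> D" for w x
        proof -
          have wT: "w \<in> T" using w K by auto
          have "\<phi> w x = x \<longleftrightarrow> \<phi> w (\<phi> z x) = \<phi> z x"
            unfolding zp(4)[OF wT x] using acts_inj[OF T(1) a z(1) ac(1)[OF wT x] x] by auto
          then show ?thesis using \<rho>D[of x] by auto
        qed
        \<comment> \<open>Modulo \<open>C\<close> an element of \<open>K\<close> is determined by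
          the blocks that it fixes pointwise. For \<open>w\<close> in \<open>K'\<close> this set of
          blocks is invariant under \<open>u\<close>, so one block from each pair
          \<open>{x, \<psi> u x}\<close> decides it. There are \<open>card D' div 2\<close>
          pairs.\<close>
        define h where "h = (\<lambda>w. {x \<in> D''. \<phi> w x = x})"
        have K'c: "K' \<subseteq> carrier G" using kk by (auto simp: K'_def)
        have finK': "finite K'" using K'c fin finite_subset by blast
        have hdet: "\<phi> w x = x \<longleftrightarrow> \<phi> v x = x" if wv: "w \<in> K'" "v \<in> K'" "h w = h v" and x: "x \<in> D" for w v x
        proof -
          have r: "\<rho> x \<in> D'" "\<rho> x \<in> D" using x \<rho>D' by (auto simp: D'_def)
          obtain y where y: "y \<in> D''" "y = \<rho> x \<or> y = \<psi> u (\<rho> x)"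
            using r(1) by (auto simp: D''_def min_def)
          have key: "\<phi> w' x = x \<longleftrightarrow> \<phi> w' y = y" if w': "w' \<in> K'" for w'
          proof -
            have w'K: "w' \<in> K" using w' by (simp add: K'_def)
            have "\<phi> w' x = x \<longleftrightarrow> \<phi> w' (\<rho> x) = \<rho> x" by (rule Kz[OF w'K x])
            also have "\<dots> \<longleftrightarrow> \<phi> w' y = y"
            proof (cases "y = \<rho> x")
              case False
              then have "y = \<rho> (\<phi> u (\<rho> x))" using y by (simp add: \<psi>_def)
              then show ?thesis using K'mem[OF w' r(2)] Kz[OF w'K ac(1)[OF u(1) r(2)]] by simp
            qed simp
            finally show ?thesis .
          qed
          have "\<phi> w y = y \<longleftrightarrow> \<phi> v y = y" using wv(3) y(1) unfolding h_def by blast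
          then show ?thesis using key wv by simp
        qed
        have "card K' \<le> card C * card (h ` K')"
        proof (rule card_fibers_le[OF finK'])
          fix b assume "b \<in> h ` K'"
          then obtain w where w: "w \<in> K'" "b = h w" by auto
          have wK: "w \<in> K" "w \<in> carrier G" "w \<in> T" using w K'c K by (auto simp: K'_def)
          show "card {v \<in> K'. h v = b} \<le> card C"
          proof (rule fiber_translate_le[OF Csub(1) _ wK(2)])
            fix v assume v: "v \<in> {v \<in> K'. h v = b}"
            then have vK: "v \<in> K" "v \<in> T" using K by (auto simp: K'_def)
            have e: "\<phi> v x = \<phi> w x" if x: "x \<in> D" for x
              using hdet[OF w(1) _ _ x, of v] v w(2) Kmem[OF wK(1) x] Kmem[OF vK(1) x] by auto
            have "\<phi> (inv w \<otimes> v) x = x" if x: "x \<in> D" for x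
              using ac(2)[OF tt(4)[OF wK(3)] vK(2) x] e[OF x] acts_inv(1)[OF T(1) a wK(3) x] by simp
            then show "inv w \<otimes> v \<in> C" using tt(3)[OF tt(4)[OF wK(3)] vK(2)] by (simp add: C_def fixer_def)
          qed (use K'c in auto)
        qed
        also have "card (h ` K') \<le> 2 ^ card D''"
        proof -
          have fD'': "finite D''" using D''D fD' finite_subset by blast
          have "h ` K' \<subseteq> Pow D''" by (auto simp: h_def)
          then show ?thesis using card_mono[of "Pow D''" "h ` K'"] fD'' by (simp add: card_Pow)
        qed
        finally have cK': "card K' \<le> card C * 2 ^ (card D' div 2)" using cD'' by simp
        \<comment> \<open>The commutator with \<open>u\<close>, taken modulo \<open>C\<close>. Its
          values lie in \<open>(A \<inter> K) / C\<close> and each fibre fits into a translate of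
          \<open>K'\<close>, so \<open>|K : A \<inter> K|\<close> is at most
          \<open>|K' : C|\<close>.\<close>
        define f where "f = (\<lambda>k. C #> (conjg k u \<otimes> inv u))"
        have fmem: "conjg k u \<otimes> inv u \<in> A \<inter> K" if k: "k \<in> K" for k
        proof
          show "conjg k u \<otimes> inv u \<in> A" using sq_comm[OF T(1) _ u(1)] k K(2) A(2) by blast
          have "u \<otimes> inv k \<otimes> inv u \<in> K" using nK u(1) kk(4)[OF k] unfolding normalizes_def by blast
          then have "k \<otimes> (u \<otimes> inv k \<otimes> inv u) \<in> K" using k kk by blast
          then show "conjg k u \<otimes> inv u \<in> K" using k kk(1) uc by (simp add: group_word)
        qed
        have "card K \<le> card K' * card (f ` K)"
        proof (rule card_fibers_le)
          show "finite K" using K sub_fin by blast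
          fix b assume "b \<in> f ` K"
          then obtain k0 where k0: "k0 \<in> K" "b = f k0" by auto
          have k0c: "k0 \<in> carrier G" "k0 \<in> T" using k0 kk K by auto
          show "card {k \<in> K. f k = b} \<le> card K'"
          proof (rule card_inj_on_le)
            show "inj_on (\<lambda>k. inv k0 \<otimes> k) {k \<in> K. f k = b}" using k0c kk by (auto simp: inj_on_def)
            show "finite K'" by fact
            show "(\<lambda>k. inv k0 \<otimes> k) ` {k \<in> K. f k = b} \<subseteq> K'"
            proof (safe)
              fix k assume k: "k \<in> K" "b = f k"
              have kc: "k \<in> carrier G" "k \<in> T" using k kk K by auto
              have "(conjg k u \<otimes> inv u) \<otimes> inv (conjg k0 u \<otimes> inv u) \<in> C"
              proof (subst rcos_eq_iff[OF Csub(1), symmetric])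
                show "C #> (conjg k u \<otimes> inv u) = C #> (conjg k0 u \<otimes> inv u)"
                  using k(2) k0(2) by (simp add: f_def)
              qed (use kc(1) k0c(1) uc in simp_all)
              then have "inv k0 \<otimes> ((conjg k u \<otimes> inv u) \<otimes> inv (conjg k0 u \<otimes> inv u)) \<otimes> inv (inv k0) \<in> C"
                using nC tt(4)[OF k0c(2)] unfolding normalizes_def by blast
              then have "(inv k0 \<otimes> k) \<otimes> u \<otimes> inv (inv k0 \<otimes> k) \<otimes> inv u \<in> C"
                using kc(1) k0c(1) uc by (simp add: group_word)
              then show "inv k0 \<otimes> k \<in> K'" using k k0 kk by (simp add: K'_def)
            qed
          qed
        qed
        moreover have "card (f ` K) * card C \<le> card (A \<inter> K)"
        proof -
          have AK: "subgroup (A \<inter> K) G" by (rule sub_Int[OF A(1) K(1)])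
          have "card (A \<inter> K) = card C * card ((\<lambda>x. C #> x) ` (A \<inter> K))"
            by (rule card_cosets[OF Csub(1) AK]) (use A CK in auto)
          moreover have "f ` K \<subseteq> (\<lambda>x. C #> x) ` (A \<inter> K)" using fmem by (auto simp: f_def)
          then have "card (f ` K) \<le> card ((\<lambda>x. C #> x) ` (A \<inter> K))" by (rule card_mono[rotated]) (use AK sub_fin in blast)
          ultimately show ?thesis by (simp add: mult.commute)
        qed
        ultimately have "card K * card C \<le> card K' * card (A \<inter> K)"
          by (metis (no_types, lifting) le_trans mult.assoc mult_le_mono1 mult_le_mono2)
        also have "\<dots> \<le> (card C * 2 ^ (card D' div 2)) * card (A \<inter> K)" using cK' by simp
        finally have b2: "card K \<le> 2 ^ (card D' div 2) * card (A \<inter> K)" using sub_pos[OF Csub(1)] by simp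
        \<comment> \<open>The blocks and the kernel on the blocks contribute
          \<open>card D' div 2\<close> each to the exponent, and
          \<open>|D| = 2 |D'|\<close>.\<close>
        from sq_index_trans[OF T(1) K Csub(1) CK _ b1 b2]
        have "card T \<le> 2 ^ (card D' div 2) * 2 ^ (card D' div 2) * card A" by (simp add: A_def)
        also have "\<dots> \<le> 2 ^ (card D div 2) * card A"
          unfolding power_add[symmetric] by (intro mult_right_mono power_increasing) (auto simp: cD')
        finally show ?thesis .
      qed
    qed
  qed
  then show ?case unfolding A_def C_def .
qed

text \<open>Transport along a numbering of \<open>D\<close>. An arbitrary point type matters, since
  the bound is applied both to the given points and to unordered pairs of group elements.\<close>

lemma two_group_bound:
  fixes \<phi> :: "'a \<Rightarrow> 'c \<Rightarrow> 'c"
  assumes T: "subgroup T G" "card T = 2 ^ m" and "finite D" "acts T \<phi> D"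
  shows "card T \<le> 2 ^ (card D div 2) * card (sq T <#> fixer T \<phi> D)"
proof -
  obtain e where e: "bij_betw e D {0..<card D}" using ex_bij_betw_finite_nat[OF assms(3)] by blast
  define d where "d = inv_into D e"
  have de: "x \<in> D \<Longrightarrow> d (e x) = x" for x using e by (simp add: d_def bij_betw_def)
  define \<psi> where "\<psi> = (\<lambda>t i. e (\<phi> t (d i)))"
  note ac = actsD[OF assms(4)]
  have "acts T \<psi> (e ` D)" unfolding acts_def \<psi>_def using ac de by auto
  moreover have "fixer T \<psi> (e ` D) = fixer T \<phi> D"
    unfolding fixer_def \<psi>_def using ac de by (auto simp: de) (metis ac(1) de)
  moreover have "card (e ` D) = card D" using e by (simp add: bij_betw_def)
  ultimately show ?thesis using two_group_bound_nat[OF T, of "e ` D" \<psi>] assms(3) by simp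
qed

end


section \<open>A normal 2-complement\<close>

text \<open>Such a permutation is a product of \<open>card S div 2\<close> disjoint transpositions;
  the induction splits off the one that contains \<open>x\<close>.\<close>

lemma sign_fpf_involution:
  "finite S \<Longrightarrow> p permutes S \<Longrightarrow> (\<And>x. x \<in> S \<Longrightarrow> p (p x) = x \<and> p x \<noteq> x) \<Longrightarrow> sign p = (- 1) ^ (card S div 2)"
proof (induction "card S" arbitrary: S p rule: less_induct)
  case less
  show ?case
  proof (cases "S = {}")
    case True then show ?thesis using less.prems(2) by simp
  next
    case False
    then obtain x where x: "x \<in> S" by auto
    define y where "y = p x"
    have y: "y \<in> S" "y \<noteq> x" "p y = x" using x less.prems(3)[OF x] permutes_in_image[OF less.prems(2)] by (auto simp: y_def)
    define r where "r = Transposition.transpose x y \<circ> p"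
    have pr: "p = Transposition.transpose x y \<circ> r" by (simp add: r_def o_assoc [symmetric] fun_eq_iff)
    have rS: "r permutes S" unfolding r_def by (intro permutes_compose less.prems(2) permutes_swap_id x y)
    have rxy: "r x = x" "r y = y" using y by (auto simp: r_def y_def[symmetric])
    have roth: "r w = p w" if "w \<in> S" "w \<noteq> x" "w \<noteq> y" for w
    proof -
      have "p w \<noteq> x" using that less.prems(3)[OF that(1)] y_def by metis
      moreover have "p w \<noteq> y" using that less.prems(3)[OF that(1)] y by metis
      ultimately show ?thesis by (simp add: r_def)
    qed
    have "r permutes (S - {x, y})" by (rule permutes_superset[OF rS]) (use rxy in auto)
    moreover have "r (r w) = w \<and> r w \<noteq> w" if "w \<in> S - {x, y}" for w
    proof -
      have w: "w \<in> S" "w \<noteq> x" "w \<noteq> y" using that by auto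
      have pw: "p w \<in> S" "p w \<noteq> x" "p w \<noteq> y" using w less.prems(3)[OF w(1)] permutes_in_image[OF less.prems(2)] y y_def
        by (simp, metis, metis)
      show ?thesis using roth[OF w] roth[OF pw] less.prems(3)[OF w(1)] by simp
    qed
    moreover have cS: "card S = card (S - {x, y}) + 2"
    proof -
      have "card {x, y} = 2" using y by auto
      moreover have "{x, y} \<subseteq> S" using x y by auto
      ultimately show ?thesis using card_Diff_subset[of "{x, y}" S] card_mono[of S "{x, y}"] less.prems(1) by simp
    qed
    ultimately have "sign r = (- 1) ^ (card (S - {x, y}) div 2)"
      using less.hyps[of "S - {x, y}" r] less.prems(1) by simp
    moreover have "sign p = sign (Transposition.transpose x y) * sign r"
      using sign_compose[of "Transposition.transpose x y" r] pr rS less.prems(1)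
      by (metis permutation_permutes permutation_swap_id)
    ultimately show ?thesis using y(2) cS by (simp add: sign_swap_id)
  qed
qed

context fin_group begin

text \<open>As long as \<open>W\<close> is not all of \<open>T\<close>, adjoining one coset gives a
  subgroup twice as large.\<close>

lemma index_over_sq:
  assumes T: "subgroup T G"
  shows "subgroup W G \<Longrightarrow> sq T \<subseteq> W \<Longrightarrow> W \<subseteq> T \<Longrightarrow> \<exists>d. card T = 2 ^ d * card W"
proof (induction "card T - card W" arbitrary: W rule: less_induct)
  case less
  note W = less.prems(1)
  show ?case
  proof (cases "W = T")
    case True then show ?thesis by (intro exI[of _ 0]) simp
  next
    case False
    then obtain x where x: "x \<in> T" "x \<notin> W" using less.prems by blast
    have xc: "x \<in> carrier G" using x T subD by blast
    have "normalizes T W" by (rule sq_normalizes_over[OF T less.prems])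
    then have nx: "\<And>w. w \<in> W \<Longrightarrow> conjg x w \<in> W" using x by (simp add: normalizes_def)
    have x2: "x \<otimes> x \<in> W" using sq_mem[OF x(1)] less.prems by blast
    note big = insert_coset_subgroup[OF W xc x(2) x2 nx]
    have bT: "W \<union> (W #> x) \<subseteq> T" using less.prems(3) x(1) by (auto simp: rcos_iff intro!: subD(3)[OF T])
    have "card (W \<union> (W #> x)) \<le> card T" by (rule card_mono[OF sub_fin[OF T] bT])
    then have "card T - card (W \<union> (W #> x)) < card T - card W" using big(2) sub_pos[OF W] by simp
    then obtain d where "card T = 2 ^ d * card (W \<union> (W #> x))"
      using less.hyps[OF _ big(1) _ bT] less.prems(2) by blast
    then show ?thesis using big(2) by (intro exI[of _ "Suc d"]) simp
  qed
qed

lemma odd_dvd_two_power: "odd r \<Longrightarrow> r dvd 2 ^ j \<Longrightarrow> r = (1::nat)"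
  using divides_primepow_nat[OF two_is_prime_nat, of r j] by (metis dvd_power even_power neq0_conv power_0 dvd_refl)

text \<open>The index of \<open>S <#> T\<close> divides the odd number \<open>q\<close> because the
  product contains \<open>T\<close>, and it divides \<open>2 ^ d\<close> because the product
  contains \<open>S\<close>.\<close>

lemma odd_two_set_mult:
  assumes "subgroup S G" "card (carrier G) = 2 ^ d * card S" "normalizes (carrier G) S"
    and T: "subgroup T G" "card T = 2 ^ m" and oq: "card (carrier G) = 2 ^ m * q" "odd q"
  shows "S <#> T = carrier G"
proof -
  have B: "subgroup (S <#> T) G" by (rule set_mult_subgroup[OF assms(1) T(1)])
    (use assms(3) subgroup.subset[OF T(1)] normalizes_mono in blast)
  obtain r where r: "card (carrier G) = card (S <#> T) * r"
    using sub_card_dvd[OF B sub_carrier subgroup.subset[OF B]] by blast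
  obtain b where b: "card (S <#> T) = card T * b" using sub_card_dvd[OF T(1) B set_mult_upper(2)[OF assms(1) T(1)]] by blast
  obtain b' where b': "card (S <#> T) = card S * b'" using sub_card_dvd[OF assms(1) B set_mult_upper(1)[OF assms(1) T(1)]] by blast
  have "2 ^ m * q = 2 ^ m * (b * r)" using r b oq(1) T(2) by simp
  then have "q = b * r" by simp
  then have "odd r" using oq(2) by simp
  have "card S * 2 ^ d = card S * (b' * r)" using r b' assms(2) by (simp add: mult_ac)
  then have "2 ^ d = b' * r" using sub_pos[OF assms(1)] by simp
  then have "r dvd 2 ^ d" by simp
  then have "r = 1" using odd_dvd_two_power \<open>odd r\<close> by blast
  then show ?thesis using card_eq_sub[OF sub_carrier subgroup.subset[OF B]] r by simp
qed

lemma sign_kernel_sub: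
  fixes s :: "'a \<Rightarrow> int"
  assumes A: "subgroup A G" and hom: "\<And>x y. x \<in> A \<Longrightarrow> y \<in> A \<Longrightarrow> s (x \<otimes> y) = s x * s y"
    and pm: "\<And>x. s x = 1 \<or> s x = - 1"
  shows "subgroup {x \<in> A. s x = 1} G"
proof (rule subgroupI)
  note aa = subD[OF A]
  have s1: "s \<one> = 1" using hom[OF aa(2) aa(2)] pm[of \<one>] by auto
  show "{x \<in> A. s x = 1} \<subseteq> carrier G" using aa(1) by auto
  show "{x \<in> A. s x = 1} \<noteq> {}" using s1 aa(2) by auto
  fix x assume x: "x \<in> {x \<in> A. s x = 1}"
  then have "x \<in> carrier G" "inv x \<in> A" using aa by auto
  then show "inv x \<in> {x \<in> A. s x = 1}" using hom[of x "inv x"] x s1 by simp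
  fix y assume "y \<in> {x \<in> A. s x = 1}"
  then show "x \<otimes> y \<in> {x \<in> A. s x = 1}" using x hom aa(3) by simp
qed

text \<open>
  A special case of Tate's theorem. Transfer into the group of order 2 appears here as the sign of the
  permutations \<open>N k \<mapsto> N t k g\<inverse>\<close> of the cosets of \<open>N\<close> in \<open>K\<close>, for pairs \<open>(g, t)\<close> that agree modulo
  \<open>K\<close>. Here \<open>K\<close> is the least normal subgroup of 2-power index, and \<open>N\<close> has index 2 in \<open>K \<inter> T\<close>.
\<close>

lemma two_complement:
  assumes T: "subgroup T G" "card T = 2 ^ m" and oq: "card (carrier G) = 2 ^ m * q" "odd q"
    and foc: "T \<inter> sq (carrier G) \<subseteq> sq T"
  shows "\<exists>K. subgroup K G \<and> normalizes (carrier G) K \<and> K \<inter> T = {\<one>} \<and> K <#> T = carrier G \<and> odd (card K)"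
proof -
  note tt = subD[OF T(1)]
  let ?G = "carrier G"
  let ?S = "sq ?G"
  have S: "subgroup ?S G" by (rule sq_sub[OF sub_carrier])
  have nS: "normalizes ?G ?S" by (rule sq_normalized_self[OF sub_carrier])
  obtain d where d: "card ?G = 2 ^ d * card ?S"
    using index_over_sq[OF sub_carrier S subset_refl sq_subset[OF sub_carrier]] by blast
  define P where "P = (\<lambda>K. subgroup K G \<and> normalizes ?G K \<and> (\<exists>j. card ?G = 2 ^ j * card K))"
  have "P ?G" unfolding P_def using sub_carrier normalizes_self[OF sub_carrier] by (auto intro: exI[of _ 0])
  then obtain K where PK: "P K" and min: "\<And>L. P L \<Longrightarrow> card K \<le> card L"
    using ex_has_least_nat[of P ?G card] by blast
  then obtain j where K: "subgroup K G" and nK: "normalizes ?G K" and j: "card ?G = 2 ^ j * card K"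
    by (auto simp: P_def)
  note kk = subD[OF K]
  have KG: "K \<subseteq> ?G" "T \<subseteq> ?G" using K T subgroup.subset by auto
  have nTK: "normalizes T K" using nK KG normalizes_mono by blast
  have BG: "K <#> T = ?G" by (rule odd_two_set_mult[OF K j nK T oq])
  define Q where "Q = K \<inter> T"
  have Q: "subgroup Q G" "Q \<subseteq> K" "Q \<subseteq> T" using sub_Int[OF K T(1)] by (auto simp: Q_def)
  have cK: "card K = q * card Q"
  proof -
    have "card K * 2 ^ m = (q * card Q) * 2 ^ m" using set_mult_card[OF K T(1)] BG oq(1) T(2) by (simp add: Q_def mult_ac)
    then show ?thesis by simp
  qed
  have nQ: "normalizes T Q" unfolding Q_def by (rule normalizes_Int[OF nTK normalizes_self[OF T(1)]])
  \<comment> \<open>By the product formula the intersection with \<open>sq G\<close> again has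
    2-power index, so minimality of \<open>K\<close> gives the inclusion. The hypothesis
    \<open>foc\<close> then puts \<open>Q\<close> inside \<open>sq T\<close>.\<close>
  have KS: "K \<subseteq> ?S"
  proof -
    let ?I = "K \<inter> ?S"
    have I: "subgroup ?I G" by (rule sub_Int[OF K S])
    have nI: "normalizes ?G ?I" by (rule normalizes_Int[OF nK nS])
    have KS': "subgroup (K <#> ?S) G" by (rule set_mult_subgroup[OF K S]) (use nK normalizes_mono subgroup.subset[OF S] in blast)
    obtain r where r: "card ?G = card (K <#> ?S) * r"
      using sub_card_dvd[OF KS' sub_carrier subgroup.subset[OF KS']] by blast
    obtain c where c: "card ?G = card ?I * c" using sub_card_dvd[OF I sub_carrier subgroup.subset[OF I]] by blast
    have e: "card (K <#> ?S) * card ?I = card K * card ?S" by (rule set_mult_card[OF K S])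
    have "card ?G * card ?G = (2 ^ j * card K) * (2 ^ d * card ?S)" using j d by metis
    also have "\<dots> = 2 ^ (j + d) * (card (K <#> ?S) * card ?I)" unfolding e by (simp add: power_add)
    also have "card ?G * card ?G = (card (K <#> ?S) * r) * (card ?I * c)" using r c by metis
    finally have "(card (K <#> ?S) * card ?I) * (r * c) = (card (K <#> ?S) * card ?I) * 2 ^ (j + d)" by (simp add: mult_ac)
    then have "r * c = 2 ^ (j + d)" using sub_pos[OF KS'] sub_pos[OF I] by simp
    then have "c dvd 2 ^ (j + d)" by (metis dvd_triv_right)
    then obtain i where "c = 2 ^ i" using divides_primepow_nat two_is_prime_nat by blast
    then have "P ?I" unfolding P_def using I nI c by (auto simp: mult.commute)
    then have "card K \<le> card ?I" by (rule min)
    then have "?I = K" using sub_fin[OF K] by (metis Int_lower1 card_seteq)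
    then show ?thesis by blast
  qed
  have QsT: "Q \<subseteq> sq T" using foc KS by (auto simp: Q_def)
  have "Q = {\<one>}"
  proof (rule ccontr)
    assume Q1: "Q \<noteq> {\<one>}"
    \<comment> \<open>A maximal such subgroup \<open>N\<close> has index 2 in \<open>Q\<close>:
      adjoining an element that is central of order 2 modulo \<open>N\<close> keeps it normalized by
      \<open>T\<close>, so nothing fits in between.\<close>
    define R where "R = (\<lambda>M. subgroup M G \<and> normalizes T M \<and> M \<subset> Q)"
    have "R {\<one>}" unfolding R_def using Q1 subD(2)[OF Q(1)] triv_subgroup tt(1) by (auto simp: normalizes_def)
    moreover have "\<forall>M. R M \<longrightarrow> card M < card Q" unfolding R_def using psubset_card_mono[OF sub_fin[OF Q(1)]] by blast
    ultimately obtain N where RN: "R N" and max: "\<And>M. R M \<Longrightarrow> card M \<le> card N"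
      using ex_has_greatest_nat[of R "{\<one>}" card "card Q"] by blast
    have N: "subgroup N G" "normalizes T N" "N \<subseteq> Q" "N \<noteq> Q" using RN by (auto simp: R_def)
    note nn = subD[OF N(1)]
    obtain x where x: "x \<in> Q" "x \<notin> N" "x \<otimes> x \<in> N" "\<forall>t\<in>T. conjg t x \<otimes> inv x \<in> N"
      using central_element[OF T N(1) Q(1) N(3,4) Q(3) N(2) nQ] by blast
    have xT: "x \<in> T" "x \<in> K" "x \<in> carrier G" using x Q KG by auto
    have nx: "\<And>w. w \<in> N \<Longrightarrow> conjg x w \<in> N" using N(2) xT by (simp add: normalizes_def)
    note big = insert_coset_subgroup[OF N(1) xT(3) x(2,3) nx]
    have bQ: "N \<union> (N #> x) \<subseteq> Q" using N(3) x(1) by (auto simp: rcos_iff intro!: subD(3)[OF Q(1)])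
    have bn: "normalizes T (N \<union> (N #> x))"
      unfolding normalizes_def
    proof (intro ballI)
      fix t w assume t: "t \<in> T" and "w \<in> N \<union> (N #> x)"
      then consider "w \<in> N" | h where "h \<in> N" "w = h \<otimes> x" by (auto simp: rcos_iff)
      then show "conjg t w \<in> N \<union> (N #> x)"
      proof cases
        case 1 then show ?thesis using N(2) t by (simp add: normalizes_def)
      next
        case 2
        have "conjg t h \<in> N" using N(2) t 2 by (simp add: normalizes_def)
        then have "(conjg t h) \<otimes> (conjg t x \<otimes> inv x) \<in> N" using x(4) t nn(3) by blast
        moreover have "conjg t w = ((conjg t h) \<otimes> (conjg t x \<otimes> inv x)) \<otimes> x"
          using 2 tt(1)[OF t] nn(1) xT(3) by (simp add: group_word)
        ultimately show ?thesis unfolding Un_iff rcos_iff by blast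
      qed
    qed
    have QN: "N \<union> (N #> x) = Q"
    proof (rule ccontr)
      assume "N \<union> (N #> x) \<noteq> Q"
      then have "R (N \<union> (N #> x))" unfolding R_def using big(1) bn bQ by blast
      from max[OF this] show False using big(2) sub_pos[OF N(1)] by simp
    qed
    have cQ: "card Q = 2 * card N" using big(2) QN by simp
    define S' where "S' = (\<lambda>k. N #> k) ` K"
    have NK: "N \<subseteq> K" using N Q by auto
    have "card K = card N * card S'" unfolding S'_def by (rule card_cosets[OF N(1) K NK])
    then have cS: "card S' = 2 * q" using cK cQ sub_pos[OF N(1)] by simp
    have fS: "finite S'" using sub_fin[OF K] by (simp add: S'_def)
    define \<pi> where "\<pi> = (\<lambda>g t C. (\<lambda>y. t \<otimes> y \<otimes> inv g) ` C)"
    \<comment> \<open>For these pairs \<open>t k g^-1 = (t k t^-1) (t g^-1)\<close> stays in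
      \<open>K\<close>. Both \<open>(k, \<one>)\<close> with \<open>k\<close> in \<open>K\<close>
      and \<open>(t, t)\<close> with \<open>t\<close> in \<open>T\<close> belong to
      \<open>V\<close>, so a single sign homomorphism can be compared on \<open>K\<close> and on
      \<open>T\<close>.\<close>
    define V where "V = {(g,t). g \<in> carrier G \<and> t \<in> T \<and> t \<otimes> inv g \<in> K}"
    have \<pi>c: "\<pi> g t (N #> k) = N #> (t \<otimes> k \<otimes> inv g)" if t: "t \<in> T" and g: "g \<in> carrier G" and k: "k \<in> carrier G" for g t k
    proof (intro equalityI subsetI)
      have tc: "t \<in> carrier G" using t tt by simp
      fix y assume "y \<in> \<pi> g t (N #> k)"
      then obtain h where h: "h \<in> N" "y = t \<otimes> (h \<otimes> k) \<otimes> inv g" by (auto simp: rcos_iff \<pi>_def)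
      have "conjg t h \<in> N" using N(2) t h by (simp add: normalizes_def)
      moreover have "y = (conjg t h) \<otimes> (t \<otimes> k \<otimes> inv g)" using h tc g k nn(1) by (simp add: group_word)
      ultimately show "y \<in> N #> (t \<otimes> k \<otimes> inv g)" unfolding rcos_iff by blast
    next
      have tc: "t \<in> carrier G" using t tt by simp
      fix y assume "y \<in> N #> (t \<otimes> k \<otimes> inv g)"
      then obtain h where h: "h \<in> N" "y = h \<otimes> (t \<otimes> k \<otimes> inv g)" by (auto simp: rcos_iff)
      have "inv t \<otimes> h \<otimes> inv (inv t) \<in> N" using N(2) tt(4)[OF t] h unfolding normalizes_def by blast
      then have "(inv t \<otimes> h \<otimes> t) \<otimes> k \<in> N #> k" using tc unfolding rcos_iff by auto
      moreover have "y = t \<otimes> ((inv t \<otimes> h \<otimes> t) \<otimes> k) \<otimes> inv g" using h tc g k nn(1) by (simp add: group_word)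
      ultimately show "y \<in> \<pi> g t (N #> k)" unfolding \<pi>_def by blast
    qed
    have VK: "t \<otimes> k \<otimes> inv g \<in> K" if "(g,t) \<in> V" "k \<in> K" for g t k
    proof -
      have c: "g \<in> carrier G" "t \<in> carrier G" "k \<in> carrier G" "t \<in> T" using that tt kk by (auto simp: V_def)
      have "conjg t k \<in> K" using nTK c that by (simp add: normalizes_def)
      then have "(conjg t k) \<otimes> (t \<otimes> inv g) \<in> K" using that kk(3) by (auto simp: V_def)
      then show ?thesis using c by (simp add: group_word)
    qed
    have \<pi>S: "\<pi> g t C \<in> S'" if v: "(g,t) \<in> V" and C: "C \<in> S'" for g t C
    proof -
      obtain k where k: "k \<in> K" "C = N #> k" using C by (auto simp: S'_def)
      have "\<pi> g t C = N #> (t \<otimes> k \<otimes> inv g)" unfolding k(2) using \<pi>c v kk(1)[OF k(1)] by (simp add: V_def)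
      then show ?thesis using VK[OF v k(1)] by (simp add: S'_def)
    qed
    have bij: "bij_betw (\<pi> g t) S' S'" if v: "(g,t) \<in> V" for g t
    proof -
      have c: "g \<in> carrier G" "t \<in> carrier G" using v tt by (auto simp: V_def)
      have "inj_on (\<pi> g t) S'"
      proof (rule inj_onI)
        fix C C' assume C: "C \<in> S'" "C' \<in> S'" "\<pi> g t C = \<pi> g t C'"
        have sub: "C \<subseteq> carrier G" "C' \<subseteq> carrier G" using C(1,2) r_coset_subset_G[OF subgroup.subset[OF N(1)]] kk(1) by (auto simp: S'_def)
        have "inj_on (\<lambda>y. t \<otimes> y \<otimes> inv g) (carrier G)" using c by (auto simp: inj_on_def)
        then show "C = C'" using C(3) sub unfolding \<pi>_def by (metis inj_on_image_eq_iff)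
      qed
      moreover have "\<pi> g t ` S' \<subseteq> S'" using \<pi>S[OF v] by auto
      ultimately show ?thesis using endo_inj_surj[OF fS] by (simp add: bij_betw_def)
    qed
    have \<pi>hom: "\<pi> (g \<otimes> g') (t \<otimes> t') C = \<pi> g t (\<pi> g' t' C)" if v: "(g,t) \<in> V" "(g',t') \<in> V" and C: "C \<in> S'" for g t g' t' C
    proof -
      obtain k where k: "k \<in> K" "C = N #> k" using C by (auto simp: S'_def)
      have c: "g \<in> carrier G" "t \<in> carrier G" "t \<in> T" "g' \<in> carrier G" "t' \<in> carrier G" "t' \<in> T" "k \<in> carrier G"
        using v tt kk k by (auto simp: V_def)
      show ?thesis unfolding k(2)
        using \<pi>c[OF tt(3)[OF c(3) c(6)] m_closed[OF c(1,4)] c(7)] \<pi>c[OF c(6,4,7)] \<pi>c[OF c(3,1), of "t' \<otimes> k \<otimes> inv g'"] c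
        by (simp add: group_word)
    qed
    define s where "s = (\<lambda>g t. sign_on S' (\<pi> g t))"
    have shom: "s (g \<otimes> g') (t \<otimes> t') = s g t * s g' t'" if v: "(g,t) \<in> V" "(g',t') \<in> V" for g t g' t'
    proof -
      have "s (g \<otimes> g') (t \<otimes> t') = sign_on S' (\<pi> g t \<circ> \<pi> g' t')" unfolding s_def
        by (rule sign_on_cong) (use \<pi>hom[OF v] in auto)
      then show ?thesis unfolding s_def using sign_on_compose[OF bij[OF v(1)] bij[OF v(2)] fS] by simp
    qed
    have spm: "s g t = 1 \<or> s g t = -1" for g t
      unfolding s_def sign_on_def by (metis sign_def)
    have Vk: "(k, \<one>) \<in> V" if "k \<in> K" for k using that kk tt(2) by (simp add: V_def)
    have Vt: "(t, t) \<in> V" if "t \<in> T" for t using that tt(1) kk(2) by (simp add: V_def)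
    define L where "L = {k \<in> K. s k \<one> = 1}"
    have sK: "s (k \<otimes> k') \<one> = s k \<one> * s k' \<one>" if "k \<in> K" "k' \<in> K" for k k'
      using shom[OF Vk[OF that(1)] Vk[OF that(2)]] by simp
    have L: "subgroup L G" unfolding L_def by (rule sign_kernel_sub[OF K]) (use sK spm in auto)
    \<comment> \<open>Because \<open>G = K <#> T\<close>, each \<open>g\<close> has a partner
      \<open>t\<close> with \<open>(g, t)\<close> in \<open>V\<close>. Then \<open>(g k, t)\<close>
      factors as \<open>(g, t) (k, \<one>)\<close> and as \<open>(g k g^-1, \<one>) (g, t)\<close>,
      so \<open>k\<close> and its conjugate have the same sign.\<close>
    have nL: "normalizes ?G L" unfolding normalizes_def
    proof (intro ballI)
      fix g k assume g: "g \<in> carrier G" and k: "k \<in> L"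
      have kK: "k \<in> K" "k \<in> carrier G" using k kk by (auto simp: L_def)
      obtain k' t where kt: "k' \<in> K" "t \<in> T" "g = k' \<otimes> t" using g BG by (metis set_mult_iff)
      have "t \<otimes> inv g = inv k'" using kt kk(1) tt(1) by (simp add: group_word)
      then have v: "(g, t) \<in> V" using g kt kk(4) by (simp add: V_def)
      have gk: "conjg g k \<in> K" using nK g kK by (simp add: normalizes_def)
      have tc: "t \<in> carrier G" using kt tt by simp
      have "s (g \<otimes> k) (t \<otimes> \<one>) = s g t * s k \<one>" by (rule shom[OF v Vk[OF kK(1)]])
      moreover have "s ((conjg g k) \<otimes> g) (\<one> \<otimes> t) = s (conjg g k) \<one> * s g t" by (rule shom[OF Vk[OF gk] v])
      moreover have "(conjg g k) \<otimes> g = g \<otimes> k" using g kK by (simp add: group_word)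
      ultimately have "s g t * s k \<one> = s (conjg g k) \<one> * s g t" using tc by simp
      then have "s (conjg g k) \<one> = s k \<one>" using spm[of g t] by auto
      then show "conjg g k \<in> L" using gk k by (simp add: L_def)
    qed
    \<comment> \<open>A nontrivial sign on \<open>K\<close> would have a kernel of index 2 in
      \<open>K\<close>, normal in \<open>G\<close> and of 2-power index, against the minimality of
      \<open>K\<close>.\<close>
    have LK: "L = K"
    proof (rule ccontr)
      assume "L \<noteq> K"
      then obtain y where y: "y \<in> K" "y \<notin> L" by (auto simp: L_def)
      have yc: "y \<in> carrier G" using y kk by auto
      have sy: "s y \<one> = -1" using y spm[of y \<one>] by (auto simp: L_def)
      have y2: "y \<otimes> y \<in> L" using sK[OF y(1) y(1)] sy y kk(3) by (simp add: L_def)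
      have ny: "\<And>w. w \<in> L \<Longrightarrow> conjg y w \<in> L" using nL yc by (simp add: normalizes_def)
      note big = insert_coset_subgroup[OF L yc y(2) y2 ny]
      have "L \<union> (L #> y) = K"
      proof (intro equalityI subsetI)
        fix w assume "w \<in> L \<union> (L #> y)"
        then show "w \<in> K" using y(1) by (auto simp: L_def rcos_iff intro!: kk(3))
      next
        fix w assume w: "w \<in> K"
        have wc: "w \<in> carrier G" using w kk by auto
        show "w \<in> L \<union> (L #> y)"
        proof (cases "w \<in> L")
          case False
          have sw: "s w \<one> = -1" using False w spm[of w \<one>] by (auto simp: L_def)
          have wy: "w \<otimes> inv y \<in> K" using w y kk by simp
          have e: "(w \<otimes> inv y) \<otimes> y = w" using wc yc by (simp add: group_word)
          have "s (w \<otimes> inv y) \<one> = 1" using sK[OF wy y(1)] unfolding e using sw sy by simp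
          then have "w \<otimes> inv y \<in> L" using wy by (simp add: L_def)
          then show ?thesis using e unfolding Un_iff rcos_iff by metis
        qed simp
      qed
      then have cL: "card K = 2 * card L" using big(2) by simp
      have "card ?G = 2 ^ Suc j * card L" using j cL by simp
      then have "P L" unfolding P_def using L nL by blast
      from min[OF this] show False using cL sub_pos[OF L] by simp
    qed
    \<comment> \<open>On the diagonal the sign is a homomorphism on \<open>T\<close>, so it is
      trivial on \<open>sq T\<close>, and \<open>x\<close> lies there.\<close>
    define T0 where "T0 = {t \<in> T. s t t = 1}"
    have sT: "s (t \<otimes> t') (t \<otimes> t') = s t t * s t' t'" if "t \<in> T" "t' \<in> T" for t t'
      by (rule shom[OF Vt[OF that(1)] Vt[OF that(2)]])
    have T0: "subgroup T0 G" unfolding T0_def by (rule sign_kernel_sub[OF T(1)]) (use sT spm in auto)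
    have "sq T \<subseteq> T0" by (rule sq_least[OF T0]) (use sT spm tt(3) in \<open>auto simp: T0_def\<close>, metis mult_minus_right minus_minus mult.right_neutral)
    then have "s x x = 1" using x(1) QsT by (auto simp: T0_def)
    have V1x: "(\<one>, x) \<in> V" using xT by (simp add: V_def)
    have "s x x = s x \<one> * s \<one> x" using shom[OF Vk[OF xT(2)] V1x] xT by simp
    moreover have "s x \<one> = 1" using LK xT(2) by (auto simp: L_def)
    \<comment> \<open>Left multiplication by \<open>x\<close> is an involution on the
      \<open>2 * q\<close> cosets, as \<open>x^2\<close> lies in \<open>N\<close>, and fixes none of
      them, as \<open>x\<close> does not. It is a product of \<open>q\<close> transpositions with
      \<open>q\<close> odd. This contradicts \<open>(x, x) = (x, \<one>) (\<one>, x)\<close>, where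
      the other two signs are 1.\<close>
    moreover have "s \<one> x = -1"
    proof -
      define p where "p = (\<lambda>C. if C \<in> S' then \<pi> \<one> x C else C)"
      have pb: "bij_betw p S' S'" using bij[OF V1x] by (rule bij_betw_cong[THEN iffD1, rotated]) (simp add: p_def)
      have pp: "p permutes S'" by (rule bij_imp_permutes[OF pb]) (simp add: p_def)
      have "s \<one> x = sign_on S' p" unfolding s_def by (rule sign_on_cong) (auto simp: p_def)
      also have "\<dots> = sign p" by (rule sign_on_permutes[OF pp subset_refl])
      also have "\<dots> = (- 1) ^ (card S' div 2)"
      proof (rule sign_fpf_involution[OF fS pp])
        fix C assume C: "C \<in> S'"
        then obtain k where k: "k \<in> K" "C = N #> k" by (auto simp: S'_def)
        have kc: "k \<in> carrier G" using k kk by auto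
        have xk: "x \<otimes> k \<in> K" "x \<otimes> k \<in> carrier G" using k xT kk by auto
        have e: "\<pi> \<one> x (N #> k) = N #> (x \<otimes> k)" using \<pi>c[OF xT(1) one_closed kc] xk by simp
        have e2: "\<pi> \<one> x (N #> (x \<otimes> k)) = N #> (x \<otimes> (x \<otimes> k))" using \<pi>c[OF xT(1) one_closed xk(2)] xk xT by simp
        have m: "N #> (x \<otimes> k) \<in> S'" using xk by (simp add: S'_def)
        have "p (p C) = N #> (x \<otimes> (x \<otimes> k))" using e e2 m C k(2) by (simp add: p_def)
        also have "\<dots> = N #> k" 
        proof (subst rcos_eq_iff[OF N(1)])
          show "x \<otimes> (x \<otimes> k) \<otimes> inv k \<in> N" using x(3) xT(3) kc by (simp add: group_word)
        qed (use xT kc in auto)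
        finally have 1: "p (p C) = C" using k by simp
        have "p C \<noteq> C"
        proof
          assume "p C = C"
          then have "N #> (x \<otimes> k) = N #> k" using C k e by (simp add: p_def)
          then have "x \<otimes> k \<otimes> inv k \<in> N" using rcos_eq_iff[OF N(1) xk(2) kc] by simp
          then show False using x(2) xT(3) kc by (simp add: group_word)
        qed
        then show "p (p C) = C \<and> p C \<noteq> C" using 1 by simp
      qed
      finally show ?thesis using cS oq(2) by simp
    qed
    ultimately show False using \<open>s x x = 1\<close> by simp
  qed
  moreover have "odd (card K)" using cK oq(2) \<open>Q = {\<one>}\<close> by simp
  ultimately show ?thesis using K nK BG by (auto simp: Q_def)
qed

lemma set_mult_one_right: "subgroup A G \<Longrightarrow> A <#> {\<one>} = A"
  using subD(1)[of A] by (force simp: set_mult_def)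

section \<open>Permutation groups attaining the bound\<close>

text \<open>Raising to the power \<open>2 * c + 2 = card K + 1\<close> is the identity on
  \<open>K\<close>, so every element of a group of odd order is a power of its own square.\<close>

lemma odd_sub_root:
  assumes K: "subgroup K G" and c: "card K = 2 * c + 1" and x: "x \<in> K"
  shows "x = (x \<otimes> x) [^] (c + 1)"
proof -
  have xc: "x \<in> carrier G" using K x subD by blast
  have "(x \<otimes> x) [^] (c + 1) = x [^] (2 * (c + 1))"
    using xc nat_pow_pow[of x 2 "c + 1"] by (simp add: numeral_2_eq_2)
  also have "\<dots> = x [^] (card K + 1)" using c by simp
  also have "\<dots> = x [^] card K \<otimes> x" by simp
  finally show ?thesis using pow_card_sub[OF K x] xc by simp
qed

lemma odd_sub_square_one:
  assumes K: "subgroup K G" and c: "odd (card K)" and x: "x \<in> K" and "x \<otimes> x = \<one>"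
  shows "x = \<one>"
  using odd_sub_root[OF K _ x] c assms(4) by (metis nat_pow_one oddE)

lemma pow_in_sub: "subgroup A G \<Longrightarrow> x \<in> A \<Longrightarrow> x [^] (n::nat) \<in> A"
  by (induction n) (auto simp: subD)

lemma odd_sub_sq:
  assumes K: "subgroup K G" and c: "odd (card K)" and T: "subgroup T G" and "K \<subseteq> T"
  shows "K \<subseteq> sq T"
proof
  fix x assume x: "x \<in> K"
  obtain c' where c': "card K = 2 * c' + 1" using c by (auto elim: oddE)
  have "x \<otimes> x \<in> sq T" using x assms(4) sq_mem by blast
  then have "(x \<otimes> x) [^] (c' + 1) \<in> sq T" by (rule pow_in_sub[OF sq_sub[OF T]])
  then show "x \<in> sq T" using odd_sub_root[OF K c' x] by simp
qed

text \<open>Below, \<open>tight\<close> always means equality in the bound for 2-groups of permutations.\<close>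

lemma tight_removal:
  assumes T: "subgroup T G" "card T = 2 ^ m" and a: "acts T \<phi> D" "finite D"
    and tight: "2 ^ (card D div 2) * card (sq T) \<le> card T"
    and W: "W \<subseteq> D" "\<And>t x. t \<in> T \<Longrightarrow> x \<in> D - W \<Longrightarrow> \<phi> t x \<in> D - W"
    and f: "fixer T \<phi> (D - W) \<subseteq> {\<one>}"
  shows "card W \<le> 1" "W \<noteq> {} \<Longrightarrow> odd (card D)"
proof -
  have a': "acts T \<phi> (D - W)" by (rule acts_subset[OF a(1)]) (use W(2) in auto)
  have "fixer T \<phi> (D - W) = {\<one>}" using f subD(2)[OF fixer_sub[OF T(1) a' subset_refl]] by auto
  then have "card T \<le> 2 ^ (card (D - W) div 2) * card (sq T)"
    using two_group_bound[OF T _ a'] a(2) set_mult_one_right[OF sq_sub[OF T(1)]] by simp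
  then have "2 ^ (card D div 2) * card (sq T) \<le> 2 ^ (card (D - W) div 2) * card (sq T)" using tight by linarith
  then have "(2::nat) ^ (card D div 2) \<le> 2 ^ (card (D - W) div 2)" using sub_pos[OF sq_sub[OF T(1)]] by simp
  then have le: "card D div 2 \<le> card (D - W) div 2" by simp
  have fW: "finite W" using W a finite_subset by blast
  have cD: "card D = card (D - W) + card W" using W(1) a(2) fW by (simp add: card_Diff_subset card_mono)
  show "card W \<le> 1" using le cD by linarith
  assume "W \<noteq> {}"
  then have "card W \<ge> 1" using fW by (simp add: Suc_leI card_gt_0_iff)
  then show "odd (card D)" using le cD by presburger
qed

text \<open>Points fixed by all of \<open>T\<close> can be removed without losing
  faithfulness.\<close>

lemma tight_fixed_points:
  assumes T: "subgroup T G" "card T = 2 ^ m" and a: "acts T \<phi> D" "finite D"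
    and faith: "fixer T \<phi> D \<subseteq> {\<one>}"
    and tight: "2 ^ (card D div 2) * card (sq T) \<le> card T"
    and W: "W \<subseteq> D" "\<And>t w. t \<in> T \<Longrightarrow> w \<in> W \<Longrightarrow> \<phi> t w = w"
  shows "card W \<le> 1" "W \<noteq> {} \<Longrightarrow> odd (card D)"
proof -
  have "fixer T \<phi> (D - W) \<subseteq> {\<one>}" using faith W(2) unfolding fixer_def by blast
  moreover have "\<phi> t x \<in> D - W" if t: "t \<in> T" and x: "x \<in> D - W" for t x
    using acts_inj[OF T(1) a(1) t, of x "\<phi> t x"] W(1) W(2)[OF t, of "\<phi> t x"] actsD(1)[OF a(1) t, of x] x by auto
  ultimately show "card W \<le> 1" "W \<noteq> {} \<Longrightarrow> odd (card D)"
    using tight_removal[OF T a tight W(1)] by blast+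
qed

text \<open>\<open>t\<close> normalizes \<open>M\<close> and so permutes the
  \<open>M\<close>-orbits; whether it maps the orbit of \<open>x\<close> to itself can be read off
  at any point of that orbit.\<close>

lemma normalized_orbit:
  assumes T: "subgroup T G" and M: "subgroup M G" and TM: "T \<subseteq> B" "M \<subseteq> B" and B: "subgroup B G" and a: "acts B \<phi> D"
    and n: "normalizes T M" and x: "x \<in> D" and t: "t \<in> T" and y: "y \<in> (\<lambda>g. \<phi> g x) ` M"
  shows "\<phi> t y \<in> (\<lambda>g. \<phi> g x) ` M \<longleftrightarrow> \<phi> t x \<in> (\<lambda>g. \<phi> g x) ` M"
proof -
  obtain g where g: "g \<in> M" "y = \<phi> g x" using y by auto
  have B': "t \<in> B" "g \<in> B" "t \<in> carrier G" "g \<in> carrier G" using t g TM subD(1)[OF B] by auto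
  have tg: "conjg t g \<in> M" using n t g by (simp add: normalizes_def)
  then have tgB: "conjg t g \<in> B" using TM by auto
  have aM: "acts M \<phi> D" by (rule acts_mono[OF a TM(2)])
  have tx: "\<phi> t x \<in> D" using actsD(1)[OF a B'(1) x] .
  have "\<phi> t y = \<phi> (t \<otimes> g) x" using actsD(2)[OF a B'(1,2) x] g by simp
  also have "t \<otimes> g = (conjg t g) \<otimes> t" using B' by (simp add: group_word)
  also have "\<phi> ((conjg t g) \<otimes> t) x = \<phi> (conjg t g) (\<phi> t x)" using actsD(2)[OF a tgB B'(1) x] .
  finally show ?thesis using orbit_invariant[OF M aM x tg tx] by simp
qed

text \<open>The orbit \<open>\<Delta>\<close> of \<open>x\<close> under \<open>M\<close> has odd
  length, so its setwise stabilizer \<open>U\<close> in \<open>T\<close> fixes a point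
  \<open>\<omega>\<close> of it. The \<open>T\<close>-orbit \<open>W\<close> of
  \<open>\<omega>\<close> meets every translate of \<open>\<Delta>\<close> in exactly one point,
  while the translates have further points. So the points outside \<open>W\<close> still determine
  an element of \<open>T\<close>, and \<open>tight_removal\<close> leaves only
  \<open>W = {\<omega>}\<close>.\<close>

lemma odd_orbit_fixed_point:
  assumes T: "subgroup T G" "card T = 2 ^ m" and a: "acts (carrier G) \<phi> D" "finite D"
    and faith: "fixer (carrier G) \<phi> D = {\<one>}"
    and tight: "2 ^ (card D div 2) * card (sq T) \<le> card T"
    and M: "subgroup M G" "odd (card M)" and n: "normalizes T M"
    and x: "x \<in> D" "g \<in> M" "\<phi> g x \<noteq> x"
  shows "\<exists>\<omega>\<in>(\<lambda>g. \<phi> g x) ` M. \<forall>t\<in>T. \<phi> t \<omega> = \<omega>"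
proof -
  note tt = subD[OF T(1)] and mm = subD[OF M(1)]
  have TG: "T \<subseteq> carrier G" "M \<subseteq> carrier G" using T M subgroup.subset by auto
  have aT: "acts T \<phi> D" by (rule acts_mono[OF a(1) TG(1)])
  have aM: "acts M \<phi> D" by (rule acts_mono[OF a(1) TG(2)])
  define \<Delta> where "\<Delta> = (\<lambda>g. \<phi> g x) ` M"
  have \<Delta>D: "\<Delta> \<subseteq> D" using actsD(1)[OF aM _ x(1)] by (auto simp: \<Delta>_def)
  have f\<Delta>: "finite \<Delta>" using \<Delta>D a(2) finite_subset by blast
  have x\<Delta>: "x \<in> \<Delta>" unfolding \<Delta>_def using actsD(3)[OF aM x(1)] mm(2) by force
  have key: "\<phi> t y \<in> \<Delta> \<longleftrightarrow> \<phi> t x \<in> \<Delta>" if "t \<in> T" "y \<in> \<Delta>" for t y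
    using normalized_orbit[OF T(1) M(1) TG sub_carrier a(1) n x(1) that(1) that(2)[unfolded \<Delta>_def]] by (simp add: \<Delta>_def)
  have o\<Delta>: "odd (card \<Delta>)" using orbit_stab[OF M(1) aM x(1)] M(2) by (simp add: \<Delta>_def)
  define U where "U = {t \<in> T. \<phi> t x \<in> \<Delta>}"
  have U: "subgroup U G"
  proof (rule subgroupI)
    show "U \<subseteq> carrier G" using TG by (auto simp: U_def)
    show "U \<noteq> {}" using tt(2) actsD(3)[OF aT x(1)] x\<Delta> by (auto simp: U_def intro!: exI[of _ \<one>])
    fix t assume t: "t \<in> U"
    then have tT: "t \<in> T" "inv t \<in> T" using tt by (auto simp: U_def)
    have "\<phi> (inv t) (\<phi> t x) \<in> \<Delta>" using acts_inv(1)[OF T(1) aT tT(1) x(1)] x\<Delta> by simp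
    then have "\<phi> (inv t) x \<in> \<Delta>" using key[OF tT(2)] t by (simp add: U_def)
    then show "inv t \<in> U" using tT by (simp add: U_def)
    fix s assume s: "s \<in> U"
    then have sT: "s \<in> T" by (simp add: U_def)
    have "\<phi> t (\<phi> s x) \<in> \<Delta>" using key[OF tT(1)] s t by (simp add: U_def)
    then show "t \<otimes> s \<in> U" using actsD(2)[OF aT tT(1) sT x(1)] tt(3)[OF tT(1) sT] by (simp add: U_def)
  qed
  have UT: "U \<subseteq> T" by (auto simp: U_def)
  obtain j where j: "card U = 2 ^ j" using pow_two_dvd[OF U T(1) UT T(2)] by auto
  have aU: "acts U \<phi> \<Delta>" by (rule acts_subset[OF aT UT \<Delta>D]) (use key UT in \<open>auto simp: U_def\<close>)
  have "odd (card {y \<in> \<Delta>. \<forall>t\<in>U. \<phi> t y = y})" using fixed_points_parity[OF U j f\<Delta> aU] o\<Delta> by simp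
  then obtain \<omega> where w: "\<omega> \<in> \<Delta>" "\<And>t. t \<in> U \<Longrightarrow> \<phi> t \<omega> = \<omega>"
    by (metis (mono_tags, lifting) card.empty empty_Collect_eq even_zero)
  have wD: "\<omega> \<in> D" using w \<Delta>D by auto
  have wU: "\<phi> s \<omega> = \<omega>" if "s \<in> T" "\<phi> s y \<in> \<Delta>" "y \<in> \<Delta>" for s y
    using w(2)[of s] key[OF that(1,3)] that by (simp add: U_def)
  define W where "W = (\<lambda>t. \<phi> t \<omega>) ` T"
  have WD: "W \<subseteq> D" using actsD(1)[OF aT _ wD] by (auto simp: W_def)
  have Winv: "\<phi> t y \<in> D - W" if "t \<in> T" "y \<in> D - W" for t y
    using orbit_invariant[OF T(1) aT wD that(1), of y] actsD(1)[OF aT that(1)] that(2) by (auto simp: W_def)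
  have W\<Delta>: "y = \<omega>" if "y \<in> W" "y \<in> \<Delta>" for y
    using that wU[OF _ _ w(1)] by (auto simp: W_def)
  have "\<exists>y\<in>\<Delta>. y \<noteq> \<omega>"
  proof (rule ccontr)
    assume "\<not> (\<exists>y\<in>\<Delta>. y \<noteq> \<omega>)"
    moreover have "\<phi> g x \<in> \<Delta>" using x by (auto simp: \<Delta>_def)
    ultimately show False using x\<Delta> x(3) by metis
  qed
  then obtain y where y: "y \<in> \<Delta>" "y \<noteq> \<omega>" by blast
  have yW: "y \<in> D - W" using y W\<Delta> \<Delta>D by auto
  have "fixer T \<phi> (D - W) \<subseteq> {\<one>}"
  proof
    \<comment> \<open>A point \<open>z = \<phi> r \<omega>\<close> of \<open>W\<close> shares the
      translate of \<open>\<Delta>\<close> under \<open>r\<close> with \<open>\<phi> r y\<close>,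
      which lies outside \<open>W\<close> and is fixed by \<open>t\<close>. Conjugating back by
      \<open>r\<close> gives an element of \<open>T\<close> that fixes \<open>y\<close>, hence
      stabilizes \<open>\<Delta>\<close>, hence fixes \<open>\<omega>\<close>; so \<open>t\<close>
      fixes \<open>z\<close>.\<close>
    fix t assume t: "t \<in> fixer T \<phi> (D - W)"
    then have tT: "t \<in> T" "\<And>y. y \<in> D - W \<Longrightarrow> \<phi> t y = y" by (auto simp: fixer_def)
    have "\<phi> t z = z" if z: "z \<in> D" for z
    proof (cases "z \<in> W")
      case True
      then obtain r where r: "r \<in> T" "z = \<phi> r \<omega>" by (auto simp: W_def)
      have irT: "inv r \<in> T" "inv r \<otimes> t \<in> T" "inv r \<otimes> t \<otimes> r \<in> T" using r tT tt by auto
      have ry: "\<phi> r y \<in> D - W" by (rule Winv[OF r(1) yW])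
      have yD: "y \<in> D" using yW by simp
      have "\<phi> (inv r \<otimes> t \<otimes> r) y = \<phi> (inv r) (\<phi> t (\<phi> r y))"
        using actsD(2)[OF aT irT(2) r(1) yD] actsD(2)[OF aT irT(1) tT(1), of "\<phi> r y"] ry by simp
      also have "\<dots> = y" using tT(2)[OF ry] acts_inv(1)[OF T(1) aT r(1) yD] by simp
      finally have "\<phi> (inv r \<otimes> t \<otimes> r) \<omega> = \<omega>" using wU[OF irT(3) _ y(1)] y(1) by simp
      moreover have "\<phi> (inv r \<otimes> t \<otimes> r) \<omega> = \<phi> (inv r) (\<phi> t (\<phi> r \<omega>))"
        using actsD(2)[OF aT irT(2) r(1) wD] actsD(2)[OF aT irT(1) tT(1), of "\<phi> r \<omega>"] r z by simp
      ultimately have "\<phi> r \<omega> = \<phi> r (\<phi> (inv r) (\<phi> t (\<phi> r \<omega>)))" by simp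
      also have "\<dots> = \<phi> t (\<phi> r \<omega>)" by (rule acts_inv(2)[OF T(1) aT r(1)]) (use actsD(1)[OF aT tT(1)] r z in auto)
      finally show ?thesis using r by simp
    next
      case False then show ?thesis using tT(2) z by simp
    qed
    then have "t \<in> fixer (carrier G) \<phi> D" using tT(1) TG by (auto simp: fixer_def)
    then show "t \<in> {\<one>}" using faith by simp
  qed
  from tight_removal(1)[OF T aT a(2) tight WD Winv this]
  have "card W \<le> 1" .
  moreover have "\<omega> \<in> W" unfolding W_def using actsD(3)[OF aT wD] tt(2) by force
  moreover have "finite W" using WD a(2) finite_subset by blast
  ultimately have "W = {\<omega>}" by (metis card_le_Suc0_iff_eq One_nat_def is_singletonI' is_singleton_the_elem empty_iff singletonD)
  then have "\<forall>t\<in>T. \<phi> t \<omega> = \<omega>" by (auto simp: W_def)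
  then show ?thesis using w(1) by (auto simp: \<Delta>_def)
qed

lemma dvd_five_cases: "b dvd 5 \<Longrightarrow> b = 1 \<or> b = (5::nat)"
proof -
  assume b: "b dvd 5"
  then have "b \<le> 5" by (auto dest: dvd_imp_le)
  then have "b = 0 \<or> b = 1 \<or> b = 2 \<or> b = 3 \<or> b = 4 \<or> b = 5" by linarith
  then show ?thesis using b by (elim disjE) simp_all
qed

text \<open>Suppose that \<open>x\<close> is fixed and not inverted, and \<open>y\<close> inverted
  and not fixed. Then \<open>x y\<close> goes to \<open>x y^-1\<close>, which can only be the
  inverse of \<open>x y\<close>, so that \<open>y\<close> inverts \<open>x\<close>. Now
  \<open>y^2\<close> centralizes \<open>x\<close>, and \<open>y\<close>, being a power of
  \<open>y^2\<close>, does too; so \<open>x\<close> is its own inverse, a contradiction.\<close>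

lemma odd_fix_or_invert:
  assumes K: "subgroup K G" "odd (card K)" and t: "t \<in> carrier G"
    and alt: "\<And>k. k \<in> K \<Longrightarrow> conjg t k = k \<or> conjg t k = inv k"
  shows "(\<forall>k\<in>K. conjg t k = k) \<or> (\<forall>k\<in>K. conjg t k = inv k)"
proof (rule ccontr)
  note kk = subD[OF K(1)]
  assume "\<not> ?thesis"
  then obtain x y where x: "x \<in> K" "conjg t x = x" "conjg t x \<noteq> inv x"
    and y: "y \<in> K" "conjg t y = inv y" "conjg t y \<noteq> y" using alt by metis
  have c: "x \<in> carrier G" "y \<in> carrier G" using x y kk by auto
  have inv_ne: "inv y \<noteq> y" "inv x \<noteq> x" using x y by auto
  have "t \<otimes> (x \<otimes> y) \<otimes> inv t = (conjg t x) \<otimes> (conjg t y)" using c t by (simp add: group_word)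
  then have e: "t \<otimes> (x \<otimes> y) \<otimes> inv t = x \<otimes> inv y" using x y by simp
  from alt[OF kk(3)[OF x(1) y(1)]] show False
  proof
    assume "t \<otimes> (x \<otimes> y) \<otimes> inv t = x \<otimes> y"
    then have "inv y = y" using e c by simp
    then show False using inv_ne by simp
  next
    assume "t \<otimes> (x \<otimes> y) \<otimes> inv t = inv (x \<otimes> y)"
    then have "x \<otimes> inv y = inv y \<otimes> inv x" using e c by (simp add: inv_mult_group)
    then have "y \<otimes> (x \<otimes> inv y) = y \<otimes> (inv y \<otimes> inv x)" by simp
    then have yx: "conjg y x = inv x" using c by (simp add: m_assoc)
    define B where "B = {z \<in> carrier G. conjg z x = x}"
    have B: "subgroup B G"
    proof (rule subgroupI)
      show "B \<subseteq> carrier G" by (auto simp: B_def)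
      show "B \<noteq> {}" using c by (auto simp: B_def intro!: exI[of _ \<one>])
      fix a assume a: "a \<in> B"
      then have ac: "a \<in> carrier G" and ax: "conjg a x = x" by (auto simp: B_def)
      have "inv a \<otimes> (conjg a x) \<otimes> a = x" using ac c(1) by (simp add: group_word)
      then show "inv a \<in> B" unfolding ax using ac by (simp add: B_def)
      fix b assume b: "b \<in> B"
      then have bc: "b \<in> carrier G" and bx: "conjg b x = x" by (auto simp: B_def)
      have "(a \<otimes> b) \<otimes> x \<otimes> inv (a \<otimes> b) = a \<otimes> (conjg b x) \<otimes> inv a" using ac bc c(1) by (simp add: group_word)
      then show "a \<otimes> b \<in> B" unfolding bx ax using ac bc by (simp add: B_def)
    qed
    have "y \<otimes> inv x \<otimes> inv y = inv (conjg y x)" using c by (simp add: group_word)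
    then have yx': "y \<otimes> inv x \<otimes> inv y = x" unfolding yx using c by simp
    have "(y \<otimes> y) \<otimes> x \<otimes> inv (y \<otimes> y) = y \<otimes> (conjg y x) \<otimes> inv y" using c by (simp add: group_word)
    then have "y \<otimes> y \<in> B" unfolding yx yx' using c by (simp add: B_def)
    obtain c' where c': "card K = 2 * c' + 1" using K(2) by (auto elim: oddE)
    have "y \<in> B" using odd_sub_root[OF K(1) c' y(1)] pow_in_sub[OF B \<open>y \<otimes> y \<in> B\<close>, of "c' + 1"] by metis
    then have "inv x = x" using yx by (simp add: B_def)
    then show False using inv_ne by simp
  qed
qed

text \<open>Every nontrivial \<open>K\<close>-orbit contains a fixed point of \<open>T\<close>, and
  there is only one such point \<open>\<omega>\<close>. So \<open>K\<close> moves the points of a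
  single orbit \<open>\<Delta>\<close>, regularly, and \<open>T\<close> acts on
  \<open>\<Delta>\<close> as on \<open>K\<close> by conjugation. The kernel \<open>C\<close> on the
  other points then embeds into the automorphisms of \<open>K\<close>, yet equality in the bound
  demands a large elementary abelian quotient of \<open>C\<close>; this restricts \<open>|K|\<close>
  to 3 or 5.\<close>

lemma tight_odd_normalized:
  fixes \<phi> :: "'a \<Rightarrow> 'c \<Rightarrow> 'c"
  assumes T: "subgroup T G" "card T = 2 ^ m" and a: "acts (carrier G) \<phi> D" "finite D"
    and faith: "fixer (carrier G) \<phi> D = {\<one>}"
    and tight: "2 ^ (card D div 2) * card (sq T) \<le> card T"
    and K: "subgroup K G" "odd (card K)" "K \<noteq> {\<one>}" and n: "normalizes T K"
  shows "card K = 3 \<and> card {y \<in> D. \<exists>k\<in>K. \<phi> k y \<noteq> y} = 3 \<and>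
    (\<forall>y\<in>D. (\<exists>k\<in>K. \<phi> k y \<noteq> y) \<longrightarrow> (\<lambda>k. \<phi> k y) ` K = {y \<in> D. \<exists>k\<in>K. \<phi> k y \<noteq> y})"
proof -
  note tt = subD[OF T(1)] and kk = subD[OF K(1)]
  have TG: "T \<subseteq> carrier G" "K \<subseteq> carrier G" using T K subgroup.subset by auto
  have aT: "acts T \<phi> D" by (rule acts_mono[OF a(1) TG(1)])
  have aK: "acts K \<phi> D" by (rule acts_mono[OF a(1) TG(2)])
  have faithD: "g = \<one>" if "g \<in> carrier G" "\<And>x. x \<in> D \<Longrightarrow> \<phi> g x = x" for g
    using faith that by (auto simp: fixer_def)
  have faithT: "fixer T \<phi> D \<subseteq> {\<one>}" using faithD TG by (auto simp: fixer_def)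
  note F2 = odd_orbit_fixed_point[OF T a faith tight]
  have F1: "w = w'" if w: "w \<in> D" "w' \<in> D" "\<And>t. t \<in> T \<Longrightarrow> \<phi> t w = w" "\<And>t. t \<in> T \<Longrightarrow> \<phi> t w' = w'" for w w'
  proof (rule ccontr)
    assume ne: "w \<noteq> w'"
    have "card {w, w'} \<le> 1" by (rule tight_fixed_points(1)[OF T aT a(2) faithT tight]) (use w in auto)
    then show False using ne by simp
  qed
  define \<Delta> where "\<Delta> = {y \<in> D. \<exists>k\<in>K. \<phi> k y \<noteq> y}"
  obtain k0 where k0: "k0 \<in> K" "k0 \<noteq> \<one>" using K(3) kk(2) by blast
  then obtain x0 where x0: "x0 \<in> D" "\<phi> k0 x0 \<noteq> x0" using faithD TG by blast
  obtain \<omega> where w: "\<omega> \<in> (\<lambda>g. \<phi> g x0) ` K" "\<And>t. t \<in> T \<Longrightarrow> \<phi> t \<omega> = \<omega>"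
    using F2[OF K(1,2) n x0(1) k0(1) x0(2)] by blast
  have wD: "\<omega> \<in> D" using w(1) actsD(1)[OF aK _ x0(1)] by auto
  define E where "E = fixer K \<phi> {\<omega>}"
  have E: "subgroup E G" unfolding E_def by (rule fixer_sub[OF K(1) aK]) (use wD in simp)
  have EK: "E \<subseteq> K" by (auto simp: E_def fixer_def)
  have oE: "odd (card E)" using sub_card_dvd[OF E K(1) EK] K(2) by (meson dvd_trans)
  have nE: "normalizes T E" unfolding normalizes_def
  proof (intro ballI)
    fix t e assume t: "t \<in> T" and e: "e \<in> E"
    have eK: "e \<in> K" "\<phi> e \<omega> = \<omega>" using e by (auto simp: E_def fixer_def)
    have c: "t \<in> carrier G" "e \<in> carrier G" "inv t \<in> T" using t eK tt kk by auto
    have "conjg t e \<in> K" using n t eK by (simp add: normalizes_def)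
    moreover have "\<phi> (conjg t e) \<omega> = \<phi> t (\<phi> e (\<phi> (inv t) \<omega>))"
      using actsD(2)[OF a(1)] actsD(1)[OF a(1)] c wD by simp
    ultimately show "conjg t e \<in> E" using w(2) t c eK by (simp add: E_def fixer_def)
  qed
  \<comment> \<open>\<open>E\<close> is again odd and normalized by \<open>T\<close>. If it were
    nontrivial, one of its nontrivial orbits would contain a fixed point of \<open>T\<close>, that
    is \<open>\<omega>\<close>, but \<open>E\<close> fixes \<open>\<omega>\<close>.\<close>
  have E1: "E = {\<one>}"
  proof (rule ccontr)
    assume "E \<noteq> {\<one>}"
    then obtain e where e: "e \<in> E" "e \<noteq> \<one>" using subD(2)[OF E] by blast
    then obtain y where y: "y \<in> D" "\<phi> e y \<noteq> y" using faithD EK TG by blast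
    obtain w' where w': "w' \<in> (\<lambda>g. \<phi> g y) ` E" "\<And>t. t \<in> T \<Longrightarrow> \<phi> t w' = w'"
      using F2[OF E oE nE y(1) e(1) y(2)] by blast
    then obtain g where g: "g \<in> E" "w' = \<phi> g y" by auto
    have gK: "g \<in> K" using g EK by auto
    have "w' = \<omega>" using F1[OF _ wD w'(2) w(2)] g actsD(1)[OF aK gK y(1)] by simp
    then have "\<phi> g y = \<phi> g \<omega>" using g by (auto simp: E_def fixer_def)
    then have "y = \<omega>" using acts_inj[OF K(1) aK gK y(1) wD] by simp
    then show False using y e by (auto simp: E_def fixer_def)
  qed
  have orb: "(\<lambda>k. \<phi> k \<omega>) ` K = \<Delta>"
  proof (intro equalityI subsetI)
    fix y assume "y \<in> (\<lambda>k. \<phi> k \<omega>) ` K"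
    then obtain k where k: "k \<in> K" "y = \<phi> k \<omega>" by auto
    have yD: "y \<in> D" using k actsD(1)[OF aK _ wD] by simp
    let ?k = "conjg k k0"
    have c: "k \<in> carrier G" "k0 \<in> carrier G" "inv k \<in> K" using k k0 kk by auto
    have "\<phi> ?k y \<noteq> y"
    proof
      assume "\<phi> ?k y = y"
      moreover have "\<phi> ?k y = \<phi> k (\<phi> k0 (\<phi> (inv k) (\<phi> k \<omega>)))" unfolding k(2)
        using actsD(2)[OF a(1)] actsD(1)[OF a(1)] c wD by simp
      ultimately have "\<phi> k (\<phi> k0 \<omega>) = \<phi> k \<omega>" using acts_inv(1)[OF K(1) aK k(1) wD] k by simp
      then have "\<phi> k0 \<omega> = \<omega>" using acts_inj[OF K(1) aK k(1) actsD(1)[OF aK k0(1) wD] wD] by simp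
      then have "k0 \<in> E" using k0 by (simp add: E_def fixer_def)
      then show False using E1 k0 by simp
    qed
    moreover have "?k \<in> K" using k k0 kk by simp
    ultimately show "y \<in> \<Delta>" using yD by (auto simp: \<Delta>_def)
  next
    fix y assume "y \<in> \<Delta>"
    then obtain k where k: "y \<in> D" "k \<in> K" "\<phi> k y \<noteq> y" by (auto simp: \<Delta>_def)
    obtain w' where w': "w' \<in> (\<lambda>g. \<phi> g y) ` K" "\<And>t. t \<in> T \<Longrightarrow> \<phi> t w' = w'"
      using F2[OF K(1,2) n k] by blast
    then obtain g where g: "g \<in> K" "w' = \<phi> g y" by auto
    have "w' = \<omega>" using F1[OF _ wD w'(2) w(2)] g actsD(1)[OF aK g(1) k(1)] by simp
    then have "y = \<phi> (inv g) \<omega>" using g acts_inv(1)[OF K(1) aK g(1) k(1)] by simp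
    then show "y \<in> (\<lambda>k. \<phi> k \<omega>) ` K" using kk(4)[OF g(1)] by simp
  qed
  have \<Delta>D: "\<Delta> \<subseteq> D" by (auto simp: \<Delta>_def)
  have c\<Delta>: "card \<Delta> = card K" using orbit_stab[OF K(1) aK wD] E1 orb by (simp add: E_def)
  have oth: "(\<lambda>k. \<phi> k y) ` K = \<Delta>" if y: "y \<in> \<Delta>" for y
  proof -
    obtain r where r: "r \<in> K" "y = \<phi> r \<omega>" using y orb by blast
    have "(\<lambda>k. \<phi> k y) ` K = (\<lambda>k. \<phi> (k \<otimes> r) \<omega>) ` K" using actsD(2)[OF aK _ r(1) wD] r by (intro image_cong) auto
    also have "\<dots> = (\<lambda>k. \<phi> k \<omega>) ` ((\<lambda>k. k \<otimes> r) ` K)" by (simp add: image_image)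
    also have "(\<lambda>k. k \<otimes> r) ` K = K"
    proof (intro equalityI subsetI)
      fix z assume z: "z \<in> K"
      then have "z = (z \<otimes> inv r) \<otimes> r" using r kk(1) by (simp add: m_assoc)
      moreover have "z \<otimes> inv r \<in> K" using z r kk by simp
      ultimately show "z \<in> (\<lambda>k. k \<otimes> r) ` K" by blast
    qed (use r kk(3) in auto)
    finally show ?thesis using orb by simp
  qed
  \<comment> \<open>Since \<open>|D|\<close> and \<open>|\<Delta>| = 2 * c + 1\<close> are odd,
    \<open>|Y|\<close> is even, so leaving out \<open>\<Delta>\<close> lowers the exponent by
    exactly \<open>c\<close>, with no rounding.\<close>
  have nodd: "odd (card D)"
    by (rule tight_fixed_points(2)[OF T aT a(2) faithT tight, of "{\<omega>}"]) (use wD w(2) in auto)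
  obtain c where c: "card K = 2 * c + 1" using K(2) by (auto elim: oddE)
  have "card K \<noteq> 1" using K(3) kk(2) by (metis card_1_singletonE singletonD)
  then have c1: "c \<ge> 1" using c by (cases c) auto
  define Y where "Y = D - \<Delta>"
  have f\<Delta>: "finite \<Delta>" using \<Delta>D a(2) finite_subset by blast
  have cD: "card D = card Y + (2 * c + 1)" using \<Delta>D f\<Delta> c c\<Delta> card_mono[OF a(2) \<Delta>D] by (simp add: Y_def card_Diff_subset)
  then have cY: "card D div 2 = card Y div 2 + c" using nodd by presburger
  have conjact: "\<phi> t (\<phi> k \<omega>) = \<phi> (conjg t k) \<omega>" if t: "t \<in> T" and k: "k \<in> K" for t k
  proof -
    have cc: "t \<in> carrier G" "k \<in> carrier G" "inv t \<in> T" "inv t \<in> carrier G" using t k tt kk by auto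
    have "\<phi> (conjg t k) \<omega> = \<phi> (t \<otimes> k) (\<phi> (inv t) \<omega>)" by (rule actsD(2)[OF a(1)]) (use cc wD in auto)
    also have "\<dots> = \<phi> t (\<phi> k \<omega>)" using actsD(2)[OF a(1) cc(1,2) wD] w(2)[OF cc(3)] by simp
    finally show ?thesis by simp
  qed
  have T\<Delta>: "\<phi> t y \<in> \<Delta>" if t: "t \<in> T" and y: "y \<in> \<Delta>" for t y
  proof -
    obtain k where k: "k \<in> K" "y = \<phi> k \<omega>" using y orb by blast
    have "conjg t k \<in> K" using n t k by (simp add: normalizes_def)
    then show ?thesis using conjact[OF t k(1)] k(2) orb by blast
  qed
  have TY: "\<phi> t y \<in> Y" if t: "t \<in> T" and y: "y \<in> Y" for t y
  proof -
    have "\<phi> t y \<notin> \<Delta>"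
    proof
      assume "\<phi> t y \<in> \<Delta>"
      then have "\<phi> (inv t) (\<phi> t y) \<in> \<Delta>" using T\<Delta> tt(4)[OF t] by blast
      then show False using acts_inv(1)[OF T(1) aT t] y by (auto simp: Y_def)
    qed
    then show ?thesis using y actsD(1)[OF aT t] by (auto simp: Y_def)
  qed
  have aY: "acts T \<phi> Y" by (rule acts_subset[OF aT]) (use TY in \<open>auto simp: Y_def\<close>)
  have fY: "finite Y" using a(2) by (simp add: Y_def)
  define C where "C = fixer T \<phi> Y"
  have C: "subgroup C G" "C \<subseteq> T" using fixer_sub[OF T(1) aY subset_refl] by (auto simp: C_def fixer_def)
  note cc = subD[OF C(1)]
  have b1: "card T \<le> 2 ^ (card Y div 2) * card (sq T <#> C)" unfolding C_def by (rule two_group_bound[OF T fY aY])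
  \<comment> \<open>By \<open>conjact\<close>, centralizing \<open>K\<close> means fixing
    \<open>\<Delta>\<close> pointwise; elements of \<open>C\<close> fix the complement
    anyway.\<close>
  have central1: "t = \<one>" if t: "t \<in> C" and ce: "\<And>k. k \<in> K \<Longrightarrow> conjg t k = k" for t
  proof (rule faithD)
    have tT: "t \<in> T" using t C by auto
    then show "t \<in> carrier G" using tt by auto
    fix y assume y: "y \<in> D"
    show "\<phi> t y = y"
    proof (cases "y \<in> \<Delta>")
      case True
      then obtain k where k: "k \<in> K" "y = \<phi> k \<omega>" using orb by blast
      then show ?thesis using conjact[OF tT k(1)] ce[OF k(1)] by simp
    next
      case False then show ?thesis using t y by (auto simp: C_def fixer_def Y_def)
    qed
  qed
  have sT: "subgroup (sq T) G" by (rule sq_sub[OF T(1)])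
  have sTC: "sq C \<subseteq> (sq T <#> {\<one>}) \<inter> C"
    using sq_mono[OF T(1) C] sq_subset[OF C(1)] set_mult_one_right[OF sT] by auto
  \<comment> \<open>Only \<open>\<one>\<close> and possibly one further element of \<open>C\<close> fix all pairs \<open>{k, inv k}\<close>, and there are just \<open>c\<close> pairs.\<close>
  define P where "P = (\<lambda>k. {k, inv k}) ` (K - {\<one>})"
  have invne: "inv k \<noteq> k" if "k \<in> K - {\<one>}" for k
  proof
    assume "inv k = k"
    then have "k \<otimes> k = \<one>" using that kk(1) r_inv[of k] by simp
    then show False using odd_sub_square_one[OF K(1,2)] that by auto
  qed
  have "card (K - {\<one>}) = 2 * card P" unfolding P_def
  proof (rule card_fibers)
    show "finite (K - {\<one>})" using sub_fin[OF K(1)] by simp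
    fix b assume "b \<in> (\<lambda>k. {k, inv k}) ` (K - {\<one>})"
    then obtain k where k: "k \<in> K - {\<one>}" "b = {k, inv k}" by auto
    have kc: "k \<in> carrier G" using k kk by auto
    have "inv k \<in> K - {\<one>}" using k kk(4) kc by auto
    then have "{a \<in> K - {\<one>}. {a, inv a} = b} = {k, inv k}" using k kc by (auto simp: doubleton_eq_iff)
    then show "card {a \<in> K - {\<one>}. {a, inv a} = b} = 2" using invne[OF k(1)] by simp
  qed
  then have cP: "card P = c" using c kk(2) sub_fin[OF K(1)] by simp
  have fP: "finite P" using sub_fin[OF K(1)] by (simp add: P_def)
  define \<theta> where "\<theta> = (\<lambda>t p. (\<lambda>k. conjg t k) ` p)"
  have \<theta>P: "\<theta> t {k, inv k} = {conjg t k, inv (conjg t k)}" if "t \<in> carrier G" "k \<in> carrier G" for t k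
    using that by (simp add: \<theta>_def group_word)
  have a\<theta>: "acts C \<theta> P" unfolding acts_def
  proof (intro conjI ballI)
    fix t p assume t: "t \<in> C" and "p \<in> P"
    then obtain k where k: "k \<in> K - {\<one>}" "p = {k, inv k}" by (auto simp: P_def)
    have tc: "t \<in> carrier G" "k \<in> carrier G" "t \<in> T" using t k kk cc C by auto
    have "conjg t k \<in> K" using n tc k by (simp add: normalizes_def)
    moreover have "conjg t k \<noteq> \<one>" using conj_eq_one[OF tc(1,2)] k(1) by auto
    ultimately show "\<theta> t p \<in> P" unfolding k(2) \<theta>P[OF tc(1,2)] by (auto simp: P_def)
  next
    fix t s p assume t: "t \<in> C" and s: "s \<in> C" and "p \<in> P"
    then obtain k where k: "k \<in> K - {\<one>}" "p = {k, inv k}" by (auto simp: P_def)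
    have tc: "t \<in> carrier G" "k \<in> carrier G" "s \<in> carrier G" using t s k kk cc by auto
    show "\<theta> (t \<otimes> s) p = \<theta> t (\<theta> s p)" using tc unfolding k(2) by (simp add: \<theta>_def group_word)
  next
    fix p assume "p \<in> P"
    then obtain k where k: "k \<in> K - {\<one>}" "p = {k, inv k}" by (auto simp: P_def)
    have "k \<in> carrier G" using k kk by auto
    then show "\<theta> \<one> p = p" unfolding k(2) by (simp add: \<theta>_def)
  qed
  define C' where "C' = fixer C \<theta> P"
  have C': "subgroup C' G" "C' \<subseteq> C" using fixer_sub[OF C(1) a\<theta> subset_refl] by (auto simp: C'_def fixer_def)
  have C'inv: "\<forall>k\<in>K. conjg t k = inv k" if t: "t \<in> C'" "t \<noteq> \<one>" for t
  proof -
    have tc: "t \<in> carrier G" "t \<in> C" using t C' cc by auto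
    have "conjg t k = k \<or> conjg t k = inv k" if k: "k \<in> K" for k
    proof (cases "k = \<one>")
      case True then show ?thesis using tc by simp
    next
      case False
      then have "{k, inv k} \<in> P" using k by (auto simp: P_def)
      then have "\<theta> t {k, inv k} = {k, inv k}" using t by (auto simp: C'_def fixer_def)
      then show ?thesis unfolding \<theta>P[OF tc(1) kk(1)[OF k]] by (auto simp: doubleton_eq_iff)
    qed
    from odd_fix_or_invert[OF K(1,2) tc(1) this] show ?thesis using central1[OF tc(2)] t(2) by blast
  qed
  have "\<exists>t0. C' \<subseteq> {\<one>, t0}"
  proof (cases "C' \<subseteq> {\<one>}")
    case False
    then obtain t0 where t0: "t0 \<in> C'" "t0 \<noteq> \<one>" by auto
    have "t = t0" if t: "t \<in> C'" "t \<noteq> \<one>" for t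
    proof -
      have c0: "t \<in> carrier G" "t0 \<in> carrier G" "inv t0 \<otimes> t \<in> C" using subsetD[OF C'(2) t(1)] subsetD[OF C'(2) t0(1)] cc by auto
      have "(inv t0 \<otimes> t) \<otimes> k \<otimes> inv (inv t0 \<otimes> t) = k" if k: "k \<in> K" for k
      proof -
        have kc: "k \<in> carrier G" using k kk by simp
        have "(inv t0 \<otimes> t) \<otimes> k \<otimes> inv (inv t0 \<otimes> t) = inv t0 \<otimes> (conjg t k) \<otimes> t0" using c0 kc by (simp add: group_word)
        also have "conjg t k = conjg t0 k" using C'inv[OF t] C'inv[OF t0] k by simp
        also have "inv t0 \<otimes> (conjg t0 k) \<otimes> t0 = k" using c0 kc by (simp add: group_word)
        finally show ?thesis .
      qed
      from central1[OF c0(3) this] have "inv t0 \<otimes> t = \<one>" .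
      then have "t0 \<otimes> (inv t0 \<otimes> t) = t0" using c0 by simp
      then show ?thesis using c0 by simp
    qed
    then show ?thesis by blast
  qed auto
  then obtain t0 where "C' \<subseteq> {\<one>, t0}" by blast
  then have cC': "card C' \<le> 2" using card_mono[of "{\<one>, t0}" C'] card_insert_le_m1[of 2 "{t0}" \<one>] by (simp add: le_trans)
  obtain j where j: "card C = 2 ^ j" using pow_two_dvd[OF C(1) T(1) C(2) T(2)] by auto
  have sC: "subgroup (sq C) G" by (rule sq_sub[OF C(1)])
  have "card C \<le> 2 ^ (c div 2) * card (sq C <#> C')"
    using two_group_bound[OF C(1) j fP a\<theta>] cP by (simp add: C'_def)
  also have "card (sq C <#> C') \<le> card (sq C) * 2"
  proof -
    have "card (sq C <#> C') \<le> card (sq C <#> C') * card (sq C \<inter> C')" using sub_pos[OF sub_Int[OF sC C'(1)]] by simp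
    also have "\<dots> = card (sq C) * card C'" by (rule set_mult_card[OF sC C'(1)])
    finally show ?thesis using cC' by (meson le_trans mult_le_mono2)
  qed
  finally have b2: "card C \<le> (2 ^ (c div 2) * 2) * card (sq C)" by (simp add: mult_ac)
  have triv: "{\<one>} \<subseteq> C" using cc(2) by simp
  from sq_index_trans[OF T(1) C triv_subgroup triv sTC b1 b2]
  have "card T \<le> 2 ^ (card Y div 2) * (2 ^ (c div 2) * 2) * card (sq T)"
    unfolding set_mult_one_right[OF sT] .
  then have "2 ^ (card D div 2) * card (sq T) \<le> 2 ^ (card Y div 2) * (2 ^ (c div 2) * 2) * card (sq T)" using tight by linarith
  then have "(2::nat) ^ (card D div 2) \<le> 2 ^ (card Y div 2) * (2 ^ (c div 2) * 2)" using sub_pos[OF sT] by simp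
  also have "\<dots> = 2 ^ (card Y div 2 + (c div 2 + 1))" by (simp add: power_add)
  finally have "card D div 2 \<le> card Y div 2 + (c div 2 + 1)" by (rule power_le_imp_le_exp[rotated]) simp
  \<comment> \<open>The exponent has dropped by \<open>c\<close>, whereas the action on the
    \<open>c\<close> pairs returns at most \<open>c div 2\<close> and the kernel \<open>C'\<close>
    of that action at most 1. So \<open>c \<le> c div 2 + 1\<close>.\<close>
  then have c2: "c = 1 \<or> c = 2" using cY c1 by presburger
  \<comment> \<open>For \<open>|K| = 5\<close> the group \<open>C\<close> acts semiregularly on the
    four nontrivial elements. Equality forces \<open>|C| = 4\<close> and
    \<open>sq T \<inter> C = {\<one>}\<close>, so \<open>C\<close> is transitive on them and has
    exponent 2. But an element taking \<open>x\<close> to \<open>x^2\<close> has a square taking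
    \<open>x\<close> to \<open>x^4\<close>, and \<open>x^4 = x\<close> is impossible.\<close>
  have "c \<noteq> 2"
  proof
    assume ceq: "c = 2"
    then have K5: "card K = 5" using c by simp
    define x where "x = k0"
    have x: "x \<in> K" "x \<noteq> \<one>" "x \<in> carrier G" using k0 kk by (auto simp: x_def)
    have semireg: "t = \<one>" if t: "t \<in> C" "conjg t x = x" for t
    proof -
      have tc: "t \<in> carrier G" using t cc by auto
      define B where "B = {k \<in> K. conjg t k = k}"
      have B: "subgroup B G"
      proof (rule subgroupI)
        show "B \<subseteq> carrier G" using kk by (auto simp: B_def)
        show "B \<noteq> {}" using x t by (auto simp: B_def)
        fix a assume a: "a \<in> B"
        then have ac: "a \<in> carrier G" "a \<in> K" using kk by (auto simp: B_def)
        have "inv (conjg t a) = inv a" using a by (simp add: B_def)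
        then show "inv a \<in> B" using ac tc kk(4) by (simp add: B_def group_word)
        fix b assume b: "b \<in> B"
        then have bc: "b \<in> carrier G" "b \<in> K" using kk by (auto simp: B_def)
        have "(conjg t a) \<otimes> (conjg t b) = a \<otimes> b" using a b by (simp add: B_def)
        then show "a \<otimes> b \<in> B" using ac bc tc kk(3) by (simp add: B_def group_word)
      qed
      have BK: "B \<subseteq> K" by (auto simp: B_def)
      have "card B dvd 5" using sub_card_dvd[OF B K(1) BK] K5 by simp
      then have "card B = 1 \<or> card B = 5" by (rule dvd_five_cases)
      moreover have "card B \<noteq> 1"
      proof
        assume "card B = 1"
        then obtain b where "B = {b}" by (rule card_1_singletonE)
        moreover have "x \<in> B" "\<one> \<in> B" using x t subD(2)[OF B] by (auto simp: B_def)
        ultimately show False using x by auto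
      qed
      ultimately have "B = K" using card_eq_sub[OF K(1) BK] K5 by simp
      then show ?thesis using central1[OF t(1)] by (auto simp: B_def)
    qed
    define f where "f = (\<lambda>t. conjg t x)"
    have fK: "f ` C \<subseteq> K - {\<one>}"
    proof
      fix y assume "y \<in> f ` C"
      then obtain t where t: "t \<in> C" "y = conjg t x" by (auto simp: f_def)
      have tc: "t \<in> carrier G" "t \<in> T" using t cc C by auto
      have "y \<in> K" using n tc x t by (simp add: normalizes_def)
      moreover have "y \<noteq> \<one>" using conj_eq_one[OF tc(1) x(3)] x(2) t(2) by auto
      ultimately show "y \<in> K - {\<one>}" by simp
    qed
    have finj: "inj_on f C"
    proof (rule inj_onI)
      fix t s assume ts: "t \<in> C" "s \<in> C" "f t = f s"
      have c0: "t \<in> carrier G" "s \<in> carrier G" "inv s \<otimes> t \<in> C" using ts cc by auto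
      have "(inv s \<otimes> t) \<otimes> x \<otimes> inv (inv s \<otimes> t) = inv s \<otimes> (conjg t x) \<otimes> s" using c0 x by (simp add: group_word)
      also have "\<dots> = inv s \<otimes> (conjg s x) \<otimes> s" using ts(3) by (simp add: f_def)
      also have "\<dots> = x" using c0 x by (simp add: group_word)
      finally have "inv s \<otimes> t = \<one>" using semireg[OF c0(3)] by simp
      then have "s \<otimes> (inv s \<otimes> t) = s" using c0 by simp
      then show "t = s" using c0 by simp
    qed
    have cK1: "card (K - {\<one>}) = 4" using K5 kk(2) sub_fin[OF K(1)] by simp
    have fK1: "finite (K - {\<one>})" using sub_fin[OF K(1)] by simp
    have C4: "card C \<le> 4" using card_mono[OF fK1 fK] card_image[OF finj] cK1 by simp
    have "2 ^ (card D div 2) * card (sq T) \<le> 2 ^ (card Y div 2) * card (sq T <#> C)" using tight b1 by linarith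
    then have "2 ^ (card Y div 2) * (4 * card (sq T)) \<le> 2 ^ (card Y div 2) * card (sq T <#> C)" using cY ceq by (simp add: power_add mult_ac)
    then have "4 * card (sq T) \<le> card (sq T <#> C)" by simp
    then have "4 * card (sq T) * card (sq T \<inter> C) \<le> card (sq T <#> C) * card (sq T \<inter> C)" by simp
    also have "\<dots> = card (sq T) * card C" by (rule set_mult_card[OF sT C(1)])
    finally have "card (sq T) * (4 * card (sq T \<inter> C)) \<le> card (sq T) * card C" by (simp add: mult_ac)
    then have i4: "4 * card (sq T \<inter> C) \<le> card C" using sub_pos[OF sT] by simp
    have ip: "card (sq T \<inter> C) > 0" by (rule sub_pos[OF sub_Int[OF sT C(1)]])
    have C4': "card C = 4" and i1: "card (sq T \<inter> C) = 1" using i4 C4 ip by linarith+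
    have "f ` C = K - {\<one>}" by (rule card_subset_eq[OF fK1 fK]) (use card_image[OF finj] C4' cK1 in simp)
    moreover have "x \<otimes> x \<in> K - {\<one>}" using x kk(3) odd_sub_square_one[OF K(1,2) x(1)] by auto
    ultimately obtain t where t: "t \<in> C" "conjg t x = x \<otimes> x" by (metis (no_types, lifting) f_def image_iff)
    have tc: "t \<in> carrier G" "t \<in> T" using t cc C by auto
    have "t \<otimes> t \<in> sq T \<inter> C" using sq_mem[OF tc(2)] cc(3)[OF t(1) t(1)] by simp
    moreover have "\<one> \<in> sq T \<inter> C" using subD(2)[OF sT] cc(2) by simp
    ultimately have t2: "t \<otimes> t = \<one>" using i1 by (metis card_1_singletonE singletonD)
    have "x = (t \<otimes> t) \<otimes> x \<otimes> inv (t \<otimes> t)" using t2 x by simp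
    also have "\<dots> = t \<otimes> (conjg t x) \<otimes> inv t" using tc x by (simp add: group_word)
    also have "\<dots> = t \<otimes> (x \<otimes> x) \<otimes> inv t" by (simp only: t(2))
    also have "\<dots> = (conjg t x) \<otimes> (conjg t x)" using tc x by (simp add: group_word)
    also have "\<dots> = x \<otimes> (x \<otimes> (x \<otimes> x))" using t(2) x by (simp add: m_assoc)
    finally have "x \<otimes> \<one> = x \<otimes> (x \<otimes> (x \<otimes> x))" using x by simp
    then have x3: "x \<otimes> (x \<otimes> x) = \<one>" using x by (metis l_cancel m_closed one_closed)
    have "x [^] (5::nat) = x \<otimes> (x \<otimes> (x \<otimes> (x \<otimes> x)))" using x by (simp add: eval_nat_numeral m_assoc)
    also have "\<dots> = x \<otimes> x" using x3 x by simp
    finally have "x \<otimes> x = \<one>" using pow_card_sub[OF K(1) x(1)] K5 by simp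
    then show False using odd_sub_square_one[OF K(1,2) x(1)] x(2) by simp
  qed
  then have "card K = 3" using c2 c by simp
  then show ?thesis using c\<Delta> oth by (auto simp: \<Delta>_def)
qed

end


section \<open>Supplements of the subgroup of squares\<close>

lemma two_odd_decomp: "n > 0 \<Longrightarrow> \<exists>m q. n = 2 ^ m * q \<and> odd (q::nat)"
proof (induction n rule: less_induct)
  case (less n)
  show ?case
  proof (cases "odd n")
    case True then show ?thesis by (intro exI[of _ 0] exI[of _ n]) simp
  next
    case False
    then obtain k where k: "n = 2 * k" by auto
    then obtain m q where "k = 2 ^ m * q" "odd q" using less.IH[of k] less.prems by auto
    then show ?thesis using k by (intro exI[of _ "Suc m"] exI[of _ q]) simp
  qed
qed

context fin_group begin

text \<open>A tuple generates \<open>G\<close> modulo \<open>S = sq G\<close> exactly when the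
  subgroup \<open>H\<close> that it generates satisfies \<open>S <#> H = G\<close>; the lemma lists
  where such a supplement can lie. The set \<open>\<Delta>\<close> is empty if the 2-complement
  \<open>K\<close> is trivial, and otherwise consists of the three points that \<open>K\<close>
  moves.\<close>

lemma tight_generation:
  fixes \<phi> :: "'a \<Rightarrow> 'c \<Rightarrow> 'c"
  assumes a: "acts (carrier G) \<phi> D" "finite D"
    and faith: "fixer (carrier G) \<phi> D = {\<one>}"
    and tight: "2 ^ (card D div 2) * card (sq (carrier G)) \<le> card (carrier G)"
  shows "card (carrier G) = 2 ^ (card D div 2) * card (sq (carrier G))"
    and "\<exists>\<Delta>\<subseteq>D. (\<Delta> = {} \<or> card \<Delta> = 3) \<and>
      (\<forall>\<delta>\<in>\<Delta>. 3 * card (fixer (carrier G) \<phi> {\<delta>}) = card (carrier G) \<and>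
          sq (carrier G) <#> fixer (carrier G) \<phi> {\<delta>} = carrier G) \<and>
      (\<forall>H. subgroup H G \<longrightarrow> sq (carrier G) <#> H = carrier G \<longrightarrow>
          H = carrier G \<or> (\<exists>\<delta>\<in>\<Delta>. H \<subseteq> fixer (carrier G) \<phi> {\<delta>}))"
proof -
  let ?G = "carrier G" and ?S = "sq (carrier G)"
  have S: "subgroup ?S G" by (rule sq_sub[OF sub_carrier])
  have nS: "normalizes ?G ?S" by (rule sq_normalized_self[OF sub_carrier])
  obtain d where d: "card ?G = 2 ^ d * card ?S"
    using index_over_sq[OF sub_carrier S subset_refl sq_subset[OF sub_carrier]] by blast
  obtain m q where oq: "card ?G = 2 ^ m * q" "odd q" using two_odd_decomp[OF sub_pos[OF sub_carrier]] by blast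
  obtain T where T: "subgroup T G" "card T = 2 ^ m"
    using sylow_thm[OF two_is_prime_nat is_group _ fin] oq(1) by (auto simp: order_def)
  note tt = subD[OF T(1)]
  have TG: "T \<subseteq> ?G" using subgroup.subset[OF T(1)] .
  have ST: "?S <#> T = ?G" by (rule odd_two_set_mult[OF S d nS T oq])
  have aT: "acts T \<phi> D" by (rule acts_mono[OF a(1) TG])
  have fT: "fixer T \<phi> D = {\<one>}" using faith TG tt(2) by (auto simp: fixer_def)
  have sT: "subgroup (sq T) G" by (rule sq_sub[OF T(1)])
  have bT: "card T \<le> 2 ^ (card D div 2) * card (sq T)"
    using two_group_bound[OF T a(2) aT] fT set_mult_one_right[OF sT] by simp
  have sTS: "sq T \<subseteq> T \<inter> ?S" using sq_mono[OF sub_carrier T(1) TG] sq_subset[OF T(1)] by auto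
  have e: "card ?G * card (?S \<inter> T) = card ?S * card T" using set_mult_card[OF S T(1)] ST by simp
  \<comment> \<open>A chain that closes up: \<open>|G : S| = |T : S \<inter> T|\<close> is at least
    \<open>2 ^ (card D div 2)\<close>, this is at least \<open>|T : sq T|\<close>, and
    \<open>sq T\<close> lies in \<open>S \<inter> T\<close>. Hence
    \<open>S \<inter> T = sq T\<close>.\<close>
  have "2 ^ (card D div 2) * card ?S * card (?S \<inter> T) \<le> card ?S * card T" unfolding e[symmetric] by (rule mult_right_mono[OF tight]) simp
  then have "card ?S * (2 ^ (card D div 2) * card (?S \<inter> T)) \<le> card ?S * card T" by (simp add: mult_ac)
  then have t1: "2 ^ (card D div 2) * card (?S \<inter> T) \<le> card T" using sub_pos[OF S] by simp
  then have "2 ^ (card D div 2) * card (?S \<inter> T) \<le> 2 ^ (card D div 2) * card (sq T)" using bT by linarith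
  then have "card (?S \<inter> T) \<le> card (sq T)" by simp
  then have foc: "?S \<inter> T = sq T" using card_seteq[OF _ sTS] sub_fin[OF sub_Int[OF S T(1)]] by (simp add: Int_commute)
  have tightT: "2 ^ (card D div 2) * card (sq T) \<le> card T" using t1 foc by simp
  have cT: "card T = 2 ^ (card D div 2) * card (sq T)" using tightT bT by simp
  have "card ?G * card (sq T) = (2 ^ (card D div 2) * card ?S) * card (sq T)" using e foc cT by (simp add: mult_ac)
  then show cG: "card ?G = 2 ^ (card D div 2) * card ?S" using sub_pos[OF sT] by simp
  obtain K where K: "subgroup K G" and nK: "normalizes ?G K" and KT1: "K \<inter> T = {\<one>}" and KT: "K <#> T = ?G" and oK: "odd (card K)"
    using two_complement[OF T oq] foc by (auto simp: Int_commute)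
  note kk = subD[OF K]
  have KG: "K \<subseteq> ?G" using subgroup.subset[OF K] .
  have KS: "K \<subseteq> ?S" by (rule odd_sub_sq[OF K oK sub_carrier KG])
  \<comment> \<open>In \<open>G / K\<close>, which is a copy of \<open>T\<close>, the image of
    \<open>S\<close> is the Frattini subgroup, whose elements are nongenerators. Otherwise
    \<open>(K <#> H) \<inter> T\<close> would lie in some proper \<open>M\<close> containing
    \<open>sq T\<close>; but the \<open>T\<close>-component of \<open>s \<otimes> h\<close> is the
    product of those of \<open>s\<close> and \<open>h\<close>, and both lie in
    \<open>M\<close>.\<close>
  have KH: "K <#> H = ?G" if H: "subgroup H G" and SH: "?S <#> H = ?G" for H
  proof -
    have HG: "H \<subseteq> ?G" using subgroup.subset[OF H] .
    have B: "subgroup (K <#> H) G" by (rule set_mult_subgroup[OF K H normalizes_mono[OF nK HG]])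
    have "(K <#> H) \<inter> T = T"
    proof (rule ccontr)
      assume ne: "(K <#> H) \<inter> T \<noteq> T"
      obtain M where M: "subgroup M G" "(K <#> H) \<inter> T \<subseteq> M" "M \<subset> T" "sq T \<subseteq> M"
        using two_group_frattini[OF T sub_Int[OF B T(1)] _ ne] by blast
      have "T \<subseteq> M"
      proof
        fix t assume t: "t \<in> T"
        then obtain s h where sh: "s \<in> ?S" "h \<in> H" "t = s \<otimes> h" using SH TG by (metis subsetD set_mult_iff)
        have scG: "s \<in> ?G" "h \<in> ?G" using sh subD(1)[OF S] HG by auto
        obtain k r where kr: "k \<in> K" "r \<in> T" "s = k \<otimes> r" using scG(1) KT by (metis set_mult_iff)
        obtain k1 r1 where kr1: "k1 \<in> K" "r1 \<in> T" "h = k1 \<otimes> r1" using scG(2) KT by (metis set_mult_iff)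
        have c: "k \<in> ?G" "r \<in> ?G" "k1 \<in> ?G" "r1 \<in> ?G" "t \<in> ?G" using kr kr1 kk tt t by auto
        have "inv k \<otimes> s \<in> ?S" using kr(1) KS sh(1) subD(3,4)[OF S] by blast
        then have "r \<in> ?S" using kr(3) c by simp
        then have rM: "r \<in> M" using foc kr(2) M(4) by blast
        have "inv k1 \<otimes> h \<in> K <#> H" using kk(4)[OF kr1(1)] sh(2) by (auto simp: set_mult_iff)
        then have "r1 \<in> K <#> H" using kr1(3) c by simp
        then have r1M: "r1 \<in> M" using kr1(2) M(2) by blast
        have "conjg r k1 \<in> K" using nK c(2) kr1(1) by (simp add: normalizes_def)
        then have "k \<otimes> (conjg r k1) \<in> K" using kr(1) kk(3) by blast
        moreover have e1: "k \<otimes> (conjg r k1) = t \<otimes> inv (r \<otimes> r1)" using sh(3) kr(3) kr1(3) c by (simp add: group_word)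
        moreover have "t \<otimes> inv (r \<otimes> r1) \<in> T" using t kr(2) kr1(2) tt by simp
        ultimately have "t \<otimes> inv (r \<otimes> r1) = \<one>" using KT1 by auto
        then have "t = r \<otimes> r1" using c by (metis inv_closed inv_inv m_closed inv_equality)
        then show "t \<in> M" using rM r1M subD(3)[OF M(1)] by simp
      qed
      then show False using M(3) by blast
    qed
    then have "T \<subseteq> K <#> H" by blast
    then have "K <#> T \<subseteq> K <#> H" by (rule set_mult_least[OF B set_mult_upper(1)[OF K H]])
    then show ?thesis using KT subgroup.subset[OF B] by blast
  qed
  show "\<exists>\<Delta>\<subseteq>D. (\<Delta> = {} \<or> card \<Delta> = 3) \<and>
      (\<forall>\<delta>\<in>\<Delta>. 3 * card (fixer ?G \<phi> {\<delta>}) = card ?G \<and> ?S <#> fixer ?G \<phi> {\<delta>} = ?G) \<and>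
      (\<forall>H. subgroup H G \<longrightarrow> ?S <#> H = ?G \<longrightarrow> H = ?G \<or> (\<exists>\<delta>\<in>\<Delta>. H \<subseteq> fixer ?G \<phi> {\<delta>}))"
  proof (cases "K = {\<one>}")
    case True
    have "H = ?G" if "subgroup H G" "?S <#> H = ?G" for H
    proof -
      have "K <#> H \<subseteq> H" by (rule set_mult_least[OF that(1)]) (use True subD(2)[OF that(1)] in auto)
      then show ?thesis using KH[OF that] subgroup.subset[OF that(1)] by blast
    qed
    then show ?thesis by (intro exI[of _ "{}"]) simp
  next
    case False
    define \<Delta> where "\<Delta> = {y \<in> D. \<exists>k\<in>K. \<phi> k y \<noteq> y}"
    have main: "card K = 3" "card \<Delta> = 3" "\<And>y. y \<in> \<Delta> \<Longrightarrow> (\<lambda>k. \<phi> k y) ` K = \<Delta>"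
      using tight_odd_normalized[OF T a faith tightT K oK False normalizes_mono[OF nK TG]] by (auto simp: \<Delta>_def)
    have \<Delta>D: "\<Delta> \<subseteq> D" by (auto simp: \<Delta>_def)
    have inv: "\<phi> g y \<in> \<Delta>" if g: "g \<in> ?G" and y: "y \<in> \<Delta>" for g y
    proof -
      obtain k where k: "y \<in> D" "k \<in> K" "\<phi> k y \<noteq> y" using y by (auto simp: \<Delta>_def)
      have c: "k \<in> ?G" using k kk by auto
      have gy: "\<phi> g y \<in> D" using actsD(1)[OF a(1) g k(1)] .
      have gk: "conjg g k \<in> K" using nK g k by (simp add: normalizes_def)
      have "\<phi> (conjg g k) (\<phi> g y) = \<phi> ((conjg g k) \<otimes> g) y"
        using actsD(2)[OF a(1) _ g k(1), of "conjg g k"] g c by simp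
      also have "(conjg g k) \<otimes> g = g \<otimes> k" using g c by (simp add: group_word)
      also have "\<phi> (g \<otimes> k) y = \<phi> g (\<phi> k y)" by (rule actsD(2)[OF a(1) g c k(1)])
      finally have "\<phi> (conjg g k) (\<phi> g y) \<noteq> \<phi> g y"
        using acts_inj[OF sub_carrier a(1) g actsD(1)[OF a(1) c k(1)] k(1)] k(3) by auto
      then show ?thesis using gk gy by (auto simp: \<Delta>_def)
    qed
    have st: "3 * card (fixer ?G \<phi> {\<delta>}) = card ?G \<and> ?S <#> fixer ?G \<phi> {\<delta>} = ?G" if d: "\<delta> \<in> \<Delta>" for \<delta>
    proof
      have dD: "\<delta> \<in> D" using d \<Delta>D by auto
      have orb: "(\<lambda>g. \<phi> g \<delta>) ` ?G = \<Delta>" using inv[OF _ d] main(3)[OF d] KG by blast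
      then show "3 * card (fixer ?G \<phi> {\<delta>}) = card ?G" using orbit_stab[OF sub_carrier a(1) dD] main(2) by simp
      have F: "subgroup (fixer ?G \<phi> {\<delta>}) G" by (rule fixer_sub[OF sub_carrier a(1)]) (use dD in simp)
      have "g \<in> ?S <#> fixer ?G \<phi> {\<delta>}" if g: "g \<in> ?G" for g
      proof -
        have "\<phi> g \<delta> \<in> (\<lambda>k. \<phi> k \<delta>) ` K" using main(3)[OF d] inv[OF g d] by simp
        then obtain k where k: "k \<in> K" "\<phi> g \<delta> = \<phi> k \<delta>" by auto
        have c: "k \<in> ?G" "inv k \<in> ?G" using k kk by auto
        have "\<phi> (inv k \<otimes> g) \<delta> = \<phi> (inv k) (\<phi> k \<delta>)" using actsD(2)[OF a(1) c(2) g dD] k by simp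
        also have "\<dots> = \<delta>" by (rule acts_inv(1)[OF sub_carrier a(1) c(1) dD])
        finally have "inv k \<otimes> g \<in> fixer ?G \<phi> {\<delta>}" using c g by (simp add: fixer_def)
        moreover have "g = k \<otimes> (inv k \<otimes> g)" using c g by simp
        ultimately show ?thesis using k(1) KS unfolding set_mult_iff by blast
      qed
      then show "?S <#> fixer ?G \<phi> {\<delta>} = ?G" using set_mult_least[OF sub_carrier subgroup.subset[OF S] subgroup.subset[OF F]] by blast
    qed
    have "H = ?G \<or> (\<exists>\<delta>\<in>\<Delta>. H \<subseteq> fixer ?G \<phi> {\<delta>})" if H: "subgroup H G" "?S <#> H = ?G" for H
    proof -
      have kh: "K <#> H = ?G" by (rule KH[OF H])
      have I: "subgroup (K \<inter> H) G" by (rule sub_Int[OF K H(1)])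
      have "card (K \<inter> H) dvd 3" using sub_card_dvd[OF I K] main(1) by simp
      then have "card (K \<inter> H) = 1 \<or> card (K \<inter> H) = 3"
      proof -
        assume b: "card (K \<inter> H) dvd 3"
        then have "card (K \<inter> H) \<le> 3" by (auto dest: dvd_imp_le)
        then have "card (K \<inter> H) = 0 \<or> card (K \<inter> H) = 1 \<or> card (K \<inter> H) = 2 \<or> card (K \<inter> H) = 3" by linarith
        then show ?thesis using b by (elim disjE) simp_all
      qed
      then show ?thesis
      proof
        assume "card (K \<inter> H) = 3"
        then have "K \<inter> H = K" using card_eq_sub[OF K, of "K \<inter> H"] main(1) by simp
        then have "K <#> H \<subseteq> H" by (intro set_mult_least[OF H(1)]) auto
        then show ?thesis using kh subgroup.subset[OF H(1)] by blast
      next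
        \<comment> \<open>Here \<open>H\<close> is a complement of \<open>K\<close>, thus a 2-group,
          and it fixes one of the three points by parity.\<close>
        assume 1: "card (K \<inter> H) = 1"
        have "card ?G = card K * card T" using set_mult_card[OF K T(1)] KT KT1 by simp
        moreover have "card ?G = card K * card H" using set_mult_card[OF K H(1)] kh 1 by simp
        ultimately have cH: "card H = 2 ^ m" using T(2) sub_pos[OF K] by simp
        have HG: "H \<subseteq> ?G" using subgroup.subset[OF H(1)] .
        have aH: "acts H \<phi> \<Delta>" by (rule acts_subset[OF a(1) HG \<Delta>D]) (use inv HG in auto)
        have f\<Delta>: "finite \<Delta>" using \<Delta>D a(2) finite_subset by blast
        have "odd (card {y \<in> \<Delta>. \<forall>t\<in>H. \<phi> t y = y})" using fixed_points_parity[OF H(1) cH f\<Delta> aH] main(2) by simp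
        then have "{y \<in> \<Delta>. \<forall>t\<in>H. \<phi> t y = y} \<noteq> {}" by (metis card.empty even_zero)
        then obtain \<delta> where "\<delta> \<in> \<Delta>" "\<forall>t\<in>H. \<phi> t \<delta> = \<delta>" by blast
        then show ?thesis using HG by (auto simp: fixer_def)
      qed
    qed
    then show ?thesis using \<Delta>D main(2) st by (intro exI[of _ \<Delta>]) blast
  qed
qed

section \<open>Counting generating tuples\<close>

text \<open>For \<open>W\<close> between \<open>sq B\<close> and \<open>B\<close> these are the
  tuples that span the vector space \<open>B / W\<close> over the field with two elements.\<close>

definition gens :: "'a set \<Rightarrow> 'a set \<Rightarrow> nat \<Rightarrow> (nat \<Rightarrow> 'a) set" where
  "gens B W k = {f \<in> {..<k} \<rightarrow>\<^sub>E B. generate G (W \<union> f ` {..<k}) = B}"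

end

text \<open>The probability that \<open>k\<close> random vectors span a \<open>d\<close>-dimensional
  space over the field with two elements. Reading them as the columns of a matrix, its
  \<open>d\<close> rows in a space of \<open>2 ^ k\<close> vectors must be independent, so row
  \<open>i\<close> avoids \<open>2 ^ i\<close> of them. For \<open>k < d\<close> the factor with
  \<open>i = k\<close> vanishes.\<close>

definition span_prob :: "nat \<Rightarrow> nat \<Rightarrow> real" where
  "span_prob k d = (\<Prod>i<d. 1 - 2 ^ i / 2 ^ k)"

lemma span_prob_Suc: "span_prob (Suc k) (Suc d) = (1 - 1 / 2 ^ Suc k) * span_prob k d"
proof -
  have "span_prob (Suc k) (Suc d) = (1 - 1 / 2 ^ Suc k) * (\<Prod>i<d. 1 - 2 ^ Suc i / 2 ^ Suc k)"
    unfolding span_prob_def by (subst prod.lessThan_Suc_shift) simp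
  also have "(\<Prod>i<d. 1 - 2 ^ Suc i / 2 ^ Suc k :: real) = span_prob k d" unfolding span_prob_def by simp
  finally show ?thesis .
qed

lemma span_prob_Suc_right: "span_prob k (Suc d) = span_prob k d * (1 - 2 ^ d / 2 ^ k)"
  by (simp add: span_prob_def)

text \<open>Conditioning on one of the vectors: it is zero with probability
  \<open>1 / 2 ^ Suc d\<close>, and otherwise the others have to span the quotient of dimension
  \<open>d\<close>.\<close>

lemma span_prob_rec:
  "span_prob (Suc k) (Suc d) = span_prob k (Suc d) / 2 ^ Suc d + (1 - 1 / 2 ^ Suc d) * span_prob k d"
  unfolding span_prob_Suc span_prob_Suc_right[of k d] by (simp add: field_simps)

context fin_group begin

lemma gens_Suc:
  assumes B: "finite B" 
  shows "card (gens B W (Suc k)) = (\<Sum>b\<in>B. card {g \<in> {..<k} \<rightarrow>\<^sub>E B. generate G (insert b W \<union> g ` {..<k}) = B})"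
proof -
  let ?A = "\<lambda>b. {g \<in> {..<k} \<rightarrow>\<^sub>E B. generate G (insert b W \<union> g ` {..<k}) = B}"
  let ?h = "\<lambda>(b,g). g(k := b)"
  have im: "(g(k := b)) ` {..<Suc k} = insert b (g ` {..<k})" for g :: "nat \<Rightarrow> 'a" and b
    by (auto simp: lessThan_Suc image_iff)
  have "gens B W (Suc k) = ?h ` (SIGMA b:B. ?A b)"
  proof (intro equalityI subsetI)
    fix f assume f: "f \<in> gens B W (Suc k)"
    then have fP: "f \<in> insert k {..<k} \<rightarrow>\<^sub>E B" by (simp add: gens_def lessThan_Suc)
    then obtain b g where bg: "b \<in> B" "g \<in> {..<k} \<rightarrow>\<^sub>E B" "f = g(k := b)"
      unfolding PiE_insert_eq by auto
    have "generate G (W \<union> f ` {..<Suc k}) = B" using f by (simp add: gens_def)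
    then have "generate G (insert b W \<union> g ` {..<k}) = B" unfolding bg(3) im by simp
    then have "(b, g) \<in> (SIGMA b:B. ?A b)" using bg by simp
    then show "f \<in> ?h ` (SIGMA b:B. ?A b)" using bg(3) by (metis (no_types, lifting) case_prod_conv image_eqI)
  next
    fix f assume "f \<in> ?h ` (SIGMA b:B. ?A b)"
    then obtain b g where bg: "b \<in> B" "g \<in> {..<k} \<rightarrow>\<^sub>E B" "generate G (insert b W \<union> g ` {..<k}) = B" "f = g(k := b)" by auto
    have "f \<in> insert k {..<k} \<rightarrow>\<^sub>E B" unfolding PiE_insert_eq using bg by auto
    moreover have "generate G (W \<union> f ` {..<Suc k}) = B" unfolding bg(4) im using bg(3) by simp
    ultimately show "f \<in> gens B W (Suc k)" by (simp add: gens_def lessThan_Suc)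
  qed
  moreover have "inj_on ?h (SIGMA b:B. ?A b)"
  proof (rule inj_onI)
    fix p p' assume p: "p \<in> (SIGMA b:B. ?A b)" "p' \<in> (SIGMA b:B. ?A b)" and h: "?h p = ?h p'"
    obtain b g b' g' where pg: "p = (b, g)" "p' = (b', g')" by (metis surj_pair)
    have g: "g \<in> {..<k} \<rightarrow>\<^sub>E B" "g' \<in> {..<k} \<rightarrow>\<^sub>E B" and e: "g(k := b) = g'(k := b')" using p h pg by auto
    have "b = b'" using e by (metis fun_upd_same)
    moreover have "g x = g' x" for x
    proof (cases "x = k")
      case True then show ?thesis using g by (simp add: PiE_def extensional_def)
    next
      case False then show ?thesis using e by (metis fun_upd_other)
    qed
    ultimately show "p = p'" using pg by auto
  qed
  moreover have "finite (?A b)" for b by (rule finite_subset[of _ "{..<k} \<rightarrow>\<^sub>E B"]) (use B in \<open>auto intro: finite_PiE\<close>)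
  ultimately show ?thesis using B by (simp add: card_image card_SigmaI)
qed

lemma generate_absorb:
  assumes "A \<subseteq> carrier G" "C \<subseteq> carrier G" "A \<subseteq> generate G C" "C \<subseteq> generate G A"
  shows "generate G A = generate G C"
  using generate_subgroup_incl[OF assms(3) generate_is_subgroup[OF assms(2)]]
    generate_subgroup_incl[OF assms(4) generate_is_subgroup[OF assms(1)]] by blast

text \<open>The choice of one entry \<open>b\<close> follows \<open>span_prob_rec\<close>: if
  \<open>b\<close> lies in \<open>W\<close> nothing changes, otherwise \<open>W\<close> is replaced
  by \<open>W \<union> (W #> b)\<close> and the dimension drops by one.\<close>

lemma card_gens:
  assumes B: "subgroup B G"
  shows "subgroup W G \<Longrightarrow> sq B \<subseteq> W \<Longrightarrow> W \<subseteq> B \<Longrightarrow> card B = 2 ^ d * card W \<Longrightarrow>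
    real (card (gens B W k)) = real (card B) ^ k * span_prob k d"
proof (induction k arbitrary: W d)
  case 0
  have "generate G W = W" using generate_subgroup_incl[OF subset_refl 0(1)] generate.incl[of _ W G] by blast
  then have "gens B W 0 = (if W = B then {\<lambda>_. undefined} else {})" by (auto simp: gens_def)
  moreover have "W = B \<longleftrightarrow> d = 0"
  proof
    assume "W = B"
    then have "(2::nat) ^ d = 1" using 0(4) sub_pos[OF B] by simp
    then show "d = 0" by simp
  next
    assume "d = 0" then show "W = B" using card_eq_sub[OF B 0(3)] 0(4) by simp
  qed
  moreover have "span_prob 0 d = (if d = 0 then 1 else 0)" by (auto simp: span_prob_def intro!: bexI[of _ 0])
  ultimately show ?case by simp
next
  case (Suc k)
  note W = Suc.prems(1)
  have Bc: "B \<subseteq> carrier G" using subgroup.subset[OF B] .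
  have fB: "finite B" using sub_fin[OF B] .
  let ?A = "\<lambda>b. {g \<in> {..<k} \<rightarrow>\<^sub>E B. generate G (insert b W \<union> g ` {..<k}) = B}"
  have nW: "normalizes B W" by (rule sq_normalizes_over[OF B W Suc.prems(2,3)])
  have inW: "real (card (?A b)) = real (card B) ^ k * span_prob k d" if "b \<in> W" for b
    using Suc.IH[OF Suc.prems] that by (simp add: gens_def insert_absorb)
  have d1: "W = B \<longleftrightarrow> d = 0"
  proof
    assume "W = B"
    then have "(2::nat) ^ d = 1" using Suc.prems(4) sub_pos[OF B] by simp
    then show "d = 0" by simp
  next
    assume "d = 0" then show "W = B" using card_eq_sub[OF B Suc.prems(3)] Suc.prems(4) by simp
  qed
  have notW: "real (card (?A b)) = real (card B) ^ k * span_prob k (d - 1)" if b: "b \<in> B" "b \<notin> W" for b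
  proof -
    have bc: "b \<in> carrier G" using b Bc by auto
    have b2: "b \<otimes> b \<in> W" using sq_mem[OF b(1)] Suc.prems(2) by blast
    have nb: "\<And>w. w \<in> W \<Longrightarrow> conjg b w \<in> W" using nW b by (simp add: normalizes_def)
    note big = insert_coset_subgroup[OF W bc b(2) b2 nb]
    let ?W = "W \<union> (W #> b)"
    have WB: "?W \<subseteq> B" using Suc.prems(3) b(1) by (auto simp: rcos_iff intro!: subD(3)[OF B])
    have "d \<noteq> 0" using d1 b by auto
    then obtain d' where d': "d = Suc d'" by (cases d) auto
    have "card B = 2 ^ d' * card ?W" using Suc.prems(4) big(2) d' by simp
    then have IH: "real (card (gens B ?W k)) = real (card B) ^ k * span_prob k d'"
      using Suc.IH[OF big(1) _ WB] Suc.prems(2) by blast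
    have "generate G (insert b W \<union> g ` {..<k}) = generate G (?W \<union> g ` {..<k})" if g: "g \<in> {..<k} \<rightarrow>\<^sub>E B" for g
    proof (rule generate_absorb)
      have gB: "g ` {..<k} \<subseteq> B" using g by auto
      show c1: "insert b W \<union> g ` {..<k} \<subseteq> carrier G" using b Suc.prems(3) gB Bc by blast
      show "?W \<union> g ` {..<k} \<subseteq> carrier G" using WB gB Bc by blast
      have "b \<in> W #> b" by (rule rcos_self[OF bc W])
      then show "insert b W \<union> g ` {..<k} \<subseteq> generate G (?W \<union> g ` {..<k})" by (auto intro: generate.incl)
      have "w \<otimes> b \<in> generate G (insert b W \<union> g ` {..<k})" if "w \<in> W" for w
        by (rule generate.eng) (use that in \<open>auto intro: generate.incl\<close>)
      then show "?W \<union> g ` {..<k} \<subseteq> generate G (insert b W \<union> g ` {..<k})" by (auto simp: rcos_iff intro: generate.incl)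
    qed
    then have "?A b = gens B ?W k" by (auto simp: gens_def)
    then show ?thesis using IH d' by simp
  qed
  have "real (card (gens B W (Suc k))) = (\<Sum>b\<in>B. real (card (?A b)))" by (simp add: gens_Suc[OF fB])
  also have "\<dots> = (\<Sum>b\<in>W. real (card (?A b))) + (\<Sum>b\<in>B - W. real (card (?A b)))"
    using sum.subset_diff[OF Suc.prems(3) fB] by (simp add: add.commute)
  also have "\<dots> = (\<Sum>b\<in>W. real (card B) ^ k * span_prob k d) + (\<Sum>b\<in>B - W. real (card B) ^ k * span_prob k (d - 1))"
    using inW notW by (intro arg_cong2[of _ _ _ _ "(+)"] sum.cong) auto
  also have "\<dots> = real (card W) * (real (card B) ^ k * span_prob k d) + (real (card B) - real (card W)) * (real (card B) ^ k * span_prob k (d - 1))"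
    using card_Diff_subset[OF sub_fin[OF W] Suc.prems(3)] card_mono[OF fB Suc.prems(3)] by (simp add: of_nat_diff)
  also have "\<dots> = real (card B) ^ Suc k * span_prob (Suc k) d"
  proof (cases d)
    case 0
    then show ?thesis using d1 by (simp add: span_prob_def)
  next
    case (Suc d')
    have cB: "real (card B) = 2 ^ Suc d' * real (card W)" using Suc.prems(4) Suc by simp
    have cW: "real (card W) = real (card B) / 2 ^ Suc d'" unfolding cB by simp
    show ?thesis unfolding Suc span_prob_rec cW by (simp add: field_simps)
  qed
  finally show ?case .
qed

text \<open>A tuple that generates modulo \<open>S\<close> and fails to generate \<open>G\<close>
  lies in the stabilizer \<open>F\<close> of one of the three points. Since
  \<open>S <#> F = G\<close>, the quotient \<open>F / (S \<inter> F)\<close> has the same dimension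
  as \<open>G / S\<close>, so each stabilizer accounts for the fraction \<open>1 / 3 ^ k\<close> of
  the tuples that generate modulo \<open>S\<close>.\<close>

lemma gen_prob_lower:
  fixes \<phi> :: "'a \<Rightarrow> 'c \<Rightarrow> 'c"
  assumes a: "acts (carrier G) \<phi> D" "finite D"
    and faith: "fixer (carrier G) \<phi> D = {\<one>}"
    and tight: "2 ^ (card D div 2) * card (sq (carrier G)) \<le> card (carrier G)"
  shows "(\<forall>k. span_prob k (card D div 2) \<le> gen_prob G k) \<or>
    (card D \<ge> 3 \<and> (\<forall>k. span_prob k (card D div 2) * (1 - 3 / 3 ^ k) \<le> gen_prob G k))"
proof -
  let ?G = "carrier G" and ?S = "sq (carrier G)" and ?d = "card D div 2"
  have S: "subgroup ?S G" by (rule sq_sub[OF sub_carrier])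
  have SG: "?S \<subseteq> ?G" by (rule subgroup.subset[OF S])
  have nS: "normalizes ?G ?S" by (rule sq_normalized_self[OF sub_carrier])
  have cG: "card ?G = 2 ^ ?d * card ?S" by (rule tight_generation(1)[OF assms])
  obtain \<Delta> where \<Delta>: "\<Delta> \<subseteq> D" "\<Delta> = {} \<or> card \<Delta> = 3"
    and st: "\<And>\<delta>. \<delta> \<in> \<Delta> \<Longrightarrow> 3 * card (fixer ?G \<phi> {\<delta>}) = card ?G \<and> ?S <#> fixer ?G \<phi> {\<delta>} = ?G"
    and alt: "\<And>H. subgroup H G \<Longrightarrow> ?S <#> H = ?G \<Longrightarrow> H = ?G \<or> (\<exists>\<delta>\<in>\<Delta>. H \<subseteq> fixer ?G \<phi> {\<delta>})"
    using tight_generation(2)[OF assms] by auto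
  define gen where "gen k = {f \<in> {..<k} \<rightarrow>\<^sub>E ?G. generate G (f ` {..<k}) = ?G}" for k :: nat
  have gp: "gen_prob G k = real (card (gen k)) / real (card ?G) ^ k" for k by (simp add: gen_prob_def gen_def)
  have Gpos: "real (card ?G) > 0" using sub_pos[OF sub_carrier] by simp
  have good: "real (card (gens ?G ?S k)) = real (card ?G) ^ k * span_prob k ?d" for k
    by (rule card_gens[OF sub_carrier S subset_refl SG cG])
  have fgens: "finite (gens B W k)" if "finite B" for B W k
    unfolding gens_def by (rule finite_subset[of _ "{..<k} \<rightarrow>\<^sub>E B"]) (use that in \<open>auto intro: finite_PiE\<close>)
  define bad where "bad \<delta> k = gens (fixer ?G \<phi> {\<delta>}) (?S \<inter> fixer ?G \<phi> {\<delta>}) k" for \<delta> k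
  have F: "subgroup (fixer ?G \<phi> {\<delta>}) G" if "\<delta> \<in> \<Delta>" for \<delta>
    by (rule fixer_sub[OF sub_carrier a(1)]) (use that \<Delta> in auto)
  have cover: "gens ?G ?S k \<subseteq> gen k \<union> (\<Union>\<delta>\<in>\<Delta>. bad \<delta> k)" for k
  proof
    fix f assume f: "f \<in> gens ?G ?S k"
    let ?I = "f ` {..<k}"
    have fP: "f \<in> {..<k} \<rightarrow>\<^sub>E ?G" and g: "generate G (?S \<union> ?I) = ?G" using f by (auto simp: gens_def)
    have IG: "?I \<subseteq> ?G" using fP by auto
    define H where "H = generate G ?I"
    have H: "subgroup H G" unfolding H_def by (rule generate_is_subgroup[OF IG])
    have IH: "?I \<subseteq> H" unfolding H_def by (auto intro: generate.incl)
    have full: "?S <#> L = ?G" if L: "subgroup L G" "?I \<subseteq> L" for L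
    proof -
      have SL: "subgroup (?S <#> L) G" by (rule set_mult_subgroup[OF S L(1) normalizes_mono[OF nS subgroup.subset[OF L(1)]]])
      have "generate G (?S \<union> ?I) \<subseteq> ?S <#> L"
        by (rule generate_subgroup_incl[OF _ SL]) (use set_mult_upper[OF S L(1)] L(2) in blast)
      then show ?thesis using g subgroup.subset[OF SL] by blast
    qed
    from alt[OF H full[OF H IH]] show "f \<in> gen k \<union> (\<Union>\<delta>\<in>\<Delta>. bad \<delta> k)"
    proof
      assume "H = ?G" then show ?thesis using fP by (simp add: gen_def H_def)
    next
      assume "\<exists>\<delta>\<in>\<Delta>. H \<subseteq> fixer ?G \<phi> {\<delta>}"
      then obtain \<delta> where d: "\<delta> \<in> \<Delta>" "H \<subseteq> fixer ?G \<phi> {\<delta>}" by blast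
      let ?F = "fixer ?G \<phi> {\<delta>}"
      define L where "L = generate G ((?S \<inter> ?F) \<union> ?I)"
      have sub: "(?S \<inter> ?F) \<union> ?I \<subseteq> ?F" using IH d(2) by blast
      have LF: "L \<subseteq> ?F" unfolding L_def by (rule generate_subgroup_incl[OF sub F[OF d(1)]])
      have L: "subgroup L G" unfolding L_def by (rule generate_is_subgroup) (use sub subgroup.subset[OF F[OF d(1)]] in blast)
      have SL: "?S <#> L = ?G" by (rule full[OF L]) (auto simp: L_def intro: generate.incl)
      \<comment> \<open>Dedekind's law: write an element of \<open>F\<close> as
        \<open>s \<otimes> l\<close> with \<open>l\<close> in \<open>L\<close>; then
        \<open>s\<close> lies in \<open>S \<inter> F\<close>, which is contained in
        \<open>L\<close>. So the tuple generates \<open>F\<close> modulo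
        \<open>S \<inter> F\<close>.\<close>
      have "?F \<subseteq> L"
      proof
        fix x assume x: "x \<in> ?F"
        then have "x \<in> ?S <#> L" using SL subgroup.subset[OF F[OF d(1)]] by blast
        then obtain s l where sl: "s \<in> ?S" "l \<in> L" "x = s \<otimes> l" by (auto simp: set_mult_iff)
        have lF: "l \<in> ?F" using sl LF by auto
        have c: "s \<in> ?G" "l \<in> ?G" using sl subD(1)[OF L] SG by auto
        have "x \<otimes> inv l \<in> ?F" using x lF subD[OF F[OF d(1)]] by blast
        then have "s \<in> ?F" using sl c by (simp add: m_assoc)
        then have "s \<in> L" unfolding L_def using sl by (auto intro: generate.incl)
        then show "x \<in> L" using sl subD(3)[OF L] by simp
      qed
      then have "L = ?F" using LF by blast
      moreover have "f \<in> {..<k} \<rightarrow>\<^sub>E ?F" using fP IH d(2) by (auto simp: PiE_iff)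
      ultimately have "f \<in> bad \<delta> k" by (simp add: bad_def gens_def L_def)
      then show ?thesis using d(1) by blast
    qed
  qed
  have fgen: "finite (gen k)" for k
    unfolding gen_def by (rule finite_subset[of _ "{..<k} \<rightarrow>\<^sub>E ?G"]) (use fin in \<open>auto intro: finite_PiE\<close>)
  from \<Delta>(2) show ?thesis
  proof
    assume e: "\<Delta> = {}"
    have "span_prob k ?d \<le> gen_prob G k" for k
    proof -
      have "card (gens ?G ?S k) \<le> card (gen k)" by (rule card_mono[OF fgen]) (use cover[of k] e in simp)
      then have "real (card ?G) ^ k * span_prob k ?d \<le> real (card (gen k))" using good[of k] by linarith
      then show ?thesis unfolding gp using Gpos by (simp add: field_simps)
    qed
    then show ?thesis by blast
  next
    assume c3: "card \<Delta> = 3"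
    have D3: "card D \<ge> 3" using card_mono[OF a(2) \<Delta>(1)] c3 by simp
    have "span_prob k ?d * (1 - 3 / 3 ^ k) \<le> gen_prob G k" for k
    proof -
      have bad: "real (card (bad \<delta> k)) = (real (card ?G) / 3) ^ k * span_prob k ?d" if d: "\<delta> \<in> \<Delta>" for \<delta>
      proof -
        let ?F = "fixer ?G \<phi> {\<delta>}"
        note FF = F[OF d]
        have "card ?G * card (?S \<inter> ?F) = card ?S * card ?F" using set_mult_card[OF S FF] st[OF d] by simp
        then have "card ?S * (2 ^ ?d * card (?S \<inter> ?F)) = card ?S * card ?F" unfolding cG by (simp add: mult_ac)
        then have cF: "card ?F = 2 ^ ?d * card (?S \<inter> ?F)" using sub_pos[OF S] by simp
        have "sq ?F \<subseteq> ?S \<inter> ?F" using sq_mono[OF sub_carrier FF subgroup.subset[OF FF]] sq_subset[OF FF] by blast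
        then have "real (card (bad \<delta> k)) = real (card ?F) ^ k * span_prob k ?d"
          unfolding bad_def by (intro card_gens[OF FF sub_Int[OF S FF] _ _ cF]) auto
        moreover have "real (card ?F) = real (card ?G) / 3" using st[OF d] by linarith
        ultimately show ?thesis by simp
      qed
      have f\<Delta>: "finite \<Delta>" using c3 by (metis card.infinite zero_neq_numeral)
      have fbad: "finite (bad \<delta> k)" if "\<delta> \<in> \<Delta>" for \<delta> unfolding bad_def by (rule fgens[OF sub_fin[OF F[OF that]]])
      have "card (gens ?G ?S k) \<le> card (gen k \<union> (\<Union>\<delta>\<in>\<Delta>. bad \<delta> k))"
        by (rule card_mono[OF _ cover]) (use fgen f\<Delta> fbad in auto)
      also have "\<dots> \<le> card (gen k) + card (\<Union>\<delta>\<in>\<Delta>. bad \<delta> k)" by (rule card_Un_le)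
      also have "\<dots> \<le> card (gen k) + (\<Sum>\<delta>\<in>\<Delta>. card (bad \<delta> k))" using card_UN_le[OF f\<Delta>] by simp
      finally have "real (card (gens ?G ?S k)) \<le> real (card (gen k)) + (\<Sum>\<delta>\<in>\<Delta>. real (card (bad \<delta> k)))"
        by (metis of_nat_add of_nat_le_iff of_nat_sum)
      also have "(\<Sum>\<delta>\<in>\<Delta>. real (card (bad \<delta> k))) = 3 * ((real (card ?G) / 3) ^ k * span_prob k ?d)"
        using bad c3 by simp
      finally have "real (card ?G) ^ k * span_prob k ?d - 3 * ((real (card ?G) / 3) ^ k * span_prob k ?d) \<le> real (card (gen k))"
        unfolding good by linarith
      then have "real (card ?G) ^ k * (span_prob k ?d * (1 - 3 / 3 ^ k)) \<le> real (card (gen k))"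
        by (simp add: power_divide algebra_simps)
      then show ?thesis unfolding gp using Gpos by (simp add: field_simps)
    qed
    then show ?thesis using D3 by blast
  qed
qed

section \<open>Complemented chief factors of order 2\<close>

lemma chief_series_from:
  "N \<lhd> G \<Longrightarrow> \<exists>Ns. Ns \<noteq> [] \<and> hd Ns = N \<and> last Ns = carrier G \<and> (\<forall>i < length Ns. Ns ! i \<lhd> G) \<and>
     (\<forall>i. Suc i < length Ns \<longrightarrow> Ns ! i \<subset> Ns ! Suc i \<and>
        \<not> (\<exists>M. M \<lhd> G \<and> Ns ! i \<subset> M \<and> M \<subset> Ns ! Suc i))"
proof (induction "card (carrier G) - card N" arbitrary: N rule: less_induct)
  case less
  have NG: "N \<subseteq> carrier G" using less.prems normal_imp_subgroup subgroup.subset by blast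
  show ?case
  proof (cases "N = carrier G")
    case True
    then show ?thesis using less.prems by (intro exI[of _ "[N]"]) auto
  next
    case False
    let ?P = "\<lambda>M. M \<lhd> G \<and> N \<subset> M"
    have "?P (carrier G)" using normal_self False NG by blast
    from ex_has_least_nat[of ?P, OF this, of card]
    obtain M where M: "M \<lhd> G" "N \<subset> M" and min: "\<And>L. L \<lhd> G \<Longrightarrow> N \<subset> L \<Longrightarrow> card M \<le> card L" by blast
    have MG: "M \<subseteq> carrier G" using M normal_imp_subgroup subgroup.subset by blast
    have fM: "finite M" using MG fin finite_subset by blast
    have "card N < card M" using M fM by (simp add: psubset_card_mono)
    moreover have "card M \<le> card (carrier G)" using MG fin by (simp add: card_mono)
    ultimately have "card (carrier G) - card M < card (carrier G) - card N" by simp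
    from less.hyps[OF this M(1)] obtain Ns where Ns: "Ns \<noteq> []" "hd Ns = M" "last Ns = carrier G"
      "\<forall>i < length Ns. Ns ! i \<lhd> G" "\<forall>i. Suc i < length Ns \<longrightarrow> Ns ! i \<subset> Ns ! Suc i \<and>
        \<not> (\<exists>M. M \<lhd> G \<and> Ns ! i \<subset> M \<and> M \<subset> Ns ! Suc i)" by blast
    have gap: "\<not> (\<exists>L. L \<lhd> G \<and> N \<subset> L \<and> L \<subset> M)"
      using min psubset_card_mono[OF fM] by (metis leD)
    have N0: "Ns ! 0 = M" using Ns(1,2) by (simp add: hd_conv_nth)
    have "(N # Ns) ! i \<lhd> G" if "i < length (N # Ns)" for i
      using that Ns(4) less.prems by (cases i) auto
    moreover have "(N # Ns) ! i \<subset> (N # Ns) ! Suc i \<and>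
        \<not> (\<exists>L. L \<lhd> G \<and> (N # Ns) ! i \<subset> L \<and> L \<subset> (N # Ns) ! Suc i)" if "Suc i < length (N # Ns)" for i
      using that Ns(5) N0 M(2) gap by (cases i) auto
    ultimately show ?thesis using Ns(1,3) by (intro exI[of _ "N # Ns"]) auto
  qed
qed

lemma index_two_sq:
  assumes K: "subgroup K G" and c: "card (carrier G) = 2 * card K"
  shows "sq (carrier G) \<subseteq> K"
proof (rule sq_least[OF K])
  note kk = subD[OF K]
  fix g assume g: "g \<in> carrier G"
  show "g \<otimes> g \<in> K"
  proof (cases "g \<in> K")
    case True then show ?thesis using kk by simp
  next
    case False
    have KG: "K \<subseteq> carrier G" "K #> g \<subseteq> carrier G" using subgroup.subset[OF K] r_coset_subset_G g by auto
    have "K \<inter> (K #> g) = {}"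
    proof (rule ccontr)
      assume "K \<inter> (K #> g) \<noteq> {}"
      then obtain h where h: "h \<in> K" "h \<otimes> g \<in> K" by (auto simp: rcos_iff)
      then have "inv h \<otimes> (h \<otimes> g) \<in> K" using kk by blast
      then show False using False h g kk(1) by simp
    qed
    then have "card (K \<union> (K #> g)) = card (carrier G)"
      using card_Un_disjoint[of K "K #> g"] card_rcos[OF K g] c KG fin finite_subset by (metis mult_2)
    then have "K \<union> (K #> g) = carrier G" using card_subset_eq[OF fin] KG by (metis Un_least)
    then have "g \<otimes> g \<in> K \<or> g \<otimes> g \<in> K #> g" using g by blast
    then show ?thesis
    proof
      assume "g \<otimes> g \<in> K #> g"
      then obtain h where "h \<in> K" "g \<otimes> g = h \<otimes> g" by (auto simp: rcos_iff)
      then show ?thesis using False g kk(1) by simp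
    qed
  qed
qed

text \<open>The complement \<open>K\<close> of a factor of order 2 has index 2 in \<open>G\<close>
  and so contains \<open>sq G\<close>. Hence \<open>K\<close> contains
  \<open>sq G <#> Ns ! i\<close> but not \<open>sq G <#> Ns ! Suc i\<close>, and the chain of these
  products at least doubles at each such factor.\<close>

lemma chief_count_le_index:
  assumes ch: "is_chief_series G Ns"
  shows "2 ^ count_compl_order2 G Ns * card (sq (carrier G)) \<le> card (carrier G)"
proof -
  let ?G = "carrier G" and ?S = "sq (carrier G)"
  have S: "subgroup ?S G" by (rule sq_sub[OF sub_carrier])
  have nS: "normalizes ?G ?S" by (rule sq_normalized_self[OF sub_carrier])
  have Ns: "Ns \<noteq> []" "Ns ! 0 = {\<one>}" "Ns ! (length Ns - 1) = ?G"
    using ch by (auto simp: is_chief_series_def hd_conv_nth last_conv_nth)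
  have nrm: "subgroup (Ns ! i) G" if "i < length Ns" for i
    using ch that unfolding is_chief_series_def by (blast intro: normal_imp_subgroup)
  have st: "Ns ! i \<subset> Ns ! Suc i" if "Suc i < length Ns" for i
    using ch that unfolding is_chief_series_def by blast
  define A where "A i = ?S <#> Ns ! i" for i
  have A: "subgroup (A i) G" if "i < length Ns" for i
    unfolding A_def by (rule set_mult_subgroup[OF S nrm[OF that] normalizes_mono[OF nS subgroup.subset[OF nrm[OF that]]]])
  have grow: "A i \<subseteq> A (Suc i)" if "Suc i < length Ns" for i
    using st[OF that] unfolding A_def set_mult_def by blast
  have strict: "2 * card (A i) \<le> card (A (Suc i))" if i: "Suc i < length Ns" and c: "compl_factor_order2 G Ns i" for i
  proof -
    have i': "i < length Ns" using i by simp
    note N = nrm[OF i'] and N' = nrm[OF i]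
    obtain K where K: "subgroup K G" "K <#> Ns ! Suc i = ?G" "K \<inter> Ns ! Suc i = Ns ! i" and two: "card (Ns ! Suc i) = 2 * card (Ns ! i)"
      using c by (auto simp: compl_factor_order2_def)
    have "card ?G * card (Ns ! i) = card K * (2 * card (Ns ! i))" using set_mult_card[OF K(1) N'] K two by simp
    then have "card ?G = 2 * card K" using sub_pos[OF N] by simp
    then have SK: "?S \<subseteq> K" by (rule index_two_sq[OF K(1)])
    have "A i \<noteq> A (Suc i)"
    proof
      assume e: "A i = A (Suc i)"
      have "Ns ! i \<subseteq> K" using K(3) by blast
      then have "A i \<subseteq> K" unfolding A_def by (rule set_mult_least[OF K(1) SK])
      moreover have "Ns ! Suc i \<subseteq> A (Suc i)" unfolding A_def by (rule set_mult_upper(2)[OF S N'])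
      ultimately have "Ns ! Suc i \<subseteq> K" using e by simp
      then have "Ns ! i = Ns ! Suc i" using K(3) by blast
      then show False using st[OF i] by simp
    qed
    moreover obtain r where r: "card (A (Suc i)) = card (A i) * r" using sub_card_dvd[OF A[OF i'] A[OF i] grow[OF i]] by blast
    ultimately have "r \<noteq> 1" using card_eq_sub[OF A[OF i] grow[OF i]] by auto
    moreover have "r \<noteq> 0" using r sub_pos[OF A[OF i]] by auto
    ultimately have "2 \<le> r" by simp
    then show ?thesis using r by simp
  qed
  have "j < length Ns \<Longrightarrow> 2 ^ card {i. i < j \<and> compl_factor_order2 G Ns i} * card ?S \<le> card (A j)" for j
  proof (induction j)
    case 0
    have "A 0 = ?S" unfolding A_def Ns(2) by (rule set_mult_one_right[OF S])
    then show ?case by simp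
  next
    case (Suc j)
    then have IH: "2 ^ card {i. i < j \<and> compl_factor_order2 G Ns i} * card ?S \<le> card (A j)" by simp
    show ?case
    proof (cases "compl_factor_order2 G Ns j")
      case True
      have "{i. i < Suc j \<and> compl_factor_order2 G Ns i} = insert j {i. i < j \<and> compl_factor_order2 G Ns i}" using True by (auto simp: less_Suc_eq)
      then have "card {i. i < Suc j \<and> compl_factor_order2 G Ns i} = Suc (card {i. i < j \<and> compl_factor_order2 G Ns i})" by simp
      then show ?thesis using IH strict[OF Suc.prems True] by simp
    next
      case False
      have "{i. i < Suc j \<and> compl_factor_order2 G Ns i} = {i. i < j \<and> compl_factor_order2 G Ns i}" using False by (auto simp: less_Suc_eq)
      then show ?thesis using IH card_mono[OF sub_fin[OF A[OF Suc.prems]] grow[OF Suc.prems]] by simp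
    qed
  qed
  from this[of "length Ns - 1"] have "2 ^ card {i. i < length Ns - 1 \<and> compl_factor_order2 G Ns i} * card ?S \<le> card (A (length Ns - 1))"
    using Ns(1) by simp
  also have "\<dots> \<le> card ?G" by (rule card_mono[OF fin subgroup.subset[OF A]]) (use Ns(1) in simp)
  also have "{i. i < length Ns - 1 \<and> compl_factor_order2 G Ns i} = {i. Suc i < length Ns \<and> compl_factor_order2 G Ns i}" by auto
  finally show ?thesis by (simp add: count_compl_order2_def)
qed

text \<open>The estimate holds for every chief series; existence of one ensures that the choice
  inside \<open>alpha21\<close> really is a chief series.\<close>

lemma alpha21_le_index: "2 ^ alpha21 G * card (sq (carrier G)) \<le> card (carrier G)"
proof -
  have "\<exists>Ns. is_chief_series G Ns" using chief_series_from[OF one_is_normal] by (simp add: is_chief_series_def)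
  then have "is_chief_series G (SOME Ns. is_chief_series G Ns)" by (rule someI_ex)
  then show ?thesis unfolding alpha21_def by (rule chief_count_le_index)
qed

lemma gen_prob_le_1: "gen_prob G k \<le> 1"
proof -
  have fp: "finite ({..<k} \<rightarrow>\<^sub>E carrier G)" using fin by (auto intro: finite_PiE)
  have "card {f \<in> {..<k} \<rightarrow>\<^sub>E carrier G. generate G (f ` {..<k}) = carrier G} \<le> card ({..<k} \<rightarrow>\<^sub>E carrier G)"
    by (rule card_mono[OF fp]) auto
  also have "\<dots> = card (carrier G) ^ k" by (simp add: card_PiE)
  finally have "real (card {f \<in> {..<k} \<rightarrow>\<^sub>E carrier G. generate G (f ` {..<k}) = carrier G}) \<le> real (card (carrier G)) ^ k"
    unfolding of_nat_power[symmetric] by (rule of_nat_mono)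
  moreover have "0 < real (card (carrier G)) ^ k" using sub_pos[OF sub_carrier] by simp
  ultimately show ?thesis unfolding gen_prob_def by (subst divide_le_eq_1_pos)
qed

end


section \<open>Comparison with the constant\<close>

text \<open>The probability that \<open>j + m\<close> random vectors span a space of dimension
  \<open>m\<close> over the field with two elements, see \<open>span_prob_eprod\<close>;
  \<open>j\<close> counts the surplus vectors.\<close>

definition eprod :: "nat \<Rightarrow> nat \<Rightarrow> real" where
  "eprod j m = (\<Prod>l<m. 1 - 1 / 2 ^ (j + Suc l))"

definition einf :: "nat \<Rightarrow> real" where
  "einf j = prodinf (\<lambda>l. 1 - 1 / 2 ^ (j + Suc l))"

lemma eprod_Suc: "eprod j (Suc m) = eprod j m * (1 - 1 / 2 ^ (j + Suc m))"
  by (simp add: eprod_def)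

lemma eprod_pos: "0 \<le> eprod j m"
  unfolding eprod_def
proof (intro prod_nonneg ballI)
  fix l
  have "(1::real) \<le> 2 ^ (j + Suc l)" by (rule one_le_power) simp
  then show "(0::real) \<le> 1 - 1 / 2 ^ (j + Suc l)" by (simp add: field_simps)
qed

lemma eprod_dec: "eprod j (Suc m) \<le> eprod j m"
  unfolding eprod_Suc using eprod_pos[of j m] by (intro mult_left_le) auto

lemma eprod_antimono: "m \<le> m' \<Longrightarrow> eprod j m' \<le> eprod j m"
  by (rule lift_Suc_antimono_le[of "eprod j"]) (auto simp: eprod_dec)

lemma eprod_le_1: "eprod j m \<le> 1"
  using eprod_antimono[of 0 m j] by (simp add: eprod_def)

text \<open>All partial products are at most 1, so the factor with index \<open>m\<close> costs at
  most \<open>1 / 2 ^ (j + Suc m)\<close>, and these losses telescope. The bound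
  \<open>1 - 1 / 2 ^ j\<close> that results for \<open>einf\<close> makes the series for the
  constant converge.\<close>

lemma eprod_ge: "1 - 1 / 2 ^ j + 1 / 2 ^ (j + m) \<le> eprod j m"
proof (induction m)
  case 0 then show ?case by (simp add: eprod_def)
next
  case (Suc m)
  have "eprod j m * (1 / 2 ^ (j + Suc m)) \<le> 1 * (1 / 2 ^ (j + Suc m))" by (intro mult_right_mono eprod_le_1) auto
  then have "eprod j m - 1 / 2 ^ (j + Suc m) \<le> eprod j (Suc m)" unfolding eprod_Suc by (simp add: algebra_simps)
  moreover have "1 / 2 ^ (j + m) - 1 / 2 ^ (j + Suc m) = (1 / 2 ^ (j + Suc m) :: real)" by (simp add: field_simps)
  ultimately show ?case using Suc by linarith
qed

lemma eprod_split: "eprod j (d + m) = eprod j d * eprod (j + d) m"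
proof (induction m)
  case 0 then show ?case by (simp add: eprod_def[of "j + d" 0])
next
  case (Suc m)
  then show ?case using eprod_Suc[of j "d + m"] eprod_Suc[of "j + d" m] by (simp add: add_ac mult_ac)
qed

lemma eprod_tendsto: "(\<lambda>m. eprod j m) \<longlonglongrightarrow> einf j"
proof -
  have e: "norm ((1 - 1 / 2 ^ (j + Suc l)) - 1 :: real) = (1/2) ^ Suc j * (1/2) ^ l" for l
    by (simp add: power_add power_one_over)
  have "summable (\<lambda>l. (1/2) ^ Suc j * (1/2::real) ^ l)" by (intro summable_mult summable_geometric) simp
  then have "summable (\<lambda>l. norm ((1 - 1 / 2 ^ (j + Suc l)) - 1 :: real))" unfolding e .
  then have "convergent_prod (\<lambda>l. 1 - 1 / 2 ^ (j + Suc l) :: real)"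
    by (intro abs_convergent_prod_imp_convergent_prod summable_imp_abs_convergent_prod)
  then have "(\<lambda>n. \<Prod>l\<le>n. 1 - 1 / 2 ^ (j + Suc l) :: real) \<longlonglongrightarrow> einf j"
    unfolding einf_def by (rule convergent_prod_LIMSEQ)
  then have "(\<lambda>n. eprod j (Suc n)) \<longlonglongrightarrow> einf j" by (simp add: eprod_def lessThan_Suc_atMost)
  then show ?thesis by (rule LIMSEQ_imp_Suc)
qed

lemma einf_le_eprod: "einf j \<le> eprod j m"
  by (rule LIMSEQ_le_const2[OF eprod_tendsto]) (use eprod_antimono in blast)

lemma einf_ge: "1 - 1 / 2 ^ j \<le> einf j"
proof (rule LIMSEQ_le_const[OF eprod_tendsto])
  have "1 - 1 / 2 ^ j \<le> eprod j m" for m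
  proof -
    have "(0::real) \<le> 1 / 2 ^ (j + m)" by simp
    then show ?thesis using eprod_ge[of j m] by linarith
  qed
  then show "\<exists>N. \<forall>n\<ge>N. 1 - 1 / 2 ^ j \<le> eprod j n" by blast
qed

lemma einf_le_1: "einf j \<le> 1"
  using einf_le_eprod[of j 0] by (simp add: eprod_def)

lemma einf_split: "einf j = eprod j d * einf (j + d)"
proof -
  have "(\<lambda>m. eprod j (d + m)) \<longlonglongrightarrow> einf j"
    using LIMSEQ_ignore_initial_segment[OF eprod_tendsto, of j d] by (simp add: add.commute)
  moreover have "(\<lambda>m. eprod j (d + m)) \<longlonglongrightarrow> eprod j d * einf (j + d)"
    unfolding eprod_split by (intro tendsto_intros eprod_tendsto)
  ultimately show ?thesis by (rule LIMSEQ_unique)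
qed

lemma span_prob_eprod: "span_prob (j + d) d = eprod j d"
proof (induction d)
  case 0 then show ?case by (simp add: span_prob_def eprod_def)
next
  case (Suc d)
  then show ?case using span_prob_Suc[of "j + d" d] by (simp add: eprod_Suc mult.commute)
qed

lemma span_prob_zero: "k < d \<Longrightarrow> span_prob k d = 0"
  unfolding span_prob_def by (rule prod_zero) (auto intro!: bexI[of _ k])

lemma summable_half: "summable (\<lambda>j. 1 / (2::real) ^ j)"
  using summable_geometric[of "1/2::real"] by (simp add: power_one_over)

lemma summable_nu: "summable (\<lambda>j. 1 - einf j)"
proof (rule summable_comparison_test'[OF summable_half])
  fix j show "norm (1 - einf j) \<le> 1 / 2 ^ j" using einf_ge[of j] einf_le_1[of j] by simp
qed

lemma nu_const_eq: "nu_const = suminf (\<lambda>j. 1 - einf j)"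
  by (simp add: nu_const_def einf_def)

text \<open>The defect of \<open>einf k\<close> is of order \<open>1 / 2 ^ k\<close> and dominates
  \<open>3 / 3 ^ k\<close> from \<open>k = 3\<close> on. At \<open>k = 2\<close> the inequality
  fails, since \<open>einf 2 \<ge> 3/4\<close> exceeds \<open>2/3\<close>. From \<open>k = 4\<close>
  on two factors suffice, with the linear bound \<open>1 - 3/5 * x\<close>,
  \<open>x = 1 / 2 ^ k\<close>, in between.\<close>

lemma einf_le_third:
  assumes "k \<ge> 3" shows "einf k \<le> 1 - 3 / 3 ^ k"
proof (cases "k = 3")
  case True
  \<comment> \<open>Four factors are needed: three of them still give about 0.894, which is above
    \<open>8/9\<close>.\<close>
  have "eprod 3 4 \<le> 1 - 3 / 3 ^ 3" by (simp add: eprod_def eval_nat_numeral)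
  then show ?thesis using einf_le_eprod[of 3 4] True by simp
next
  case False
  then have "k = (k - 4) + 4" using assms by simp
  then obtain i where i: "k = i + 4" by blast
  have a: "3 / 3 ^ (i + 4) \<le> (3 / 5) / (2::real) ^ (i + 4)"
  proof (induction i)
    case 0 then show ?case by simp
  next
    case (Suc i)
    have "3 / 3 ^ (Suc i + 4) = (3 / (3::real) ^ (i + 4)) / 3" by (simp only: add_Suc power_Suc) simp
    also have "\<dots> \<le> ((3 / 5) / 2 ^ (i + 4)) / 3" using Suc by (intro divide_right_mono) auto
    also have "\<dots> \<le> ((3 / 5) / 2 ^ (i + 4)) / 2" by (intro divide_left_mono) auto
    also have "\<dots> = (3 / 5) / 2 ^ (Suc i + 4)" by (simp only: add_Suc power_Suc) simp
    finally show ?case .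
  qed
  define x :: real where "x = 1 / 2 ^ (i + 4)"
  have x: "0 < x" "x \<le> 1 / 16" unfolding x_def by (auto simp: power_add field_simps)
  have "eprod k 2 = (1 - x / 2) * (1 - x / 4)" unfolding i eprod_def x_def by (simp add: eval_nat_numeral)
  also have "\<dots> \<le> 1 - 3 / 5 * x"
  proof -
    have "x * x \<le> x * (1/16)" using x by (intro mult_left_mono) auto
    then show ?thesis using x by (simp add: algebra_simps)
  qed
  also have "\<dots> \<le> 1 - 3 / 3 ^ k" using a unfolding i x_def by simp
  finally show ?thesis using einf_le_eprod[of k 2] by linarith
qed

text \<open>
  The terms are nonnegative except for \<open>d = 2\<close>, \<open>j = 0\<close>; the next four terms make up for that one.
\<close>

definition third_gap :: "nat \<Rightarrow> nat \<Rightarrow> real" where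
  "third_gap d j = eprod j d * (1 - 3 / 3 ^ (j + d)) - einf j"

lemma third_gap_nonneg: "j + d \<ge> 3 \<Longrightarrow> third_gap d j \<ge> 0"
  using mult_left_mono[OF einf_le_third[of "j + d"] eprod_pos[of j d]]
  unfolding third_gap_def einf_split[of j d] by simp

lemma third_gap_two_sum: "(\<Sum>j<5. third_gap 2 j) \<ge> 0"
proof -
  \<comment> \<open>Replacing each \<open>einf j\<close> by the larger \<open>eprod j 8\<close> only
    lowers the sum and leaves rational arithmetic.\<close>
  have "(\<Sum>j<5. eprod j 2 * (1 - 3 / 3 ^ (j + 2)) - eprod j 8) \<le> (\<Sum>j<5. third_gap 2 j)"
    unfolding third_gap_def by (intro sum_mono diff_left_mono einf_le_eprod)
  moreover have "(0::real) \<le> (\<Sum>j<5. eprod j 2 * (1 - 3 / 3 ^ (j + 2)) - eprod j 8)"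
    by (simp add: eprod_def eval_nat_numeral)
  ultimately show ?thesis by linarith
qed

text \<open>Fewer than \<open>d\<close> vectors never span dimension \<open>d\<close>, so the first
  \<open>d\<close> terms of the majorant are 1 and contribute \<open>d\<close>. The remaining terms
  are compared with the series of \<open>1 - einf j\<close>, where \<open>j\<close> counts the
  elements beyond \<open>d\<close>.\<close>

lemma expected_bound:
  fixes g :: "nat \<Rightarrow> real"
  assumes g1: "\<And>k. g k \<le> 1"
    and g: "(\<forall>k. span_prob k d \<le> g k) \<or> (d \<ge> 2 \<and> (\<forall>k. span_prob k d * (1 - 3 / 3 ^ k) \<le> g k))"
  shows "suminf (\<lambda>k. 1 - g k) \<le> real d + nu_const"
proof -
  \<comment> \<open>The parameter \<open>e\<close> treats both alternatives at once; it is the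
    number of point stabilizers to be avoided.\<close>
  obtain e :: real where e: "e = 0 \<or> (e = 3 \<and> d \<ge> 2)" and ge: "\<And>k. span_prob k d * (1 - e / 3 ^ k) \<le> g k"
  proof (cases "\<forall>k. span_prob k d \<le> g k")
    case True then show ?thesis using that[of 0] by simp
  next
    case False then show ?thesis using that[of 3] g by auto
  qed
  define b where "b k = 1 - span_prob k d * (1 - e / 3 ^ k)" for k
  have bd: "b (j + d) = 1 - eprod j d * (1 - e / 3 ^ (j + d))" for j by (simp add: b_def span_prob_eprod)
  have le: "1 - g k \<le> b k" "0 \<le> 1 - g k" for k using ge[of k] g1[of k] by (auto simp: b_def)
  have e0: "0 \<le> e" "e \<le> 3" using e by auto
  have "summable (\<lambda>j. b (j + d))"
  proof (rule summable_comparison_test')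
    show "summable (\<lambda>j. 1 / (2::real) ^ j + 3 * (1 / (3::real) ^ j))"
      using summable_geometric[of "1/3::real"] by (intro summable_add summable_half summable_mult) (simp add: power_one_over)
    fix j
    have "0 \<le> b (j + d)" using le[of "j + d"] by linarith
    have "eprod j d \<ge> 1 - 1 / 2 ^ j" 
    proof -
      have "(0::real) \<le> 1 / 2 ^ (j + d)" by simp
      then show ?thesis using eprod_ge[of j d] by linarith
    qed
    moreover have "eprod j d * (e / 3 ^ (j + d)) \<le> 1 * (3 / 3 ^ j)"
    proof (intro mult_mono eprod_le_1)
      show "e / 3 ^ (j + d) \<le> 3 / 3 ^ j" using e0 by (intro frac_le) auto
    qed (use e0 in auto)
    ultimately have "b (j + d) \<le> 1 / 2 ^ j + 3 * (1 / 3 ^ j)" unfolding bd by (simp add: algebra_simps)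
    then show "norm (b (j + d)) \<le> 1 / 2 ^ j + 3 * (1 / 3 ^ j)" using \<open>0 \<le> b (j + d)\<close> by simp
  qed
  then have sb: "summable b" using summable_iff_shift by blast
  have sg: "summable (\<lambda>k. 1 - g k)" by (rule summable_comparison_test'[OF sb]) (use le in auto)
  have "suminf (\<lambda>k. 1 - g k) \<le> suminf b" by (rule suminf_le[OF _ sg sb]) (use le in auto)
  also have "suminf b = suminf (\<lambda>j. b (j + d)) + (\<Sum>k<d. b k)" by (rule suminf_split_initial_segment[OF sb])
  also have "(\<Sum>k<d. b k) = real d" by (simp add: b_def span_prob_zero)
  also have "suminf (\<lambda>j. b (j + d)) \<le> nu_const"
  proof -
    define t where "t j = (1 - einf j) - b (j + d)" for j
    have st: "summable t" unfolding t_def by (intro summable_diff summable_nu) fact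
    have tt: "t j = eprod j d * (1 - e / 3 ^ (j + d)) - einf j" for j by (simp add: t_def bd)
    have "0 \<le> suminf t"
    proof (cases "e = 0")
      case True
      have "0 \<le> t j" for j unfolding tt using True einf_le_eprod[of j d] by simp
      then show ?thesis using st by (simp add: suminf_nonneg)
    next
      case False
      then have e3: "e = 3" "d \<ge> 2" using e by auto
      have td: "t = third_gap d" by (rule ext) (simp add: tt third_gap_def e3)
      show ?thesis
      proof (cases "d = 2")
        case True
        have "(\<Sum>j<5. third_gap 2 j) \<le> suminf t" unfolding td True
          by (rule sum_le_suminf) (use st td True third_gap_nonneg in auto)
        then show ?thesis using third_gap_two_sum by linarith
      next
        case False
        then have "0 \<le> t j" for j unfolding td using e3 by (intro third_gap_nonneg) simp
        then show ?thesis using st by (simp add: suminf_nonneg)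
      qed
    qed
    also have "suminf t = nu_const - suminf (\<lambda>j. b (j + d))" unfolding t_def nu_const_eq
      by (rule suminf_diff[symmetric]) (fact summable_nu, fact)
    finally show ?thesis by simp
  qed
  finally show ?thesis by simp
qed

theorem theorem11:
  fixes n :: nat and H :: "(nat \<Rightarrow> nat) set"
  assumes "subgroup H (sym_group n)"
    and "n \<noteq> 3"
    and "alpha21 ((sym_group n)\<lparr>carrier := H\<rparr>) = n div 2"
  shows "expected_gen ((sym_group n)\<lparr>carrier := H\<rparr>) \<le> real (n div 2) + nu_const"
proof -
  let ?G = "(sym_group n)\<lparr>carrier := H\<rparr>"
  have perm: "p permutes {1..n}" if "p \<in> H" for p
    using subgroup.subset[OF assms(1)] that by (auto simp: sym_group_def)
  have "finite H" by (rule finite_subset[OF _ finite_permutations[of "{1..n}"]]) (use perm in auto)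
  then interpret fin_group ?G
    using subgroup.subgroup_is_group[OF assms(1) sym_group_is_group] by (simp add: fin_group_def fin_group_axioms_def)
  have a: "acts (carrier ?G) (\<lambda>p x. p x) {1..n}"
    unfolding acts_def using permutes_in_image[OF perm] by (simp add: sym_group_mult sym_group_one)
  have "p = id" if "p \<in> H" "\<And>x. x \<in> {1..n} \<Longrightarrow> p x = x" for p
  proof
    fix x show "p x = id x" using that(2)[of x] permutes_not_in[OF perm[OF that(1)], of x] by (cases "x \<in> {1..n}") simp_all
  qed
  moreover have "id \<in> H" using subgroup.one_closed[OF assms(1)] by (simp add: sym_group_one)
  ultimately have f: "fixer (carrier ?G) (\<lambda>p x. p x) {1..n} = {\<one>\<^bsub>?G\<^esub>}"
    by (auto simp: fixer_def sym_group_one)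
  have "2 ^ (card {1..n} div 2) * card (sq (carrier ?G)) \<le> card (carrier ?G)"
    using alpha21_le_index assms(3) by simp
  \<comment> \<open>In the second alternative there are at least three points, so
    \<open>n \<noteq> 3\<close> gives \<open>n \<ge> 4\<close> and \<open>n div 2 \<ge> 2\<close>,
    as the comparison with the constant requires.\<close>
  from gen_prob_lower[OF a finite_atLeastAtMost f this]
  have "(\<forall>k. span_prob k (n div 2) \<le> gen_prob ?G k) \<or> (n div 2 \<ge> 2 \<and> (\<forall>k. span_prob k (n div 2) * (1 - 3 / 3 ^ k) \<le> gen_prob ?G k))"
    using assms(2) by auto
  then show ?thesis unfolding expected_gen_def by (intro expected_bound gen_prob_le_1)
qed

end
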